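(* Let $\Lambda$ be the $2$-graph with one vertex $v$, two edges $f_1,f_2$ of degree $e_1$, one edge $e$ of degree $e_2$, and factorization rules $f_1e=ef_2$, $f_2e=ef_1$. Let $(\gamma_n)_{n\ge1}$ be real numbers with $|\gamma_n|<\frac12$ and $\sum_{n=1}^\infty|\gamma_n|<\infty$. For $g_1,g_2,\dots\in\{f_1,f_2\}$ put $\alpha_i=\frac12+\gamma_i$ if $g_i=f_1$ and $\alpha_i=\frac12-\gamma_i$ if $g_i=f_2$, and define $\mu$ on square cylinder sets by $$\mu\big(Z(eg_1eg_2\cdots eg_n)\big)=\prod_{i=1}^n\alpha_i,\qquad \mu(Z(v))=1.$$ Then: (a) The function $\mu$ extends uniquely to a Borel probability measure on $\Lambda^\infty$, and the standard prefixing and coding maps $(\sigma_\lambda,\sigma^n)$ endow $(\Lambda^\infty,\mu)$ with a $\Lambda$-semibranching function system. (b) Each such measure $\mu$ is equivalent (mutually absolutely continuous) to the Perron--Frobenius measure $M$ on $\Lambda^\infty$. (c) The $\Lambda$-semibranching representation of $C^*(\Lambda)$ on $L^2(\Lambda^\infty,\mu)$ is unitarily equivalent to the standard $\Lambda$-semibranching representation on $L^2(\Lambda^\infty,M)$. In particular, the $\Lambda$-semibranching representations on such spaces $L^2(\Lambda^\infty,\mu)$ are all unitarily equivalent.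
   Context: $\mathbb N=\{0,1,2,\dots\}$. A $k$-graph is a countable small category $\Lambda$ with a degree functor $d:\Lambda\to\mathbb N^k$ such that if $d(\lambda)=m+n$ there are unique $\mu,\nu$ with $\lambda=\mu\nu$, $d(\mu)=m$, $d(\nu)=n$. $\Lambda^n=d^{-1}(n)$; $\Lambda^0$ is the set of objects (vertices); $r,s$ are range and source; $v\Lambda^n=\{\lambda\in\Lambda^n:r(\lambda)=v\}$; $s(\lambda)\Lambda=\{\nu:r(\nu)=s(\lambda)\}$. $\Omega_k$ is the $k$-graph with objects $\mathbb N^k$, morphisms $\{(p,q):p\le q\}$, $r(p,q)=p$, $s(p,q)=q$, $d(p,q)=q-p$. $\Lambda^\infty$ is the set of degree-preserving functors $x:\Omega_k\to\Lambda$ (infinite paths), $r(x)=x(0)$. Cylinder sets $Z(\lambda)=\{x\in\Lambda^\infty:x(0,d(\lambda))=\lambda\}$ form a basis for the topology of $\Lambda^\infty$. In the $2$-graph of the claim, every path of degree $(n,n)$ is uniquely of the form $eg_1eg_2\cdots eg_n$ with $g_i\in\{f_1,f_2\}$; its cylinder set is called a square cylinder set. Standard coding maps: $\sigma^m(x)(p,q)=x(p+m,q+m)$ for $m\in\mathbb N^k$. Standard prefixing maps: $\sigma_\lambda:Z(s(\lambda))\to Z(\lambda)$, $\sigma_\lambda(x)=\lambda x$ (the infinite path with initial segment $\lambda$ and $\sigma^{d(\lambda)}(\lambda x)=x$). Here $D_\lambda=Z(s(\lambda))$, $R_\lambda=Z(\lambda)$. Semibranching function system: finitely many measurable maps $\sigma_i:D_i\to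 X$, $D_i\subset X$ measurable, such that with $R_i=\sigma_i(D_i)$: $\mu(X\setminus\bigcup_iR_i)=0$, $\mu(R_i\cap R_j)=0$ for $i\ne j$, and $\Phi_{\sigma_i}=\frac{d(\mu\circ\sigma_i)}{d\mu}>0$ $\mu$-a.e. on $D_i$. A measurable $\sigma:X\to X$ is a coding map if $\sigma\circ\sigma_i(x)=x$ for $x\in D_i$. A $\Lambda$-semibranching function system on $(X,\mu)$ ($\Lambda$ a finite $k$-graph) consists of measurable sets $\{D_\lambda\}_{\lambda\in\Lambda}$, prefixing maps $\tau_\lambda:D_\lambda\to X$ and coding maps $\tau^m:X\to X$ ($m\in\mathbb N^k$) with: (a) for each $m$, $\{\tau_\lambda:d(\lambda)=m\}$ is a semibranching function system with coding map $\tau^m$; (b) $\tau_v=\mathrm{id}$, $\mu(D_v)>0$ for $v\in\Lambda^0$; (c) with $R_\lambda=\tau_\lambda(D_\lambda)$, for $\nu\in s(\lambda)\Lambda$, $R_\nu\subseteq D_\lambda$ up to a null set and $\tau_\lambda\tau_\nu=\tau_{\lambda\nu}$ a.e.; (d) $\tau^m\circ\tau^n=\tau^{m+n}$. $C^*(\Lambda)$ is the universal $C^*$-algebra generated by partial isometries $\{t_\lambda\}_{\lambda\in\Lambda}$ with: $t_v$ ($v\in\Lambda^0$) mutually orthogonal projections; $t_\lambda t_\eta=t_{\lambda\eta}$ if $s(\lambda)=r(\eta)$; $t_\lambda^*t_\lambda=t_{s(\lambda)}$; $t_v=\sum_{\lambda\in v\Lambda^n}t_\lambda t_\lambda^*$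 for all $v\in\Lambda^0,n\in\mathbb N^k$. For a finite source-free $\Lambda$, the $\Lambda$-semibranching representation of $C^*(\Lambda)$ attached to a $\Lambda$-semibranching function system on $(X,\mu)$ is $t_\lambda\mapsto S_\lambda\in B(L^2(X,\mu))$, $S_\lambda\xi(x)=\chi_{R_\lambda}(x)\,\Phi_{\tau_\lambda}(\tau^{d(\lambda)}(x))^{-1/2}\,\xi(\tau^{d(\lambda)}(x))$. The Perron--Frobenius measure $M$ of a finite strongly connected $k$-graph is the Borel probability measure on $\Lambda^\infty$ with $M(Z(\lambda))=\rho(\Lambda)^{-d(\lambda)}\kappa^\Lambda_{s(\lambda)}$, where $\rho(\Lambda)=(\rho_1,\dots,\rho_k)$ are the spectral radii of the vertex matrices $A_i(v,w)=|v\Lambda^{e_i}w|$ (with $v\Lambda^{e_i}w$ the set of $\lambda\in\Lambda^{e_i}$ with $r(\lambda)=v$, $s(\lambda)=w$), $\rho(\Lambda)^n=\prod\rho_i^{n_i}$, and $\kappa^\Lambda$ is the positive vector of $\ell^1$-norm $1$ with $A_i\kappa^\Lambda=\rho_i\kappa^\Lambda$ for all $i$; for the $2$-graph of the claim this reads $M(Z(\lambda))=2^{-n_1}$ for $d(\lambda)=(n_1,n_2)$. The standard $\Lambda$-semibranching representation is the one attached to the standard prefixing and coding maps on $(\Lambda^\infty,M)$. *)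

theory Defs
  imports "HOL-Probability.Probability" "HOL-Algebra.Module"
begin

section \<open>Higher-rank graphs and their infinite paths\<close>

text \<open>
  Categories are given by their morphisms only: an object is identified with its identity
  morphism, so \<open>src\<close> and \<open>rng\<close> return morphisms, and \<open>cmp l \<mu>\<close> is the composite
  \<open>l\<mu>\<close>, relevant only when \<open>src l = rng \<mu>\<close>.  The degree monoid \<open>\<nat>\<^sup>k\<close> is
  \<open>nat ^ 'k\<close> with its componentwise order.
\<close>

record ('a, 'k :: finite) kgraph_data =
  mor :: "'a set"
  src :: "'a \<Rightarrow> 'a"
  rng :: "'a \<Rightarrow> 'a"
  cmp :: "'a \<Rightarrow> 'a \<Rightarrow> 'a"
  deg :: "'a \<Rightarrow> nat ^ 'k"

locale small_category =
  fixes L :: "('a, 'k :: finite) kgraph_data"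
  assumes src_mor: "l \<in> mor L \<Longrightarrow> src L l \<in> mor L"
    and rng_mor: "l \<in> mor L \<Longrightarrow> rng L l \<in> mor L"
    and src_src: "l \<in> mor L \<Longrightarrow> src L (src L l) = src L l"
    and rng_src: "l \<in> mor L \<Longrightarrow> rng L (src L l) = src L l"
    and src_rng: "l \<in> mor L \<Longrightarrow> src L (rng L l) = rng L l"
    and rng_rng: "l \<in> mor L \<Longrightarrow> rng L (rng L l) = rng L l"
    and cmp_mor: "\<lbrakk>l \<in> mor L; \<mu> \<in> mor L; src L l = rng L \<mu>\<rbrakk> \<Longrightarrow> cmp L l \<mu> \<in> mor L"
    and rng_cmp: "\<lbrakk>l \<in> mor L; \<mu> \<in> mor L; src L l = rng L \<mu>\<rbrakk> \<Longrightarrow> rng L (cmp L l \<mu>) = rng L l"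
    and src_cmp: "\<lbrakk>l \<in> mor L; \<mu> \<in> mor L; src L l = rng L \<mu>\<rbrakk> \<Longrightarrow> src L (cmp L l \<mu>) = src L \<mu>"
    and cmp_assoc: "\<lbrakk>l \<in> mor L; \<mu> \<in> mor L; \<nu> \<in> mor L; src L l = rng L \<mu>; src L \<mu> = rng L \<nu>\<rbrakk>
      \<Longrightarrow> cmp L (cmp L l \<mu>) \<nu> = cmp L l (cmp L \<mu> \<nu>)"
    and cmp_rng: "l \<in> mor L \<Longrightarrow> cmp L (rng L l) l = l"
    and cmp_src: "l \<in> mor L \<Longrightarrow> cmp L l (src L l) = l"

locale kgraph = small_category L for L :: "('a, 'k :: finite) kgraph_data" +
  assumes countable_mor: "countable (mor L)"
    and deg_identity: "l \<in> mor L \<Longrightarrow> deg L (src L l) = 0 \<and> deg L (rng L l) = 0"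
    and deg_cmp: "\<lbrakk>l \<in> mor L; \<mu> \<in> mor L; src L l = rng L \<mu>\<rbrakk>
      \<Longrightarrow> deg L (cmp L l \<mu>) = deg L l + deg L \<mu>"
    and factorization: "\<lbrakk>l \<in> mor L; deg L l = m + n\<rbrakk>
      \<Longrightarrow> \<exists>!(\<mu>, \<nu>). \<mu> \<in> mor L \<and> \<nu> \<in> mor L \<and> src L \<mu> = rng L \<nu> \<and>
            l = cmp L \<mu> \<nu> \<and> deg L \<mu> = m \<and> deg L \<nu> = n"

definition paths_of_degree :: "('a, 'k :: finite) kgraph_data \<Rightarrow> nat ^ 'k \<Rightarrow> 'a set" where
  "paths_of_degree L n = {l \<in> mor L. deg L l = n}"

abbreviation vertices :: "('a, 'k :: finite) kgraph_data \<Rightarrow> 'a set" where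
  "vertices L \<equiv> paths_of_degree L 0"

definition Omega :: "((nat ^ 'k) \<times> (nat ^ 'k), 'k :: finite) kgraph_data" where
  "Omega = \<lparr>mor = {(p, q). p \<le> q}, src = (\<lambda>(p, q). (q, q)), rng = (\<lambda>(p, q). (p, p)),
            cmp = (\<lambda>(p, q) (q', r). (p, r)), deg = (\<lambda>(p, q). q - p)\<rparr>"

definition degree_functor ::
  "('a, 'k :: finite) kgraph_data \<Rightarrow> ('b, 'k) kgraph_data \<Rightarrow> ('a \<Rightarrow> 'b) \<Rightarrow> bool" where
  "degree_functor K L F \<longleftrightarrow>
     (\<forall>l\<in>mor K. F l \<in> mor L \<and> src L (F l) = F (src K l) \<and> rng L (F l) = F (rng K l) \<and>
                  deg L (F l) = deg K l) \<and>
     (\<forall>l\<in>mor K. \<forall>\<mu>\<in>mor K. src K l = rng K \<mu> \<longrightarrow> F (cmp K l \<mu>) = cmp L (F l) (F \<mu>))"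

type_synonym ('a, 'k) infpath = "(nat ^ 'k) \<times> (nat ^ 'k) \<Rightarrow> 'a"

text \<open>
  Infinite paths are extensional (\<open>undefined\<close> off the morphisms of \<open>Omega\<close>), so that equality of
  HOL functions is equality of functors.
\<close>

definition infinite_paths :: "('a, 'k :: finite) kgraph_data \<Rightarrow> ('a, 'k) infpath set" where
  "infinite_paths L = {x \<in> extensional (mor Omega). degree_functor Omega L x}"

definition cylinder :: "('a, 'k :: finite) kgraph_data \<Rightarrow> 'a \<Rightarrow> ('a, 'k) infpath set" where
  "cylinder L l = {x \<in> infinite_paths L. x (0, deg L l) = l}"

definition path_topology :: "('a, 'k :: finite) kgraph_data \<Rightarrow> ('a, 'k) infpath topology" where
  "path_topology L = topology_generated_by (cylinder L ` mor L)"

definition path_borel :: "('a, 'k :: finite) kgraph_data \<Rightarrow> ('a, 'k) infpath measure" where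
  "path_borel L = sigma (infinite_paths L) {U. openin (path_topology L) U}"

definition path_shift :: "nat ^ 'k \<Rightarrow> ('a, 'k :: finite) infpath \<Rightarrow> ('a, 'k) infpath" where
  "path_shift m x = (\<lambda>(p, q)\<in>mor Omega. x (p + m, q + m))"

definition prefixing ::
  "('a, 'k :: finite) kgraph_data \<Rightarrow> 'a \<Rightarrow> ('a, 'k) infpath \<Rightarrow> ('a, 'k) infpath" where
  "prefixing L l x =
     (THE y. y \<in> infinite_paths L \<and> y (0, deg L l) = l \<and> path_shift (deg L l) y = x)"


section \<open>Semibranching function systems\<close>

text \<open>The set function \<open>\<mu> \<circ> f\<close> on the measurable subsets of \<open>D\<close>, that is, \<open>A \<mapsto> \<mu> (f ` A)\<close>.\<close>

definition measure_comp :: "'x measure \<Rightarrow> 'x set \<Rightarrow> ('x \<Rightarrow> 'x) \<Rightarrow> 'x measure" where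
  "measure_comp M D f = measure_of D (sets (restrict_space M D)) (\<lambda>A. emeasure M (f ` A))"

definition Phi :: "'x measure \<Rightarrow> 'x set \<Rightarrow> ('x \<Rightarrow> 'x) \<Rightarrow> 'x \<Rightarrow> ennreal" where
  "Phi M D f = RN_deriv (restrict_space M D) (measure_comp M D f)"

text \<open>
  The third to fifth conditions on each map make explicit what the existence of
  \<open>d(\<mu> \<circ> f)/d\<mu>\<close> presupposes: \<open>\<mu> \<circ> f\<close> is a measure on \<open>D\<close>, absolutely continuous with
  respect to \<open>\<mu>\<close>.
\<close>

definition semibranching_map :: "'x measure \<Rightarrow> 'x set \<Rightarrow> ('x \<Rightarrow> 'x) \<Rightarrow> bool" where
  "semibranching_map M D f \<longleftrightarrow>
     D \<in> sets M \<and>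
     f \<in> restrict_space M D \<rightarrow>\<^sub>M M \<and>
     (\<forall>A\<in>sets (restrict_space M D). f ` A \<in> sets M) \<and>
     measure_space D (sets (restrict_space M D)) (\<lambda>A. emeasure M (f ` A)) \<and>
     absolutely_continuous (restrict_space M D) (measure_comp M D f) \<and>
     (AE x in restrict_space M D. 0 < Phi M D f x)"

definition semibranching_system ::
  "'x measure \<Rightarrow> 'i set \<Rightarrow> ('i \<Rightarrow> 'x set) \<Rightarrow> ('i \<Rightarrow> 'x \<Rightarrow> 'x) \<Rightarrow> bool" where
  "semibranching_system M I D \<sigma> \<longleftrightarrow>
     finite I \<and>
     (\<forall>i\<in>I. semibranching_map M (D i) (\<sigma> i)) \<and>
     space M - (\<Union>i\<in>I. \<sigma> i ` D i) \<in> null_sets M \<and>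
     (\<forall>i\<in>I. \<forall>j\<in>I. i \<noteq> j \<longrightarrow> \<sigma> i ` D i \<inter> \<sigma> j ` D j \<in> null_sets M)"

definition coding_map ::
  "'x measure \<Rightarrow> 'i set \<Rightarrow> ('i \<Rightarrow> 'x set) \<Rightarrow> ('i \<Rightarrow> 'x \<Rightarrow> 'x) \<Rightarrow> ('x \<Rightarrow> 'x) \<Rightarrow> bool" where
  "coding_map M I D \<sigma> T \<longleftrightarrow> T \<in> M \<rightarrow>\<^sub>M M \<and> (\<forall>i\<in>I. \<forall>x\<in>D i. T (\<sigma> i x) = x)"

text \<open>
  In the third clause \<open>\<tau>\<^sub>l\<tau>\<^sub>\<nu> = \<tau>\<^sub>l\<^sub>\<nu>\<close> is an a.e. equality of partially defined
  maps: the domains agree up to a null set, and so do the values.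
\<close>

definition graph_semibranching_system ::
  "('a, 'k :: finite) kgraph_data \<Rightarrow> 'x measure \<Rightarrow> ('a \<Rightarrow> 'x set) \<Rightarrow> ('a \<Rightarrow> 'x \<Rightarrow> 'x) \<Rightarrow>
   (nat ^ 'k \<Rightarrow> 'x \<Rightarrow> 'x) \<Rightarrow> bool" where
  "graph_semibranching_system L M D \<tau> T \<longleftrightarrow>
     (\<forall>m. semibranching_system M (paths_of_degree L m) D \<tau> \<and>
          coding_map M (paths_of_degree L m) D \<tau> (T m)) \<and>
     (\<forall>v\<in>vertices L. (\<forall>x\<in>D v. \<tau> v x = x) \<and> 0 < emeasure M (D v)) \<and>
     (\<forall>l\<in>mor L. \<forall>\<nu>\<in>mor L. src L l = rng L \<nu> \<longrightarrow>
        \<tau> \<nu> ` D \<nu> - D l \<in> null_sets M \<and>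
        (AE x in M. (x \<in> D \<nu> \<and> \<tau> \<nu> x \<in> D l \<longleftrightarrow> x \<in> D (cmp L l \<nu>)) \<and>
                    (x \<in> D (cmp L l \<nu>) \<longrightarrow> \<tau> l (\<tau> \<nu> x) = \<tau> (cmp L l \<nu>) x))) \<and>
     (\<forall>m n. \<forall>x\<in>space M. T m (T n x) = T (m + n) x)"

definition standard_domain :: "('a, 'k :: finite) kgraph_data \<Rightarrow> 'a \<Rightarrow> ('a, 'k) infpath set" where
  "standard_domain L l = cylinder L (src L l)"


section \<open>The Perron--Frobenius measure\<close>

definition vertex_matrix :: "('a, 'k :: finite) kgraph_data \<Rightarrow> 'k \<Rightarrow> 'a \<Rightarrow> 'a \<Rightarrow> nat" where
  "vertex_matrix L i v w = card {l \<in> paths_of_degree L (axis i 1). rng L l = v \<and> src L l = w}"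

definition vertex_eigenvalue :: "('a, 'k :: finite) kgraph_data \<Rightarrow> 'k \<Rightarrow> complex \<Rightarrow> bool" where
  "vertex_eigenvalue L i z \<longleftrightarrow>
     (\<exists>x. (\<exists>v\<in>vertices L. x v \<noteq> 0) \<and>
          (\<forall>v\<in>vertices L. (\<Sum>w\<in>vertices L. of_nat (vertex_matrix L i v w) * x w) = z * x v))"

definition vertex_spectral_radius :: "('a, 'k :: finite) kgraph_data \<Rightarrow> 'k \<Rightarrow> real" where
  "vertex_spectral_radius L i = Max {cmod z | z. vertex_eigenvalue L i z}"

definition pf_vector :: "('a, 'k :: finite) kgraph_data \<Rightarrow> 'a \<Rightarrow> real" where
  "pf_vector L = (THE \<kappa>. \<kappa> \<in> extensional (vertices L) \<and>
     (\<forall>v\<in>vertices L. 0 < \<kappa> v) \<and> (\<Sum>v\<in>vertices L. \<kappa> v) = 1 \<and>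
     (\<forall>i. \<forall>v\<in>vertices L. (\<Sum>w\<in>vertices L. real (vertex_matrix L i v w) * \<kappa> w) =
                        vertex_spectral_radius L i * \<kappa> v))"

definition borel_probability ::
  "('a, 'k :: finite) kgraph_data \<Rightarrow> ('a, 'k) infpath measure \<Rightarrow> bool" where
  "borel_probability L M \<longleftrightarrow> sets M = sets (path_borel L) \<and> prob_space M"

definition pf_measure :: "('a, 'k :: finite) kgraph_data \<Rightarrow> ('a, 'k) infpath measure" where
  "pf_measure L = (THE M. borel_probability L M \<and>
     (\<forall>l\<in>mor L. measure M (cylinder L l) =
        inverse (\<Prod>i\<in>UNIV. vertex_spectral_radius L i ^ (deg L l $ i)) * pf_vector L (src L l)))"

definition equivalent_measures :: "'x measure \<Rightarrow> 'x measure \<Rightarrow> bool" where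
  "equivalent_measures M N \<longleftrightarrow> absolutely_continuous M N \<and> absolutely_continuous N M"


section \<open>C*-algebras and the C*-algebra of a higher-rank graph\<close>

text \<open>
  C*-algebras are carrier-based and need not be unital: the \<open>one\<close> component of the record is not
  constrained, and homomorphisms need not preserve it.
\<close>

record 'b cstar_data = "(complex, 'b) module" +
  star :: "'b \<Rightarrow> 'b"
  nrm :: "'b \<Rightarrow> real"

definition limit_in :: "'b cstar_data \<Rightarrow> (nat \<Rightarrow> 'b) \<Rightarrow> 'b \<Rightarrow> bool" where
  "limit_in A X a \<longleftrightarrow> (\<lambda>n. nrm A (X n \<ominus>\<^bsub>A\<^esub> a)) \<longlonglongrightarrow> 0"

locale cstar_algebra = abelian_group A for A :: "'b cstar_data" (structure) +
  assumes mult_closed: "\<lbrakk>a \<in> carrier A; b \<in> carrier A\<rbrakk> \<Longrightarrow> a \<otimes> b \<in> carrier A"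
    and smult_closed: "a \<in> carrier A \<Longrightarrow> z \<odot> a \<in> carrier A"
    and star_closed: "a \<in> carrier A \<Longrightarrow> star A a \<in> carrier A"
    and smult_add: "\<lbrakk>a \<in> carrier A; b \<in> carrier A\<rbrakk> \<Longrightarrow> z \<odot> (a \<oplus> b) = z \<odot> a \<oplus> z \<odot> b"
    and add_smult: "a \<in> carrier A \<Longrightarrow> (z + w) \<odot> a = z \<odot> a \<oplus> w \<odot> a"
    and smult_smult: "a \<in> carrier A \<Longrightarrow> (z * w) \<odot> a = z \<odot> (w \<odot> a)"
    and one_smult: "a \<in> carrier A \<Longrightarrow> 1 \<odot> a = a"
    and mult_assoc: "\<lbrakk>a \<in> carrier A; b \<in> carrier A; c \<in> carrier A\<rbrakk>
      \<Longrightarrow> (a \<otimes> b) \<otimes> c = a \<otimes> (b \<otimes> c)"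
    and mult_add: "\<lbrakk>a \<in> carrier A; b \<in> carrier A; c \<in> carrier A\<rbrakk>
      \<Longrightarrow> a \<otimes> (b \<oplus> c) = a \<otimes> b \<oplus> a \<otimes> c"
    and add_mult: "\<lbrakk>a \<in> carrier A; b \<in> carrier A; c \<in> carrier A\<rbrakk>
      \<Longrightarrow> (a \<oplus> b) \<otimes> c = a \<otimes> c \<oplus> b \<otimes> c"
    and smult_mult: "\<lbrakk>a \<in> carrier A; b \<in> carrier A\<rbrakk> \<Longrightarrow> (z \<odot> a) \<otimes> b = z \<odot> (a \<otimes> b)"
    and mult_smult: "\<lbrakk>a \<in> carrier A; b \<in> carrier A\<rbrakk> \<Longrightarrow> a \<otimes> (z \<odot> b) = z \<odot> (a \<otimes> b)"
    and star_star: "a \<in> carrier A \<Longrightarrow> star A (star A a) = a"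
    and star_add: "\<lbrakk>a \<in> carrier A; b \<in> carrier A\<rbrakk> \<Longrightarrow> star A (a \<oplus> b) = star A a \<oplus> star A b"
    and star_smult: "a \<in> carrier A \<Longrightarrow> star A (z \<odot> a) = cnj z \<odot> star A a"
    and star_mult: "\<lbrakk>a \<in> carrier A; b \<in> carrier A\<rbrakk> \<Longrightarrow> star A (a \<otimes> b) = star A b \<otimes> star A a"
    and nrm_nonneg: "a \<in> carrier A \<Longrightarrow> 0 \<le> nrm A a"
    and nrm_eq_0: "a \<in> carrier A \<Longrightarrow> nrm A a = 0 \<longleftrightarrow> a = \<zero>"
    and nrm_add: "\<lbrakk>a \<in> carrier A; b \<in> carrier A\<rbrakk> \<Longrightarrow> nrm A (a \<oplus> b) \<le> nrm A a + nrm A b"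
    and nrm_smult: "a \<in> carrier A \<Longrightarrow> nrm A (z \<odot> a) = cmod z * nrm A a"
    and nrm_mult: "\<lbrakk>a \<in> carrier A; b \<in> carrier A\<rbrakk> \<Longrightarrow> nrm A (a \<otimes> b) \<le> nrm A a * nrm A b"
    and nrm_star_mult: "a \<in> carrier A \<Longrightarrow> nrm A (star A a \<otimes> a) = (nrm A a)\<^sup>2"
    and complete: "\<lbrakk>\<And>n. X n \<in> carrier A;
        \<And>\<epsilon>. 0 < \<epsilon> \<Longrightarrow> \<exists>N. \<forall>m\<ge>N. \<forall>n\<ge>N. nrm A (X m \<ominus> X n) < \<epsilon>\<rbrakk>
      \<Longrightarrow> \<exists>a\<in>carrier A. limit_in A X a"

definition star_hom :: "'b cstar_data \<Rightarrow> 'c cstar_data \<Rightarrow> ('b \<Rightarrow> 'c) set" where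
  "star_hom A B = {\<phi> \<in> carrier A \<rightarrow>\<^sub>E carrier B.
     (\<forall>a\<in>carrier A. \<forall>b\<in>carrier A. \<phi> (a \<oplus>\<^bsub>A\<^esub> b) = \<phi> a \<oplus>\<^bsub>B\<^esub> \<phi> b) \<and>
     (\<forall>a\<in>carrier A. \<forall>b\<in>carrier A. \<phi> (a \<otimes>\<^bsub>A\<^esub> b) = \<phi> a \<otimes>\<^bsub>B\<^esub> \<phi> b) \<and>
     (\<forall>z. \<forall>a\<in>carrier A. \<phi> (z \<odot>\<^bsub>A\<^esub> a) = z \<odot>\<^bsub>B\<^esub> \<phi> a) \<and>
     (\<forall>a\<in>carrier A. \<phi> (star A a) = star B (\<phi> a))}"

definition closed_star_subalgebra :: "'b cstar_data \<Rightarrow> 'b set \<Rightarrow> bool" where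
  "closed_star_subalgebra A S \<longleftrightarrow>
     S \<subseteq> carrier A \<and> \<zero>\<^bsub>A\<^esub> \<in> S \<and>
     (\<forall>a\<in>S. \<forall>b\<in>S. a \<oplus>\<^bsub>A\<^esub> b \<in> S \<and> a \<otimes>\<^bsub>A\<^esub> b \<in> S) \<and>
     (\<forall>z. \<forall>a\<in>S. z \<odot>\<^bsub>A\<^esub> a \<in> S) \<and> (\<forall>a\<in>S. star A a \<in> S) \<and>
     (\<forall>X. \<forall>a\<in>carrier A. (\<forall>n. X n \<in> S) \<and> limit_in A X a \<longrightarrow> a \<in> S)"

definition generates :: "'b cstar_data \<Rightarrow> 'b set \<Rightarrow> bool" where
  "generates A G \<longleftrightarrow>
     G \<subseteq> carrier A \<and> (\<forall>S. closed_star_subalgebra A S \<and> G \<subseteq> S \<longrightarrow> S = carrier A)"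

definition cuntz_krieger_family ::
  "('a, 'k :: finite) kgraph_data \<Rightarrow> 'b cstar_data \<Rightarrow> ('a \<Rightarrow> 'b) \<Rightarrow> bool" where
  "cuntz_krieger_family L A t \<longleftrightarrow>
     (\<forall>l\<in>mor L. t l \<in> carrier A \<and> t l \<otimes>\<^bsub>A\<^esub> star A (t l) \<otimes>\<^bsub>A\<^esub> t l = t l) \<and>
     (\<forall>v\<in>vertices L. star A (t v) = t v \<and> t v \<otimes>\<^bsub>A\<^esub> t v = t v) \<and>
     (\<forall>v\<in>vertices L. \<forall>w\<in>vertices L. v \<noteq> w \<longrightarrow> t v \<otimes>\<^bsub>A\<^esub> t w = \<zero>\<^bsub>A\<^esub>) \<and>
     (\<forall>l\<in>mor L. \<forall>\<eta>\<in>mor L. src L l = rng L \<eta> \<longrightarrow> t l \<otimes>\<^bsub>A\<^esub> t \<eta> = t (cmp L l \<eta>)) \<and>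
     (\<forall>l\<in>mor L. star A (t l) \<otimes>\<^bsub>A\<^esub> t l = t (src L l)) \<and>
     (\<forall>v\<in>vertices L. \<forall>n.
        t v = (\<Oplus>\<^bsub>A\<^esub>l\<in>{l \<in> paths_of_degree L n. rng L l = v}. t l \<otimes>\<^bsub>A\<^esub> star A (t l)))"

text \<open>
  \<open>(A, t)\<close> is the universal C*-algebra generated by a Cuntz--Krieger family.  HOL cannot
  quantify over the types of the test algebras \<open>B\<close> inside a formula, so their element type is
  passed as the parameter \<open>TYPE('c)\<close>; the C*-algebra of \<open>L\<close> satisfies the predicate for every
  choice of \<open>'c\<close>.
\<close>

definition graph_cstar_algebra ::
  "'c itself \<Rightarrow> ('a, 'k :: finite) kgraph_data \<Rightarrow> 'b cstar_data \<Rightarrow> ('a \<Rightarrow> 'b) \<Rightarrow> bool" where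
  "graph_cstar_algebra (_ :: 'c itself) L A t \<longleftrightarrow>
     cstar_algebra A \<and> cuntz_krieger_family L A t \<and> generates A (t ` mor L) \<and>
     (\<forall>(B :: 'c cstar_data) s. cstar_algebra B \<and> cuntz_krieger_family L B s \<longrightarrow>
        (\<exists>!\<phi>. \<phi> \<in> star_hom A B \<and> (\<forall>l\<in>mor L. \<phi> (t l) = s l)))"


section \<open>Hilbert spaces, \<open>L\<^sup>2\<close>, and bounded operators\<close>

record 'v hilbert_data =
  vectors :: "'v set"
  vzero :: 'v
  vplus :: "'v \<Rightarrow> 'v \<Rightarrow> 'v"
  vscale :: "complex \<Rightarrow> 'v \<Rightarrow> 'v"
  vinner :: "'v \<Rightarrow> 'v \<Rightarrow> complex"

definition vnorm :: "'v hilbert_data \<Rightarrow> 'v \<Rightarrow> real" where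
  "vnorm H u = sqrt (Re (vinner H u u))"

definition linear_on :: "'v hilbert_data \<Rightarrow> 'w hilbert_data \<Rightarrow> ('v \<Rightarrow> 'w) \<Rightarrow> bool" where
  "linear_on H K T \<longleftrightarrow> T ` vectors H \<subseteq> vectors K \<and>
     (\<forall>u\<in>vectors H. \<forall>w\<in>vectors H. T (vplus H u w) = vplus K (T u) (T w)) \<and>
     (\<forall>z. \<forall>u\<in>vectors H. T (vscale H z u) = vscale K z (T u))"

definition bounded_operators :: "'v hilbert_data \<Rightarrow> ('v \<Rightarrow> 'v) set" where
  "bounded_operators H = {T \<in> extensional (vectors H).
     linear_on H H T \<and> (\<exists>C. \<forall>u\<in>vectors H. vnorm H (T u) \<le> C * vnorm H u)}"

definition adjoint_op :: "'v hilbert_data \<Rightarrow> ('v \<Rightarrow> 'v) \<Rightarrow> 'v \<Rightarrow> 'v" where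
  "adjoint_op H T = (THE S. S \<in> bounded_operators H \<and>
     (\<forall>u\<in>vectors H. \<forall>w\<in>vectors H. vinner H (T u) w = vinner H u (S w)))"

definition BH :: "'v hilbert_data \<Rightarrow> ('v \<Rightarrow> 'v) cstar_data" where
  "BH H = \<lparr>carrier = bounded_operators H,
     mult = (\<lambda>S T. \<lambda>u\<in>vectors H. S (T u)),
     one = (\<lambda>u\<in>vectors H. u),
     zero = (\<lambda>u\<in>vectors H. vzero H),
     add = (\<lambda>S T. \<lambda>u\<in>vectors H. vplus H (S u) (T u)),
     smult = (\<lambda>z T. \<lambda>u\<in>vectors H. vscale H z (T u)),
     star = adjoint_op H,
     nrm = (\<lambda>T. Sup {vnorm H (T u) | u. u \<in> vectors H \<and> vnorm H u \<le> 1})\<rparr>"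

definition L2_functions :: "'x measure \<Rightarrow> ('x \<Rightarrow> complex) set" where
  "L2_functions M = {f \<in> borel_measurable M. integrable M (\<lambda>x. (cmod (f x))\<^sup>2)}"

definition L2_rel :: "'x measure \<Rightarrow> (('x \<Rightarrow> complex) \<times> ('x \<Rightarrow> complex)) set" where
  "L2_rel M = {(f, g). f \<in> L2_functions M \<and> g \<in> L2_functions M \<and> (AE x in M. f x = g x)}"

definition L2_class :: "'x measure \<Rightarrow> ('x \<Rightarrow> complex) \<Rightarrow> ('x \<Rightarrow> complex) set" where
  "L2_class M f = L2_rel M `` {f}"

definition L2_rep :: "('x \<Rightarrow> complex) set \<Rightarrow> 'x \<Rightarrow> complex" where
  "L2_rep \<xi> = (SOME f. f \<in> \<xi>)"

definition L2 :: "'x measure \<Rightarrow> ('x \<Rightarrow> complex) set hilbert_data" where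
  "L2 M = \<lparr>vectors = L2_functions M // L2_rel M,
     vzero = L2_class M (\<lambda>x. 0),
     vplus = (\<lambda>\<xi> \<eta>. L2_class M (\<lambda>x. L2_rep \<xi> x + L2_rep \<eta> x)),
     vscale = (\<lambda>z \<xi>. L2_class M (\<lambda>x. z * L2_rep \<xi> x)),
     vinner = (\<lambda>\<xi> \<eta>. \<integral>x. L2_rep \<xi> x * cnj (L2_rep \<eta> x) \<partial>M)\<rparr>"

type_synonym 'x L2_operator = "('x \<Rightarrow> complex) set \<Rightarrow> ('x \<Rightarrow> complex) set"

definition unitary :: "'v hilbert_data \<Rightarrow> 'w hilbert_data \<Rightarrow> ('v \<Rightarrow> 'w) \<Rightarrow> bool" where
  "unitary H K U \<longleftrightarrow> linear_on H K U \<and> bij_betw U (vectors H) (vectors K) \<and>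
     (\<forall>u\<in>vectors H. \<forall>w\<in>vectors H. vinner K (U u) (U w) = vinner H u w)"

definition unitarily_equivalent ::
  "'b cstar_data \<Rightarrow> 'v hilbert_data \<Rightarrow> ('b \<Rightarrow> 'v \<Rightarrow> 'v) \<Rightarrow> 'w hilbert_data \<Rightarrow> ('b \<Rightarrow> 'w \<Rightarrow> 'w) \<Rightarrow> bool"
  where
  "unitarily_equivalent A H \<pi> K \<pi>' \<longleftrightarrow>
     (\<exists>U. unitary H K U \<and> (\<forall>a\<in>carrier A. \<forall>u\<in>vectors H. U (\<pi> a u) = \<pi>' a (U u)))"


section \<open>Semibranching representations\<close>

definition semibranching_operator ::
  "('a, 'k :: finite) kgraph_data \<Rightarrow> 'x measure \<Rightarrow> ('a \<Rightarrow> 'x set) \<Rightarrow> ('a \<Rightarrow> 'x \<Rightarrow> 'x) \<Rightarrow>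
   (nat ^ 'k \<Rightarrow> 'x \<Rightarrow> 'x) \<Rightarrow> 'a \<Rightarrow> 'x L2_operator" where
  "semibranching_operator L M D \<tau> T l =
     (\<lambda>\<xi>\<in>vectors (L2 M). L2_class M (\<lambda>x.
        indicator (\<tau> l ` D l) x *
        complex_of_real (enn2real (Phi M (D l) (\<tau> l) (T (deg L l) x)) powr (- 1 / 2)) *
        L2_rep \<xi> (T (deg L l) x)))"

definition semibranching_representation ::
  "('a, 'k :: finite) kgraph_data \<Rightarrow> 'b cstar_data \<Rightarrow> ('a \<Rightarrow> 'b) \<Rightarrow> 'x measure \<Rightarrow>
   ('a \<Rightarrow> 'x set) \<Rightarrow> ('a \<Rightarrow> 'x \<Rightarrow> 'x) \<Rightarrow> (nat ^ 'k \<Rightarrow> 'x \<Rightarrow> 'x) \<Rightarrow>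
   ('b \<Rightarrow> 'x L2_operator) \<Rightarrow> bool" where
  "semibranching_representation L A t M D \<tau> T \<pi> \<longleftrightarrow>
     \<pi> \<in> star_hom A (BH (L2 M)) \<and>
     (\<forall>l\<in>mor L. \<pi> (t l) = semibranching_operator L M D \<tau> T l)"

abbreviation standard_system ::
  "('a, 'k :: finite) kgraph_data \<Rightarrow> ('a, 'k) infpath measure \<Rightarrow> bool" where
  "standard_system L M \<equiv> graph_semibranching_system L M (standard_domain L) (prefixing L) path_shift"

abbreviation standard_representation ::
  "('a, 'k :: finite) kgraph_data \<Rightarrow> 'b cstar_data \<Rightarrow> ('a \<Rightarrow> 'b) \<Rightarrow> ('a, 'k) infpath measure \<Rightarrow>
   ('b \<Rightarrow> ('a, 'k) infpath L2_operator) \<Rightarrow> bool" where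
  "standard_representation L A t M \<equiv>
     semibranching_representation L A t M (standard_domain L) (prefixing L) path_shift"


section \<open>The 2-graph with \<open>f\<^sub>1e = ef\<^sub>2\<close>, \<open>f\<^sub>2e = ef\<^sub>1\<close>, and its product measures\<close>

text \<open>
  The coordinates are indexed by the elements \<open>1\<close> and \<open>2\<close> of the numeral type \<open>2\<close>, so
  \<open>axis 1 1\<close> and \<open>axis 2 1\<close> are the two generators of \<open>\<nat>\<^sup>2\<close>.
\<close>

definition flip_graph :: "('a, 2) kgraph_data \<Rightarrow> 'a \<Rightarrow> 'a \<Rightarrow> 'a \<Rightarrow> 'a \<Rightarrow> bool" where
  "flip_graph L v f1 f2 e \<longleftrightarrow> kgraph L \<and>
     vertices L = {v} \<and>
     paths_of_degree L (axis 1 1) = {f1, f2} \<and> f1 \<noteq> f2 \<and>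
     paths_of_degree L (axis 2 1) = {e} \<and>
     cmp L f1 e = cmp L e f2 \<and> cmp L f2 e = cmp L e f1"

text \<open>The path \<open>e g\<^sub>1 e g\<^sub>2 \<dots> e g\<^sub>n\<close>; it is \<open>v\<close> for \<open>n = 0\<close>.\<close>

definition square_path :: "('a, 2) kgraph_data \<Rightarrow> 'a \<Rightarrow> 'a \<Rightarrow> 'a list \<Rightarrow> 'a" where
  "square_path L v e gs = foldr (\<lambda>g l. cmp L e (cmp L g l)) gs v"

definition admissible :: "(nat \<Rightarrow> real) \<Rightarrow> bool" where
  "admissible \<gamma> \<longleftrightarrow> (\<forall>n\<ge>1. \<bar>\<gamma> n\<bar> < 1 / 2) \<and> summable (\<lambda>n. \<bar>\<gamma> (Suc n)\<bar>)"

text \<open>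
  List positions start at 0 and \<open>\<gamma>\<close> at 1, so the \<open>i\<close>-th list entry carries \<open>\<gamma> (Suc i)\<close>.  The
  empty list gives \<open>\<mu> (Z v) = 1\<close>.
\<close>

definition extends_square_weights ::
  "('a, 2) kgraph_data \<Rightarrow> 'a \<Rightarrow> 'a \<Rightarrow> 'a \<Rightarrow> 'a \<Rightarrow> (nat \<Rightarrow> real) \<Rightarrow> ('a, 2) infpath measure \<Rightarrow> bool"
  where
  "extends_square_weights L v f1 f2 e \<gamma> \<mu> \<longleftrightarrow>
     borel_probability L \<mu> \<and>
     (\<forall>gs. set gs \<subseteq> {f1, f2} \<longrightarrow>
        measure \<mu> (cylinder L (square_path L v e gs)) =
          (\<Prod>i<length gs. if gs ! i = f1 then 1 / 2 + \<gamma> (Suc i) else 1 / 2 - \<gamma> (Suc i)))"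

end

theory Submission
  imports Defs
begin

text \<open>
  Why the theorem holds.  In the flip graph the paths of degree \<open>(n, n)\<close> are the words
  \<open>e g\<^sub>1 \<dots> e g\<^sub>n\<close>, and an infinite path is determined by its initial segments of these degrees.
  So the path space is the space of sequences in \<open>{f1, f2}\<close>, and the square cylinder sets form,
  together with the empty set, an intersection-stable generator of its Borel sets
  (\<open>sets_path_borel\<close>, \<open>measure_eqI_square_cylinders\<close>).  The number of paths of degree \<open>m\<close> is
  \<open>2 ^ m\<^sub>1\<close>, and therefore the law \<open>fair\<close> of a sequence of fair coin tosses is the
  Perron--Frobenius measure \<open>M\<close> (\<open>pf_measure_flip\<close>).

  The candidate for \<open>d\<mu>/dM\<close> is the infinite product \<open>D\<close> of the factors \<open>1 + 2\<gamma>\<^sub>i\<close> (where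
  \<open>g\<^sub>i = f1\<close>) and \<open>1 - 2\<gamma>\<^sub>i\<close> (where \<open>g\<^sub>i = f2\<close>).  The factors are positive because
  \<open>\<bar>\<gamma>\<^sub>i\<bar> < 1/2\<close>, and the product converges absolutely because the \<open>\<gamma>\<^sub>i\<close> are absolutely summable;
  so \<open>D\<close> is positive everywhere and bounded.  Dominated convergence shows that \<open>D M\<close> has the
  prescribed values on square cylinder sets, so \<open>\<mu> = D M\<close> exists, is unique and is equivalent to
  \<open>M\<close> (\<open>extends_square_weights_iff\<close>).

  Prefixing by a path \<open>l\<close> of degree \<open>(n\<^sub>1, n\<^sub>2)\<close> multiplies \<open>M\<close> by \<open>2 ^ -n\<^sub>1\<close>.  Consequently the
  Radon--Nikodym derivative of \<open>\<mu> \<circ> \<sigma>\<^sub>l\<close> is \<open>2 ^ -n\<^sub>1 (D \<circ> \<sigma>\<^sub>l) / D\<close>, again positive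
  (\<open>Phi_prefixing\<close>), which is the analytic content of the semibranching axioms
  (\<open>standard_system_\<mu>\<close>).

  This formula is also what makes multiplication by \<open>\<surd>D\<close> from \<open>L\<^sup>2(\<mu>)\<close> to \<open>L\<^sup>2(M)\<close> a unitary
  that carries the operators attached to \<open>\<mu>\<close> to fixed isometries \<open>S\<^sub>l\<close> of \<open>L\<^sup>2(M)\<close> that do not
  depend on \<open>\<mu>\<close> (\<open>density_unitary_intertwines\<close>).  The Cuntz--Krieger relations are verified for the
  \<open>S\<^sub>l\<close> (\<open>shift_op_cuntz_krieger\<close>).  The universal property then yields exactly one representation
  on \<open>L\<^sup>2(M)\<close> with \<open>t\<^sub>l \<mapsto> S\<^sub>l\<close>, and conjugation by the unitary makes the representations on
  \<open>L\<^sup>2(\<mu>)\<close> correspond to it bijectively.  All of them are thus unitarily equivalent to one another,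
  and \<open>D = 1\<close> is the case of \<open>M\<close>.

  The universal property is applied to the bounded operators on \<open>L\<^sup>2(M)\<close>, which have to be a
  C*-algebra for this: completeness of \<open>L\<^sup>2\<close> is the Riesz--Fischer theorem (\<open>riesz_fischer\<close>),
  and adjoints come from the Riesz representation theorem (\<open>riesz_representation\<close>).
\<close>

section \<open>Paths in higher-rank graphs\<close>

lemma vec_le_add_diff:
  fixes p q :: "nat ^ 'k :: finite"
  assumes "p \<le> q"
  shows "p + (q - p) = q"
  using assms by (simp add: vec_eq_iff less_eq_vec_def)

lemma vec_nat_zero_le: "(0 :: nat ^ 'k :: finite) \<le> q"
  by (simp add: less_eq_vec_def)

lemma vec_nat_le_add: "(p :: nat ^ 'k :: finite) \<le> p + q"
  by (simp add: less_eq_vec_def)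

lemma vec_nat_add_mono: "(p :: nat ^ 'k :: finite) \<le> q \<Longrightarrow> p + m \<le> q + m"
  by (simp add: less_eq_vec_def)

lemma vec_nat_diff_cancel: "(q + m) - (p + m) = (q - p :: nat ^ 'k :: finite)"
  by (simp add: vec_eq_iff)

lemma mor_Omega_iff: "(p, q) \<in> mor Omega \<longleftrightarrow> p \<le> q"
  by (simp add: Omega_def)

text \<open>
  The degrees \<open>(n, \<dots>, n)\<close> are cofinal among all degrees, so a nested sequence of paths of these
  degrees is enough to pin down an infinite path.
\<close>

definition diagonal :: "nat \<Rightarrow> nat ^ 'k :: finite" where
  "diagonal n = (\<chi> i. n)"

lemma diagonal_nth [simp]: "diagonal n $ i = n"
  by (simp add: diagonal_def)

lemma diagonal_mono: "m \<le> n \<Longrightarrow> (diagonal m :: nat ^ 'k :: finite) \<le> diagonal n"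
  by (simp add: less_eq_vec_def)

lemma le_diagonal_Max: "(q :: nat ^ 'k :: finite) \<le> diagonal (Max (range (\<lambda>i. q $ i)))"
  by (simp add: less_eq_vec_def)

lemma diagonal_eq_iff [simp]: "(diagonal m :: nat ^ 'k :: finite) = diagonal n \<longleftrightarrow> m = n"
  by (simp add: vec_eq_iff)

lemma diagonal_0: "diagonal 0 = 0"
  by (simp add: vec_eq_iff)

context kgraph
begin

text \<open>
  Equal degrees of the left factors force equal degrees of the right factors, so both
  decompositions are instances of the same factorization problem.
\<close>

lemma factorization_unique:
  assumes "l \<in> mor L" "\<mu> \<in> mor L" "l' \<in> mor L" "\<mu>' \<in> mor L"
    and "src L l = rng L \<mu>" "src L l' = rng L \<mu>'"
    and "cmp L l \<mu> = cmp L l' \<mu>'" "deg L l = deg L l'"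
  shows "l = l'" "\<mu> = \<mu>'"
proof -
  have d: "deg L (cmp L l \<mu>) = deg L l + deg L \<mu>"
    and d': "deg L (cmp L l \<mu>) = deg L l' + deg L \<mu>'"
    using deg_cmp[OF assms(1,2,5)] deg_cmp[OF assms(3,4,6)] assms(7) by simp_all
  then have "deg L \<mu> = deg L \<mu>'" using assms(8) by (metis add_left_cancel)
  note u = factorization[OF cmp_mor[OF assms(1,2,5)] d]
  have "(l, \<mu>) = (l', \<mu>')"
    by (rule trans[OF the1_equality[OF u, symmetric] the1_equality[OF u]])
       (use assms \<open>deg L \<mu> = deg L \<mu>'\<close> in simp_all)
  then show "l = l'" "\<mu> = \<mu>'" by auto
qed

lemma factorization_exists:
  assumes "l \<in> mor L" "deg L l = m + n"
  obtains \<mu> \<nu> where "\<mu> \<in> mor L" "\<nu> \<in> mor L" "src L \<mu> = rng L \<nu>" "l = cmp L \<mu> \<nu>"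
    "deg L \<mu> = m" "deg L \<nu> = n"
  using ex1_implies_ex[OF factorization[OF assms]] by auto

text \<open>
  Both \<open>(rng l, l)\<close> and \<open>(l, src l)\<close> factor \<open>l\<close> with degrees \<open>(0, 0)\<close>, so they coincide.
\<close>

lemma degree_0_identity:
  assumes "l \<in> mor L" "deg L l = 0"
  shows "src L l = l" "rng L l = l"
proof -
  have "rng L l = l" "l = src L l"
    using factorization_unique[of "rng L l" l l "src L l"] assms
      rng_mor src_mor src_rng rng_src cmp_rng cmp_src deg_identity by metis+
  then show "src L l = l" "rng L l = l" by simp_all
qed

definition prefix :: "'a \<Rightarrow> 'a \<Rightarrow> bool" where
  "prefix \<mu> l \<longleftrightarrow> \<mu> \<in> mor L \<and> (\<exists>\<nu>\<in>mor L. src L \<mu> = rng L \<nu> \<and> l = cmp L \<mu> \<nu>)"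

lemma prefix_cmp: "\<lbrakk>l \<in> mor L; \<mu> \<in> mor L; src L l = rng L \<mu>\<rbrakk> \<Longrightarrow> prefix l (cmp L l \<mu>)"
  by (auto simp: prefix_def)

lemma prefix_mor: "prefix \<mu> l \<Longrightarrow> \<mu> \<in> mor L" "prefix \<mu> l \<Longrightarrow> l \<in> mor L"
  by (auto simp: prefix_def cmp_mor)

lemma prefix_trans:
  assumes "prefix \<kappa> \<mu>" "prefix \<mu> l"
  shows "prefix \<kappa> l"
proof -
  obtain \<alpha> \<beta> where a: "\<alpha> \<in> mor L" "\<beta> \<in> mor L" "\<kappa> \<in> mor L" "src L \<kappa> = rng L \<alpha>" "\<mu> = cmp L \<kappa> \<alpha>"
    "src L \<mu> = rng L \<beta>" "l = cmp L \<mu> \<beta>"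
    using assms by (auto simp: prefix_def)
  then have s: "src L \<alpha> = rng L \<beta>" by (simp add: src_cmp)
  then have "l = cmp L \<kappa> (cmp L \<alpha> \<beta>)" using a by (simp add: cmp_assoc)
  then show ?thesis using a s by (auto simp: prefix_def cmp_mor rng_cmp intro!: bexI[of _ "cmp L \<alpha> \<beta>"])
qed

lemma prefix_exists:
  assumes "l \<in> mor L" "q \<le> deg L l"
  obtains \<mu> where "prefix \<mu> l" "deg L \<mu> = q"
proof -
  have "deg L l = q + (deg L l - q)" using vec_le_add_diff[OF assms(2)] by simp
  from factorization_exists[OF assms(1) this] show ?thesis
    using that by (auto simp: prefix_def)
qed

lemma prefix_unique:
  assumes "prefix \<mu> l" "prefix \<mu>' l" "deg L \<mu> = deg L \<mu>'"
  shows "\<mu> = \<mu>'"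
  using assms factorization_unique(1) unfolding prefix_def by metis

text \<open>
  The initial segments of a path form a chain that is indexed by their degrees.
\<close>

lemma prefix_linear:
  assumes "prefix \<mu> l" "prefix \<mu>' l" "deg L \<mu> \<le> deg L \<mu>'"
  shows "prefix \<mu> \<mu>'"
proof -
  obtain \<kappa> where k: "prefix \<kappa> \<mu>'" "deg L \<kappa> = deg L \<mu>"
    using prefix_exists[OF prefix_mor(1)[OF assms(2)] assms(3)] .
  then have "\<kappa> = \<mu>" using prefix_unique[OF prefix_trans[OF k(1) assms(2)] assms(1)] by simp
  with k show ?thesis by simp
qed

lemma prefix_cmp_left:
  assumes "prefix \<mu> \<nu>" "l \<in> mor L" "src L l = rng L \<mu>"
  shows "prefix (cmp L l \<mu>) (cmp L l \<nu>)"
proof -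
  obtain \<beta> where b: "\<mu> \<in> mor L" "\<beta> \<in> mor L" "src L \<mu> = rng L \<beta>" "\<nu> = cmp L \<mu> \<beta>"
    using assms(1) by (auto simp: prefix_def)
  then have "cmp L l \<nu> = cmp L (cmp L l \<mu>) \<beta>" using assms by (simp add: cmp_assoc)
  then show ?thesis using b assms by (simp add: prefix_cmp cmp_mor src_cmp)
qed

section \<open>Infinite paths\<close>

lemma infinite_path_mor:
  assumes "x \<in> infinite_paths L" "p \<le> q"
  shows "x (p, q) \<in> mor L" "src L (x (p, q)) = x (q, q)" "rng L (x (p, q)) = x (p, p)"
    "deg L (x (p, q)) = q - p"
proof -
  have "(p, q) \<in> mor Omega" using assms by (simp add: mor_Omega_iff)
  moreover have "\<forall>l\<in>mor Omega. x l \<in> mor L \<and> src L (x l) = x (src Omega l) \<and>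
      rng L (x l) = x (rng Omega l) \<and> deg L (x l) = deg Omega l"
    using assms(1) by (auto simp: infinite_paths_def degree_functor_def)
  ultimately show "x (p, q) \<in> mor L" "src L (x (p, q)) = x (q, q)" "rng L (x (p, q)) = x (p, p)"
    "deg L (x (p, q)) = q - p"
    by (fastforce simp: Omega_def)+
qed

lemma infinite_path_cmp:
  assumes "x \<in> infinite_paths L" "p \<le> q" "q \<le> r"
  shows "x (p, r) = cmp L (x (p, q)) (x (q, r))"
proof -
  have pq: "(p, q) \<in> mor Omega" "(q, r) \<in> mor Omega" using assms by (simp_all add: mor_Omega_iff)
  have "src Omega (p, q) = rng Omega (q, r)" by (simp add: Omega_def)
  with pq assms(1) have "x (cmp Omega (p, q) (q, r)) = cmp L (x (p, q)) (x (q, r))"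
    unfolding infinite_paths_def degree_functor_def by blast
  then show ?thesis by (simp add: Omega_def)
qed

lemma infinite_path_prefix:
  assumes "x \<in> infinite_paths L" "p \<le> q"
  shows "prefix (x (0, p)) (x (0, q))"
  using infinite_path_cmp[OF assms(1) vec_nat_zero_le assms(2)]
    infinite_path_mor[OF assms(1) vec_nat_zero_le] infinite_path_mor[OF assms]
  by (simp add: prefix_cmp)

lemma infinite_path_deg0:
  "x \<in> infinite_paths L \<Longrightarrow> deg L (x (0, q)) = q"
  using infinite_path_mor(4)[OF _ vec_nat_zero_le] by (simp add: vec_eq_iff)

lemma infinite_path_mor0: "x \<in> infinite_paths L \<Longrightarrow> x (0, q) \<in> mor L"
  using infinite_path_mor(1)[OF _ vec_nat_zero_le] .

text \<open>
  The segment \<open>x (p, q)\<close> is recovered by cancelling \<open>x (0, p)\<close> from \<open>x (0, q)\<close>, and \<open>x (0, q)\<close> is the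
  initial segment of degree \<open>q\<close> of any longer \<open>x (0, r)\<close>.
\<close>

lemma infinite_path_eqI:
  assumes x: "x \<in> infinite_paths L" and y: "y \<in> infinite_paths L"
    and eq: "\<And>q. \<exists>r\<ge>q. x (0, r) = y (0, r)"
  shows "x = y"
proof -
  have 0: "x (0, q) = y (0, q)" for q
  proof -
    obtain r where r: "q \<le> r" "x (0, r) = y (0, r)" using eq by blast
    show ?thesis
      using prefix_unique[of "x (0, q)" "x (0, r)" "y (0, q)"] r
        infinite_path_prefix[OF x r(1)] infinite_path_prefix[OF y r(1)]
      by (simp add: infinite_path_deg0 x y)
  qed
  show ?thesis
  proof (rule extensionalityI[of _ "mor Omega"])
    show "x \<in> extensional (mor Omega)" "y \<in> extensional (mor Omega)"
      using x y by (auto simp: infinite_paths_def)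
  next
    fix l assume "l \<in> mor (Omega :: ((nat ^ 'k) \<times> (nat ^ 'k), 'k) kgraph_data)"
    then obtain p q where l: "l = (p, q)" "p \<le> q" by (cases l) (auto simp: mor_Omega_iff)
    have "x (p, q) = y (p, q)"
    proof (rule factorization_unique(2)[of "x (0, p)" "x (p, q)" "y (0, p)" "y (p, q)"])
      show "cmp L (x (0, p)) (x (p, q)) = cmp L (y (0, p)) (y (p, q))"
        using infinite_path_cmp[OF x vec_nat_zero_le l(2)] infinite_path_cmp[OF y vec_nat_zero_le l(2)] 0
        by simp
    qed (auto simp: infinite_path_mor[OF x l(2)] infinite_path_mor[OF y l(2)] infinite_path_deg0 x y
        infinite_path_mor0 infinite_path_mor(2)[OF _ vec_nat_zero_le])
    then show "x l = y l" by (simp add: l)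
  qed
qed

text \<open>
  The functor is obtained by cancellation: \<open>x (p, q)\<close> is the unique \<open>b\<close> with \<open>P q = P p b\<close>.
  Functoriality is then the uniqueness of the factorization of \<open>P r\<close> for \<open>p \<le> q \<le> r\<close>.
\<close>

lemma infinite_path_exists:
  assumes P: "\<And>q. P q \<in> mor L" "\<And>q. deg L (P q) = q" "\<And>p q. p \<le> q \<Longrightarrow> prefix (P p) (P q)"
  obtains x where "x \<in> infinite_paths L" "\<And>q. x (0, q) = P q"
proof -
  have "\<exists>b. p \<le> q \<longrightarrow> b \<in> mor L \<and> src L (P p) = rng L b \<and> P q = cmp L (P p) b" for p q
    using P(3) unfolding prefix_def by blast
  then obtain b where b: "\<And>p q. p \<le> q \<Longrightarrow> b p q \<in> mor L \<and> src L (P p) = rng L (b p q) \<and> P q = cmp L (P p) (b p q)"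
    by metis
  have deg: "deg L (b p q) = q - p" if "p \<le> q" for p q
  proof -
    have "q = p + deg L (b p q)" using b[OF that] deg_cmp[of "P p" "b p q"] P(1,2) by metis
    then have "q - p = (p + deg L (b p q)) - p" by simp
    then show ?thesis by simp
  qed
  have src: "src L (b p q) = src L (P q)" if "p \<le> q" for p q
    using b[OF that] src_cmp[of "P p" "b p q"] P by simp
  have refl: "b p p = src L (P p)" for p
    by (rule factorization_unique(2)[of "P p" _ "P p"])
       (metis b[OF order_refl, of p] P(1) src_mor[OF P(1)] rng_src[OF P(1)] cmp_src[OF P(1)])+
  have cmp: "b p r = cmp L (b p q) (b q r)" if "p \<le> q" "q \<le> r" for p q r
  proof (rule factorization_unique(2)[of "P p" _ "P p"])
    have pr: "p \<le> r" using that by (rule order_trans)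
    note s = b[OF that(1)] b[OF that(2)] b[OF pr] src[OF that(1)]
    show "b p r \<in> mor L" "src L (P p) = rng L (b p r)" using s by auto
    show "cmp L (b p q) (b q r) \<in> mor L" "src L (P p) = rng L (cmp L (b p q) (b q r))"
      using s by (auto simp: cmp_mor rng_cmp)
    have "cmp L (P p) (cmp L (b p q) (b q r)) = cmp L (cmp L (P p) (b p q)) (b q r)"
      using s P(1) by (simp add: cmp_assoc)
    then show "cmp L (P p) (b p r) = cmp L (P p) (cmp L (b p q) (b q r))" using s by metis
  qed (auto simp: P)
  define x where "x = (\<lambda>(p, q)\<in>mor Omega. b p q)"
  have x: "x (p, q) = b p q" if "p \<le> q" for p q using that by (simp add: x_def mor_Omega_iff)
  have "x \<in> infinite_paths L"
    unfolding infinite_paths_def degree_functor_def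
  proof (safe, goal_cases)
    case 1 show ?case by (simp add: x_def)
  next
    case (2 p q) then show ?case using b by (simp add: mor_Omega_iff x)
  next
    case (3 p q) then show ?case by (simp add: mor_Omega_iff x src refl) (simp add: Omega_def x refl)
  next
    case (4 p q) then show ?case using b[of p q] by (simp add: mor_Omega_iff x) (simp add: Omega_def x refl)
  next
    case (5 p q) then show ?case by (simp add: mor_Omega_iff x deg) (simp add: Omega_def)
  next
    case (6 p q q' r)
    then have "p \<le> q" "q' \<le> r" "q' = q" by (simp_all add: mor_Omega_iff) (simp add: Omega_def)
    then show ?case using cmp[of p q r] x order_trans[of p q r] by (simp add: Omega_def)
  qed
  moreover have "x (0, q) = P q" for q
  proof -
    have P0: "src L (P 0) = P 0" using degree_0_identity P by blast
    have "b 0 q \<in> mor L" "P 0 = rng L (b 0 q)" "P q = cmp L (P 0) (b 0 q)"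
      using b[OF vec_nat_zero_le, of q] P0 by simp_all
    then have "P q = b 0 q" by (simp add: cmp_rng)
    then show ?thesis by (simp add: x vec_nat_zero_le)
  qed
  ultimately show ?thesis using that by blast
qed

text \<open>
  Infinite paths are built from finite ones with this lemma.  Directedness makes the initial
  segment of degree \<open>q\<close> independent of the member of \<open>S\<close> from which it is taken.
\<close>

lemma infinite_path_of_directed_set:
  assumes mor: "S \<subseteq> mor L"
    and dir: "\<And>a b. \<lbrakk>a \<in> S; b \<in> S\<rbrakk> \<Longrightarrow> \<exists>c\<in>S. prefix a c \<and> prefix b c"
    and cof: "\<And>q. \<exists>a\<in>S. q \<le> deg L a"
  obtains x where "x \<in> infinite_paths L" "\<And>a. a \<in> S \<Longrightarrow> x (0, deg L a) = a"
proof -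
  have "\<exists>m. deg L m = q \<and> (\<exists>a\<in>S. prefix m a)" for q
    using cof[of q] mor prefix_exists by (metis subsetD)
  then obtain P where P: "\<And>q. deg L (P q) = q" "\<And>q. \<exists>a\<in>S. prefix (P q) a"
    by metis
  have "prefix (P p) (P q)" if "p \<le> q" for p q
  proof -
    obtain a b where ab: "a \<in> S" "prefix (P p) a" "b \<in> S" "prefix (P q) b" using P(2) by blast
    obtain c where c: "prefix a c" "prefix b c" using dir[OF ab(1,3)] by blast
    have "prefix (P p) c" "prefix (P q) c"
      by (rule prefix_trans[OF ab(2) c(1)], rule prefix_trans[OF ab(4) c(2)])
    then show ?thesis by (rule prefix_linear) (simp add: P(1) that)
  qed
  then obtain x where x: "x \<in> infinite_paths L" "\<And>q. x (0, q) = P q"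
    using infinite_path_exists[of P] P prefix_mor by metis
  have "P (deg L a) = a" if a: "a \<in> S" for a
  proof -
    obtain b where b: "b \<in> S" "prefix (P (deg L a)) b" using P(2) by blast
    obtain c where c: "prefix a c" "prefix b c" using dir[OF a b(1)] by blast
    show ?thesis by (rule prefix_unique[OF prefix_trans[OF b(2) c(2)] c(1)]) (simp add: P(1))
  qed
  then show ?thesis using that x by simp
qed

lemma path_shift_apply: "p \<le> q \<Longrightarrow> path_shift m x (p, q) = x (p + m, q + m)"
  by (simp add: path_shift_def mor_Omega_iff)

lemma path_shift_infinite_path:
  assumes x: "x \<in> infinite_paths L"
  shows "path_shift m x \<in> infinite_paths L"
  unfolding infinite_paths_def degree_functor_def
proof (safe, goal_cases)
  case 1 show ?case by (simp add: path_shift_def)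
next
  case (2 p q) then show ?case
    using infinite_path_mor[OF x vec_nat_add_mono] by (simp add: mor_Omega_iff path_shift_apply)
next
  case (3 p q) then show ?case
    using infinite_path_mor[OF x vec_nat_add_mono]
    by (simp add: mor_Omega_iff path_shift_apply) (simp add: Omega_def path_shift_apply)
next
  case (4 p q) then show ?case
    using infinite_path_mor[OF x vec_nat_add_mono]
    by (simp add: mor_Omega_iff path_shift_apply) (simp add: Omega_def path_shift_apply)
next
  case (5 p q) then show ?case
    using infinite_path_mor[OF x vec_nat_add_mono]
    by (simp add: mor_Omega_iff path_shift_apply vec_nat_diff_cancel) (simp add: Omega_def)
next
  case (6 p q q' r)
  then have *: "p \<le> q" "q \<le> r" "q' = q" by (simp_all add: mor_Omega_iff) (simp_all add: Omega_def)
  then show ?case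
    using infinite_path_cmp[OF x vec_nat_add_mono[OF *(1)] vec_nat_add_mono[OF *(2)], of m] order_trans[of p q r]
    by (simp add: Omega_def path_shift_apply)
qed

lemma path_shift_0:
  assumes "x \<in> infinite_paths L"
  shows "path_shift 0 x = x"
proof
  fix l
  have "x \<in> extensional (mor Omega)" using assms by (simp add: infinite_paths_def)
  then show "path_shift 0 x l = x l"
    by (cases l) (auto simp: path_shift_def restrict_def extensional_def)
qed

lemma path_shift_add: "path_shift m (path_shift n x) = path_shift (m + n) x"
proof
  fix l
  show "path_shift m (path_shift n x) l = path_shift (m + n) x l"
  proof (cases l)
    case (Pair p q)
    have "p + m + n = p + (m + n)" "q + m + n = q + (m + n)" by (simp_all only: add.assoc)
    then show ?thesis
      using vec_nat_add_mono[of p q m] by (simp add: Pair path_shift_def mor_Omega_iff)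
  qed
qed

lemma path_shift_segment:
  assumes "x \<in> infinite_paths L"
  shows "x (0, m + q) = cmp L (x (0, m)) (path_shift m x (0, q))"
    "src L (x (0, m)) = rng L (path_shift m x (0, q))"
proof -
  have e: "path_shift m x (0, q) = x (m, m + q)"
    by (subst path_shift_apply[OF vec_nat_zero_le]) (simp only: add_0_left add.commute[of q m])
  show "x (0, m + q) = cmp L (x (0, m)) (path_shift m x (0, q))"
    unfolding e by (rule infinite_path_cmp[OF assms vec_nat_zero_le vec_nat_le_add])
  show "src L (x (0, m)) = rng L (path_shift m x (0, q))"
    unfolding e infinite_path_mor(2)[OF assms vec_nat_zero_le] infinite_path_mor(3)[OF assms vec_nat_le_add] ..
qed

text \<open>
  The path \<open>l x\<close> is the limit of the finite paths \<open>l x(0, q)\<close>.  It is unique because its initial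
  segment of degree \<open>d(l) + q\<close> has to be \<open>l x(0, q)\<close>.
\<close>

lemma prefixing_exists_unique:
  assumes l: "l \<in> mor L" and x: "x \<in> infinite_paths L" and s: "src L l = x (0, 0)"
  shows "\<exists>!y. y \<in> infinite_paths L \<and> y (0, deg L l) = l \<and> path_shift (deg L l) y = x"
proof (rule ex_ex1I)
  have src: "src L l = rng L (x (0, q))" for q
    using infinite_path_mor(3)[OF x vec_nat_zero_le] s by simp
  have deg: "deg L (cmp L l (x (0, q))) = deg L l + q" for q
    using deg_cmp[OF l infinite_path_mor0[OF x] src] infinite_path_deg0[OF x] by simp
  let ?S = "range (\<lambda>q. cmp L l (x (0, q)))"
  have pre: "prefix (cmp L l (x (0, p))) (cmp L l (x (0, q)))" if "p \<le> q" for p q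
    using prefix_cmp_left[OF infinite_path_prefix[OF x that] l src] .
  obtain y where y: "y \<in> infinite_paths L" "\<And>a. a \<in> ?S \<Longrightarrow> y (0, deg L a) = a"
  proof (rule infinite_path_of_directed_set[of ?S])
    show "?S \<subseteq> mor L" using cmp_mor l infinite_path_mor0[OF x] src by auto
    show "\<exists>c\<in>?S. prefix a c \<and> prefix b c" if ab: "a \<in> ?S" "b \<in> ?S" for a b
    proof -
      obtain p q where "a = cmp L l (x (0, p))" "b = cmp L l (x (0, q))" using ab by auto
      then have "prefix a (cmp L l (x (0, p + q)))" "prefix b (cmp L l (x (0, p + q)))"
        using pre[OF vec_nat_le_add, of p q] pre[OF vec_nat_le_add, of q p] by (simp_all add: add.commute)
      then show ?thesis by blast
    qed
    show "\<exists>a\<in>?S. q \<le> deg L a" for q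
      using vec_nat_le_add[of q "deg L l"] by (auto simp: deg add.commute)
  qed blast
  have yq: "y (0, deg L l + q) = cmp L l (x (0, q))" for q
    using y(2)[of "cmp L l (x (0, q))"] deg by simp
  have x0: "x (0, 0) = src L l" using s by simp
  have yl: "y (0, deg L l) = l" using yq[of 0] x0 l by (simp add: cmp_src)
  have "path_shift (deg L l) y = x"
  proof (rule infinite_path_eqI[OF path_shift_infinite_path[OF y(1)] x])
    fix q
    have "path_shift (deg L l) y (0, q) = x (0, q)"
    proof (rule factorization_unique(2)[of l _ l])
      show "cmp L l (path_shift (deg L l) y (0, q)) = cmp L l (x (0, q))"
        using path_shift_segment(1)[OF y(1), of "deg L l" q] yq yl by simp
      show "src L l = rng L (path_shift (deg L l) y (0, q))"
        using path_shift_segment(2)[OF y(1), of "deg L l" q] yl by simp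
    qed (auto simp: l src infinite_path_mor0 x path_shift_infinite_path y)
    then show "\<exists>r\<ge>q. path_shift (deg L l) y (0, r) = x (0, r)" by blast
  qed
  with y(1) yl show "\<exists>y. y \<in> infinite_paths L \<and> y (0, deg L l) = l \<and> path_shift (deg L l) y = x"
    by blast
next
  fix y y'
  assume a: "y \<in> infinite_paths L \<and> y (0, deg L l) = l \<and> path_shift (deg L l) y = x"
    "y' \<in> infinite_paths L \<and> y' (0, deg L l) = l \<and> path_shift (deg L l) y' = x"
  have *: "z (0, deg L l + q) = cmp L l (x (0, q))"
    if "z \<in> infinite_paths L \<and> z (0, deg L l) = l \<and> path_shift (deg L l) z = x" for z q
  proof -
    have z: "z \<in> infinite_paths L" "z (0, deg L l) = l" "path_shift (deg L l) z = x" using that by blast+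
    show ?thesis using path_shift_segment(1)[OF z(1), of "deg L l" q] unfolding z(2) z(3) .
  qed
  show "y = y'"
  proof (rule infinite_path_eqI)
    fix q
    have "y (0, deg L l + q) = y' (0, deg L l + q)"
      by (rule trans[OF *[OF a(1)] *[OF a(2), symmetric]])
    moreover have "q \<le> deg L l + q" using vec_nat_le_add[of q "deg L l"] by (subst add.commute)
    ultimately show "\<exists>r\<ge>q. y (0, r) = y' (0, r)" by blast
  next
    show "y \<in> infinite_paths L" "y' \<in> infinite_paths L" using a by blast+
  qed
qed

lemma prefixing_properties:
  assumes "l \<in> mor L" "x \<in> infinite_paths L" "src L l = x (0, 0)"
  shows "prefixing L l x \<in> cylinder L l" "path_shift (deg L l) (prefixing L l x) = x"
  unfolding cylinder_def prefixing_def
  using theI'[OF prefixing_exists_unique[OF assms]] by blast+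

lemma prefixing_eqI:
  assumes "l \<in> mor L" "y \<in> cylinder L l"
  shows "prefixing L l (path_shift (deg L l) y) = y"
proof -
  have y: "y \<in> infinite_paths L" "y (0, deg L l) = l" using assms(2) by (auto simp: cylinder_def)
  have s: "src L l = path_shift (deg L l) y (0, 0)"
    using infinite_path_mor(2)[OF y(1) vec_nat_zero_le, of "deg L l"] y(2)
    by (simp add: path_shift_apply)
  show ?thesis
    unfolding prefixing_def
    by (rule the1_equality[OF prefixing_exists_unique[OF assms(1) path_shift_infinite_path[OF y(1)] s]])
       (use y in blast)
qed

lemma cylinder_subset: "cylinder L l \<subseteq> infinite_paths L"
  by (auto simp: cylinder_def)

lemma mem_cylinder_iff_prefix:
  assumes "x \<in> infinite_paths L" "deg L l \<le> r"
  shows "x \<in> cylinder L l \<longleftrightarrow> prefix l (x (0, r))"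
  using infinite_path_prefix[OF assms] assms(1) prefix_unique[of "x (0, deg L l)" "x (0, r)" l]
  by (auto simp: cylinder_def infinite_path_deg0)

lemma cylinder_cmp_iff:
  assumes "l \<in> mor L" "\<nu> \<in> mor L" "src L l = rng L \<nu>"
  shows "x \<in> cylinder L (cmp L l \<nu>) \<longleftrightarrow> x \<in> cylinder L l \<and> path_shift (deg L l) x \<in> cylinder L \<nu>"
proof (cases "x \<in> infinite_paths L")
  case True
  have d: "deg L (cmp L l \<nu>) = deg L l + deg L \<nu>" using assms by (simp add: deg_cmp)
  note seg = path_shift_segment[OF True, of "deg L l" "deg L \<nu>"]
  note sh = path_shift_infinite_path[OF True]
  have 1: "x \<in> cylinder L l \<longleftrightarrow> x (0, deg L l) = l" using True by (simp add: cylinder_def)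
  have 2: "path_shift (deg L l) x \<in> cylinder L \<nu> \<longleftrightarrow> path_shift (deg L l) x (0, deg L \<nu>) = \<nu>"
    using sh by (simp add: cylinder_def)
  have 3: "x \<in> cylinder L (cmp L l \<nu>) \<longleftrightarrow>
      cmp L (x (0, deg L l)) (path_shift (deg L l) x (0, deg L \<nu>)) = cmp L l \<nu>"
    using True unfolding cylinder_def mem_Collect_eq d seg(1) by blast
  show ?thesis
    unfolding 1 2 3
  proof
    assume "cmp L (x (0, deg L l)) (path_shift (deg L l) x (0, deg L \<nu>)) = cmp L l \<nu>"
    then show "x (0, deg L l) = l \<and> path_shift (deg L l) x (0, deg L \<nu>) = \<nu>"
      using factorization_unique[OF infinite_path_mor0[OF True] infinite_path_mor0[OF sh] assms(1,2)
        seg(2) assms(3) _ infinite_path_deg0[OF True]] by blast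
  qed simp
qed (auto simp: cylinder_def)

lemma prefixing_cmp:
  assumes "l \<in> mor L" "\<nu> \<in> mor L" "src L l = rng L \<nu>" "x \<in> infinite_paths L" "src L \<nu> = x (0, 0)"
  shows "prefixing L l (prefixing L \<nu> x) = prefixing L (cmp L l \<nu>) x"
proof -
  note p = prefixing_properties[OF assms(2,4,5)]
  have y: "prefixing L \<nu> x \<in> infinite_paths L" using p(1) cylinder_subset by blast
  have "prefixing L \<nu> x (0, deg L \<nu>) = \<nu>" using p(1) by (simp add: cylinder_def)
  then have s: "src L l = prefixing L \<nu> x (0, 0)"
    using infinite_path_mor(3)[OF y vec_nat_zero_le, of "deg L \<nu>"] assms(3) by simp
  note q = prefixing_properties[OF assms(1) y s]
  have "prefixing L l (prefixing L \<nu> x) \<in> cylinder L (cmp L l \<nu>)"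
    using cylinder_cmp_iff[OF assms(1-3)] p q by simp
  moreover have "path_shift (deg L (cmp L l \<nu>)) (prefixing L l (prefixing L \<nu> x)) = x"
    using p(2) q(2) assms(1-3) by (simp add: deg_cmp add.commute flip: path_shift_add)
  ultimately show ?thesis using prefixing_eqI[OF cmp_mor[OF assms(1-3)]] by metis
qed

section \<open>The Borel structure of the path space\<close>

definition diagonal_cylinders :: "('a, 'k) infpath set set" where
  "diagonal_cylinders = {cylinder L l |l. l \<in> mor L \<and> (\<exists>n. deg L l = diagonal n)}"

text \<open>
  A cylinder set that contains \<open>x\<close> contains the cylinder set of every longer initial segment of \<open>x\<close>,
  so finite intersections in the topology can be met by taking the larger of two diagonal degrees.
\<close>

lemma open_contains_diagonal_cylinder:
  assumes "openin (path_topology L) U" "x \<in> U"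
  shows "x \<in> infinite_paths L \<and> (\<exists>n. cylinder L (x (0, diagonal n)) \<subseteq> U)"
proof -
  have "generate_topology_on (cylinder L ` mor L) U"
    using assms(1) by (simp add: path_topology_def openin_topology_generated_by_iff)
  then show ?thesis using assms(2)
  proof (induction arbitrary: x)
    case Empty then show ?case by simp
  next
    case (Int a b)
    then obtain m n where mn: "cylinder L (x (0, diagonal m)) \<subseteq> a" "cylinder L (x (0, diagonal n)) \<subseteq> b"
      and x: "x \<in> infinite_paths L" by blast
    have *: "cylinder L (x (0, diagonal (max m n))) \<subseteq> cylinder L (x (0, diagonal k))" if "k \<le> max m n" for k
    proof
      fix y assume y: "y \<in> cylinder L (x (0, diagonal (max m n)))"
      then have yi: "y \<in> infinite_paths L" and eq: "y (0, diagonal (max m n)) = x (0, diagonal (max m n))"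
        by (auto simp: cylinder_def infinite_path_deg0[OF x])
      have "prefix (x (0, diagonal k)) (y (0, diagonal (max m n)))"
        using infinite_path_prefix[OF x diagonal_mono[OF that]] eq by simp
      then show "y \<in> cylinder L (x (0, diagonal k))"
        using mem_cylinder_iff_prefix[OF yi, of "x (0, diagonal k)" "diagonal (max m n)"]
          diagonal_mono[OF that]
        by (simp add: infinite_path_deg0[OF x])
    qed
    have "cylinder L (x (0, diagonal (max m n))) \<subseteq> a \<inter> b" using *[of m] *[of n] mn by auto
    then show ?case using x by blast
  next
    case (UN K) then show ?case by (meson Union_iff Union_upper order_trans)
  next
    case (Basis s)
    then obtain l where l: "l \<in> mor L" "s = cylinder L l" "x \<in> cylinder L l" by blast
    then have x: "x \<in> infinite_paths L" by (simp add: cylinder_def)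
    let ?n = "Max (range (\<lambda>i. deg L l $ i))"
    have "prefix l (x (0, diagonal ?n))"
      using mem_cylinder_iff_prefix[OF x le_diagonal_Max] l by blast
    then have "cylinder L (x (0, diagonal ?n)) \<subseteq> cylinder L l"
      using mem_cylinder_iff_prefix[OF _ le_diagonal_Max, of _ l]
      by (auto simp: cylinder_def infinite_path_deg0[OF x])
    then show ?case using l x by blast
  qed
qed

lemma open_cylinder: "l \<in> mor L \<Longrightarrow> openin (path_topology L) (cylinder L l)"
  by (auto simp: path_topology_def openin_topology_generated_by_iff intro: generate_topology_on.Basis)

lemma space_path_borel [simp]: "space (path_borel L) = infinite_paths L"
  using open_contains_diagonal_cylinder unfolding path_borel_def by (subst space_measure_of) auto

lemma sets_path_borel_opens:
  "sets (path_borel L) = sigma_sets (infinite_paths L) {U. openin (path_topology L) U}"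
  using open_contains_diagonal_cylinder unfolding path_borel_def by (subst sets_measure_of) auto

text \<open>
  There are only countably many finite paths, so an open set is a countable union of diagonal
  cylinder sets.
\<close>

lemma sets_path_borel: "sets (path_borel L) = sigma_sets (infinite_paths L) diagonal_cylinders"
  unfolding sets_path_borel_opens
proof (rule sigma_sets_eqI)
  fix U assume "U \<in> {U. openin (path_topology L) U}"
  then have U: "openin (path_topology L) U" by simp
  let ?C = "{c \<in> diagonal_cylinders. c \<subseteq> U}"
  have "countable diagonal_cylinders"
    by (rule countable_subset[of _ "cylinder L ` mor L"])
       (auto simp: diagonal_cylinders_def countable_mor)
  then have c: "countable ?C" by (rule countable_subset[rotated]) auto
  have "U = \<Union> ?C"
  proof
    show "U \<subseteq> \<Union> ?C"
    proof
      fix x assume "x \<in> U"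
      then obtain n where x: "x \<in> infinite_paths L" and n: "cylinder L (x (0, diagonal n)) \<subseteq> U"
        using open_contains_diagonal_cylinder[OF U] by blast
      have "cylinder L (x (0, diagonal n)) \<in> ?C"
        using n infinite_path_deg0[OF x] infinite_path_mor0[OF x] by (auto simp: diagonal_cylinders_def)
      moreover have "x \<in> cylinder L (x (0, diagonal n))"
        using x by (simp add: cylinder_def infinite_path_deg0)
      ultimately show "x \<in> \<Union> ?C" by blast
    qed
  qed blast
  moreover have "\<Union> ?C \<in> sigma_sets (infinite_paths L) diagonal_cylinders"
    by (rule sigma_sets_UNION[OF c]) auto
  ultimately show "U \<in> sigma_sets (infinite_paths L) diagonal_cylinders" by simp
next
  fix c assume "c \<in> diagonal_cylinders"
  then show "c \<in> sigma_sets (infinite_paths L) {U. openin (path_topology L) U}"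
    using open_cylinder by (auto simp: diagonal_cylinders_def)
qed

lemma cylinder_sets [measurable]: "l \<in> mor L \<Longrightarrow> cylinder L l \<in> sets (path_borel L)"
  using open_cylinder by (auto simp: sets_path_borel_opens)

lemma measurable_path_borelI:
  assumes "f \<in> space N \<rightarrow> infinite_paths L"
    and "\<And>l n. \<lbrakk>l \<in> mor L; deg L l = diagonal n\<rbrakk> \<Longrightarrow> f -` cylinder L l \<inter> space N \<in> sets N"
  shows "f \<in> N \<rightarrow>\<^sub>M path_borel L"
  by (rule measurable_sigma_sets[OF sets_path_borel])
     (use assms cylinder_subset in \<open>fastforce simp: diagonal_cylinders_def\<close>)+

text \<open>
  Diagonal degrees are linearly ordered, so two diagonal cylinder sets are nested or disjoint.
\<close>

lemma diagonal_cylinders_Int_stable: "Int_stable (insert {} diagonal_cylinders)"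
proof (rule Int_stableI)
  have *: "cylinder L l \<inter> cylinder L m \<in> insert {} diagonal_cylinders"
    if "l \<in> mor L" "m \<in> mor L" "deg L l = diagonal i" "deg L m = diagonal j" "i \<le> j" for l m i j
  proof -
    have "cylinder L l \<inter> cylinder L m = (if prefix l m then cylinder L m else {})"
      using mem_cylinder_iff_prefix[of _ l "deg L m"] that diagonal_mono[of i j]
      by (auto simp: cylinder_def)
    then show ?thesis using that by (auto simp: diagonal_cylinders_def)
  qed
  fix a b assume "a \<in> insert {} diagonal_cylinders" "b \<in> insert {} diagonal_cylinders"
  then consider "a = {} \<or> b = {}" | l m i j where "l \<in> mor L" "m \<in> mor L" "deg L l = diagonal i"
    "deg L m = diagonal j" "a = cylinder L l" "b = cylinder L m"
    by (auto simp: diagonal_cylinders_def)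
  then show "a \<inter> b \<in> insert {} diagonal_cylinders"
  proof cases
    case 2
    then show ?thesis
      using *[of l m i j] *[of m l j i] by (cases "i \<le> j") (auto simp: Int_commute)
  qed auto
qed

lemma sets_path_borel_insert: "sets (path_borel L) = sigma_sets (infinite_paths L) (insert {} diagonal_cylinders)"
  unfolding sets_path_borel by (rule sigma_sets_eqI) (auto intro: sigma_sets.Empty)

end

section \<open>Hilbert spaces and their bounded operators\<close>

text \<open>
  The vector space identities are not listed: \<open>inner_ext\<close> says that a vector is determined by its
  inner products, so every such identity follows from the sesquilinearity of the inner product.
  This keeps the axioms close to what has to be computed for \<open>L\<^sup>2\<close>.
\<close>

locale hilbert =
  fixes H :: "'v hilbert_data"
  assumes zero_vec: "vzero H \<in> vectors H"
    and plus_vec: "\<lbrakk>u \<in> vectors H; w \<in> vectors H\<rbrakk> \<Longrightarrow> vplus H u w \<in> vectors H"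
    and scale_vec: "u \<in> vectors H \<Longrightarrow> vscale H z u \<in> vectors H"
    and inner_commute: "\<lbrakk>u \<in> vectors H; w \<in> vectors H\<rbrakk> \<Longrightarrow> vinner H w u = cnj (vinner H u w)"
    and inner_zero: "u \<in> vectors H \<Longrightarrow> vinner H (vzero H) u = 0"
    and inner_plus: "\<lbrakk>u \<in> vectors H; u' \<in> vectors H; w \<in> vectors H\<rbrakk>
      \<Longrightarrow> vinner H (vplus H u u') w = vinner H u w + vinner H u' w"
    and inner_scale: "\<lbrakk>u \<in> vectors H; w \<in> vectors H\<rbrakk> \<Longrightarrow> vinner H (vscale H z u) w = z * vinner H u w"
    and inner_nonneg: "u \<in> vectors H \<Longrightarrow> 0 \<le> Re (vinner H u u)"
    and inner_ext: "\<lbrakk>u \<in> vectors H; w \<in> vectors H; \<And>t. t \<in> vectors H \<Longrightarrow> vinner H u t = vinner H w t\<rbrakk>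
      \<Longrightarrow> u = w"
    and norm_complete: "\<lbrakk>\<And>n. X n \<in> vectors H;
        \<And>\<epsilon>. 0 < \<epsilon> \<Longrightarrow> \<exists>N. \<forall>m\<ge>N. \<forall>n\<ge>N. vnorm H (vplus H (X m) (vscale H (-1) (X n))) < \<epsilon>\<rbrakk>
      \<Longrightarrow> \<exists>u\<in>vectors H. (\<lambda>n. vnorm H (vplus H (X n) (vscale H (-1) u))) \<longlonglongrightarrow> 0"
begin

abbreviation vminus :: "'v \<Rightarrow> 'v \<Rightarrow> 'v" where
  "vminus u w \<equiv> vplus H u (vscale H (-1) w)"

lemma inner_plus_right:
  "\<lbrakk>u \<in> vectors H; w \<in> vectors H; w' \<in> vectors H\<rbrakk>
    \<Longrightarrow> vinner H u (vplus H w w') = vinner H u w + vinner H u w'"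
  using inner_commute[of "vplus H w w'" u] inner_commute[of w u] inner_commute[of w' u]
  by (simp add: plus_vec inner_plus)

lemma inner_scale_right:
  "\<lbrakk>u \<in> vectors H; w \<in> vectors H\<rbrakk> \<Longrightarrow> vinner H u (vscale H z w) = cnj z * vinner H u w"
  using inner_commute[of "vscale H z w" u] inner_commute[of w u] by (simp add: scale_vec inner_scale)

lemma inner_zero_right: "u \<in> vectors H \<Longrightarrow> vinner H u (vzero H) = 0"
  using inner_commute[of "vzero H" u] by (simp add: zero_vec inner_zero)

lemmas inner_simps = zero_vec plus_vec scale_vec inner_zero inner_zero_right inner_plus
  inner_plus_right inner_scale inner_scale_right

lemma vnorm_nonneg: "u \<in> vectors H \<Longrightarrow> 0 \<le> vnorm H u"
  by (simp add: vnorm_def inner_nonneg)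

lemma vnorm_squared: "u \<in> vectors H \<Longrightarrow> (vnorm H u)\<^sup>2 = Re (vinner H u u)"
  by (simp add: vnorm_def inner_nonneg)

lemma inner_self: "u \<in> vectors H \<Longrightarrow> vinner H u u = complex_of_real ((vnorm H u)\<^sup>2)"
  using inner_commute[of u u] by (simp add: vnorm_squared complex_eq_iff)

lemma Re_inner_commute: "\<lbrakk>u \<in> vectors H; w \<in> vectors H\<rbrakk> \<Longrightarrow> Re (vinner H w u) = Re (vinner H u w)"
  using inner_commute[of u w] by simp

lemma vnorm_plus_squared:
  assumes "u \<in> vectors H" "w \<in> vectors H"
  shows "(vnorm H (vplus H u w))\<^sup>2 = (vnorm H u)\<^sup>2 + (vnorm H w)\<^sup>2 + 2 * Re (vinner H u w)"
  using assms Re_inner_commute[OF assms] by (simp add: vnorm_squared inner_simps)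

lemma vnorm_scale: 
  assumes "u \<in> vectors H"
  shows "vnorm H (vscale H z u) = cmod z * vnorm H u"
proof -
  have "z * (cnj z * vinner H u u) = complex_of_real ((cmod z * vnorm H u)\<^sup>2)"
    unfolding inner_self[OF assms] power_mult_distrib of_real_mult
    by (simp add: mult.assoc[symmetric] complex_norm_square[symmetric])
  then have "vinner H (vscale H z u) (vscale H z u) = complex_of_real ((cmod z * vnorm H u)\<^sup>2)"
    using assms by (simp add: inner_simps mult.left_commute)
  then show ?thesis unfolding vnorm_def[of H "vscale H z u"] by (simp add: vnorm_nonneg assms)
qed

text \<open>
  Expand \<open>0 \<le> \<parallel>u - t c w\<parallel>\<^sup>2\<close> with \<open>c = \<langle>u, w\<rangle>\<close> and real \<open>t\<close>; take \<open>t = 1 / \<parallel>w\<parallel>\<^sup>2\<close> if \<open>w\<close> has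
  positive norm, and \<open>t\<close> large otherwise.
\<close>

lemma cauchy_schwarz:
  assumes u: "u \<in> vectors H" and w: "w \<in> vectors H"
  shows "cmod (vinner H u w) \<le> vnorm H u * vnorm H w"
proof -
  let ?c = "vinner H u w"
  have key: "0 \<le> (vnorm H u)\<^sup>2 - 2 * t * (cmod ?c)\<^sup>2 + t\<^sup>2 * (cmod ?c)\<^sup>2 * (vnorm H w)\<^sup>2" for t :: real
  proof -
    \<comment> \<open>The phase of \<open>?c\<close> in the coefficient makes the mixed term real.\<close>
    let ?z = "- complex_of_real t * ?c"
    have "0 \<le> (vnorm H (vplus H u (vscale H ?z w)))\<^sup>2" by simp
    also have "\<dots> = (vnorm H u)\<^sup>2 + (cmod ?z * vnorm H w)\<^sup>2 + 2 * Re (cnj ?z * ?c)"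
      using u w by (subst vnorm_plus_squared) (simp_all add: inner_simps vnorm_scale)
    also have "Re (cnj ?z * ?c) = - t * (cmod ?c)\<^sup>2"
      unfolding cmod_power2 by (simp add: algebra_simps power2_eq_square)
    also have "(cmod ?z * vnorm H w)\<^sup>2 = t\<^sup>2 * (cmod ?c)\<^sup>2 * (vnorm H w)\<^sup>2"
      by (simp add: norm_mult power_mult_distrib)
    finally show ?thesis by (simp add: algebra_simps)
  qed
  show ?thesis
  proof (cases "vnorm H w = 0")
    case True
    have "?c = 0"
    proof (rule ccontr)
      assume "?c \<noteq> 0"
      then have c: "(cmod ?c)\<^sup>2 > 0" by simp
      \<comment> \<open>This \<open>t\<close> makes the right-hand side of \<open>key\<close> equal to \<open>-1\<close>.\<close>
      have "0 \<le> (vnorm H u)\<^sup>2 - 2 * (((vnorm H u)\<^sup>2 + 1) / (2 * (cmod ?c)\<^sup>2)) * (cmod ?c)\<^sup>2"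
        using key[of "((vnorm H u)\<^sup>2 + 1) / (2 * (cmod ?c)\<^sup>2)"] True by simp
      also have "\<dots> = -1" using c by (simp add: field_simps)
      finally show False by simp
    qed
    then show ?thesis by (simp add: True)
  next
    case False
    then have w2: "(vnorm H w)\<^sup>2 > 0" by simp
    have "0 \<le> (vnorm H u)\<^sup>2 - (cmod ?c)\<^sup>2 / (vnorm H w)\<^sup>2"
    proof -
      have "2 * (1 / (vnorm H w)\<^sup>2) * (cmod ?c)\<^sup>2 = 2 * ((cmod ?c)\<^sup>2 / (vnorm H w)\<^sup>2)" by simp
      moreover have "(1 / (vnorm H w)\<^sup>2)\<^sup>2 * (cmod ?c)\<^sup>2 * (vnorm H w)\<^sup>2 = (cmod ?c)\<^sup>2 / (vnorm H w)\<^sup>2"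
        using w2 by (simp add: power2_eq_square)
      ultimately show ?thesis using key[of "1 / (vnorm H w)\<^sup>2"] by linarith
    qed
    then have "(cmod ?c)\<^sup>2 \<le> (vnorm H u * vnorm H w)\<^sup>2"
      using w2 by (simp add: field_simps power_mult_distrib)
    then show ?thesis using vnorm_nonneg u w by (simp add: abs_le_square_iff[symmetric])
  qed
qed

lemma vnorm_triangle:
  assumes u: "u \<in> vectors H" and w: "w \<in> vectors H"
  shows "vnorm H (vplus H u w) \<le> vnorm H u + vnorm H w"
proof -
  have "(vnorm H (vplus H u w))\<^sup>2 \<le> (vnorm H u + vnorm H w)\<^sup>2"
    using cauchy_schwarz[OF u w] complex_Re_le_cmod[of "vinner H u w"]
    by (simp add: vnorm_plus_squared u w power2_sum)
  then show ?thesis using vnorm_nonneg u w by (simp add: abs_le_square_iff[symmetric] plus_vec)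
qed

lemma vminus_vplus: "\<lbrakk>u \<in> vectors H; w \<in> vectors H\<rbrakk> \<Longrightarrow> vplus H (vminus u w) w = u"
  by (rule inner_ext) (simp_all add: inner_simps)

lemma vminus_swap: "\<lbrakk>u \<in> vectors H; w \<in> vectors H\<rbrakk> \<Longrightarrow> vnorm H (vminus u w) = vnorm H (vminus w u)"
  unfolding vnorm_def by (simp add: inner_simps algebra_simps)

lemma vnorm_eq_0: "u \<in> vectors H \<Longrightarrow> vnorm H u = 0 \<longleftrightarrow> u = vzero H"
proof safe
  assume u: "u \<in> vectors H" "vnorm H u = 0"
  show "u = vzero H"
  proof (rule inner_ext)
    fix t assume "t \<in> vectors H"
    then show "vinner H u t = vinner H (vzero H) t" using cauchy_schwarz[of u t] u by (simp add: inner_zero)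
  qed (use u zero_vec in auto)
qed (simp add: vnorm_def inner_zero)

lemma vnorm_minus_triangle:
  assumes "u \<in> vectors H" "w \<in> vectors H" "t \<in> vectors H"
  shows "vnorm H (vminus u t) \<le> vnorm H (vminus u w) + vnorm H (vminus w t)"
proof -
  have "vminus u t = vplus H (vminus u w) (vminus w t)"
    using assms by (intro inner_ext) (simp_all add: inner_simps)
  then show ?thesis using vnorm_triangle[of "vminus u w" "vminus w t"] assms by (simp add: inner_simps)
qed

lemma vnorm_le_minus:
  assumes "u \<in> vectors H" "w \<in> vectors H"
  shows "vnorm H u \<le> vnorm H w + vnorm H (vminus w u)"
  using vnorm_triangle[of "vminus u w" w] assms by (simp add: vminus_vplus inner_simps vminus_swap[of u w])

lemma inner_tendsto:
  assumes "\<And>n. X n \<in> vectors H" "u \<in> vectors H" "t \<in> vectors H"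
    and "(\<lambda>n. vnorm H (vminus (X n) u)) \<longlonglongrightarrow> 0"
  shows "(\<lambda>n. vinner H (X n) t) \<longlonglongrightarrow> vinner H u t"
proof -
  have "(\<lambda>n. vinner H (X n) t - vinner H u t) \<longlonglongrightarrow> 0"
  proof (rule Lim_null_comparison)
    show "\<forall>\<^sub>F n in sequentially. norm (vinner H (X n) t - vinner H u t) \<le> vnorm H (vminus (X n) u) * vnorm H t"
    proof (rule always_eventually, rule allI)
      fix n
      have "vinner H (X n) t - vinner H u t = vinner H (vminus (X n) u) t"
        using assms by (simp add: inner_simps)
      then show "norm (vinner H (X n) t - vinner H u t) \<le> vnorm H (vminus (X n) u) * vnorm H t"
        using cauchy_schwarz[of "vminus (X n) u" t] assms by (simp add: inner_simps)
    qed
    show "(\<lambda>n. vnorm H (vminus (X n) u) * vnorm H t) \<longlonglongrightarrow> 0"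
      using tendsto_mult_right[OF assms(4), of "vnorm H t"] by simp
  qed
  then show ?thesis by (simp add: LIM_zero_iff)
qed

text \<open>
  The first-order condition for a minimum at \<open>t = 0\<close>, in the form used for the Riesz
  representation theorem.
\<close>

lemma linear_coefficient_zero:
  fixes a b :: real
  assumes "0 \<le> a" "\<And>t. 0 \<le> t\<^sup>2 * a + 2 * t * b"
  shows "b = 0"
proof (rule ccontr)
  assume "b \<noteq> 0"
  \<comment> \<open>The vertex of the parabola with leading coefficient \<open>a + 1\<close>; the shift by 1 covers \<open>a = 0\<close>.\<close>
  have "0 \<le> (- b / (a + 1))\<^sup>2 * a + 2 * (- b / (a + 1)) * b" by (rule assms(2))
  also have "\<dots> = (b\<^sup>2 * a - 2 * b\<^sup>2 * (a + 1)) / (a + 1)\<^sup>2"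
    using assms(1) by (simp add: power2_eq_square divide_simps)
  also have "b\<^sup>2 * a - 2 * b\<^sup>2 * (a + 1) = - (b\<^sup>2 * (a + 2))" by (simp add: algebra_simps)
  also have "- (b\<^sup>2 * (a + 2)) / (a + 1)\<^sup>2 < 0"
    using \<open>b \<noteq> 0\<close> assms(1) by (simp add: divide_neg_pos)
  finally show False by simp
qed

text \<open>
  The representing vector is the minimizer of \<open>J u = \<parallel>u\<parallel>\<^sup>2 - 2 Re (\<phi> u)\<close>.  The parallelogram identity
  makes minimizing sequences Cauchy, and the first-order condition at the limit says
  \<open>Re (\<phi> h) = Re \<langle>h, w\<rangle>\<close> for all \<open>h\<close>; applying this to \<open>\<i> h\<close> gives the imaginary part.
\<close>

lemma riesz_representation:
  assumes add: "\<And>u w. \<lbrakk>u \<in> vectors H; w \<in> vectors H\<rbrakk> \<Longrightarrow> \<phi> (vplus H u w) = \<phi> u + \<phi> w"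
    and scale: "\<And>z u. u \<in> vectors H \<Longrightarrow> \<phi> (vscale H z u) = z * \<phi> u"
    and bound: "\<And>u. u \<in> vectors H \<Longrightarrow> cmod (\<phi> u) \<le> C * vnorm H u"
  obtains w where "w \<in> vectors H" "\<And>u. u \<in> vectors H \<Longrightarrow> \<phi> u = vinner H u w"
proof -
  define J where "J u = (vnorm H u)\<^sup>2 - 2 * Re (\<phi> u)" for u
  define j where "j = Inf (J ` vectors H)"
  have lower: "- C\<^sup>2 \<le> J u" if "u \<in> vectors H" for u
  proof -
    have "Re (\<phi> u) \<le> C * vnorm H u" using bound[OF that] complex_Re_le_cmod[of "\<phi> u"] by simp
    moreover have "0 \<le> (vnorm H u - C)\<^sup>2" by simp
    ultimately show ?thesis by (simp add: J_def power2_diff algebra_simps)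
  qed
  then have bdd: "bdd_below (J ` vectors H)" by (intro bdd_belowI2)
  then have jle: "j \<le> J u" if "u \<in> vectors H" for u
    unfolding j_def using that by (rule cINF_lower)
  have "\<exists>u. u \<in> vectors H \<and> J u < j + 1 / real (Suc n)" for n
  proof -
    have "Inf (J ` vectors H) < j + 1 / real (Suc n)" by (simp add: j_def)
    then show ?thesis using zero_vec by (subst (asm) cInf_less_iff[OF _ bdd]) auto
  qed
  then obtain X where X: "\<And>n. X n \<in> vectors H" "\<And>n. J (X n) < j + 1 / real (Suc n)" by metis
  have par: "(vnorm H (vminus u w))\<^sup>2 \<le> 2 * (J u + J w - 2 * j)"
    if u: "u \<in> vectors H" and w: "w \<in> vectors H" for u w
  proof -
    let ?m = "vscale H (1 / 2) (vplus H u w)"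
    have "j \<le> J ?m" using u w by (intro jle) (simp add: inner_simps)
    moreover have "(vnorm H ?m)\<^sup>2 = ((vnorm H u)\<^sup>2 + (vnorm H w)\<^sup>2 + 2 * Re (vinner H u w)) / 4"
      using u w by (simp add: vnorm_scale inner_simps power_divide vnorm_plus_squared)
    moreover have "Re (\<phi> ?m) = (Re (\<phi> u) + Re (\<phi> w)) / 2"
      using u w by (simp add: scale plus_vec add)
    moreover have "(vnorm H (vminus u w))\<^sup>2 = (vnorm H u)\<^sup>2 + (vnorm H w)\<^sup>2 - 2 * Re (vinner H u w)"
      using u w by (simp add: vnorm_plus_squared inner_simps vnorm_scale)
    ultimately show ?thesis by (simp add: J_def field_simps)
  qed
  have "\<exists>w\<in>vectors H. (\<lambda>n. vnorm H (vminus (X n) w)) \<longlonglongrightarrow> 0"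
  proof (rule norm_complete[OF X(1)])
    fix \<epsilon> :: real assume e: "0 < \<epsilon>"
    then obtain N where N: "4 / \<epsilon>\<^sup>2 < real N" using reals_Archimedean2 by blast
    show "\<exists>N. \<forall>m\<ge>N. \<forall>n\<ge>N. vnorm H (vminus (X m) (X n)) < \<epsilon>"
    proof (intro exI allI impI)
      fix m n assume mn: "N \<le> m" "N \<le> n"
      have "1 / real (Suc m) \<le> 1 / real (Suc N)" "1 / real (Suc n) \<le> 1 / real (Suc N)"
        using mn by (simp_all add: frac_le)
      moreover have "4 / real (Suc N) < \<epsilon>\<^sup>2"
      proof -
        have "4 < \<epsilon>\<^sup>2 * real N" using N e by (simp add: divide_less_eq mult.commute)
        also have "\<dots> \<le> \<epsilon>\<^sup>2 * real (Suc N)" using e by simp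
        finally show ?thesis by (simp add: divide_less_eq)
      qed
      ultimately have "(vnorm H (vminus (X m) (X n)))\<^sup>2 < \<epsilon>\<^sup>2"
        using par[OF X(1) X(1), of m n] X(2)[of m] X(2)[of n] by simp
      then show "vnorm H (vminus (X m) (X n)) < \<epsilon>" by (rule power_less_imp_less_base) (use e in simp)
    qed
  qed
  then obtain w where w: "w \<in> vectors H" "(\<lambda>n. vnorm H (vminus (X n) w)) \<longlonglongrightarrow> 0" by blast
  \<comment> \<open>The inequality at \<open>w\<close> is the limit of the almost minimality of \<open>X n\<close> in the direction \<open>h\<close>.\<close>
  have Re_eq: "Re (\<phi> h) = Re (vinner H h w)" if h: "h \<in> vectors H" for h
  proof -
    have "0 \<le> t\<^sup>2 * (vnorm H h)\<^sup>2 + 2 * t * (Re (vinner H w h) - Re (\<phi> h))" for t :: real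
    proof (rule LIMSEQ_le)
      have "(\<lambda>n. t\<^sup>2 * (vnorm H h)\<^sup>2 + 2 * t * (Re (vinner H (X n) h) - Re (\<phi> h)) + 1 / real (Suc n))
        \<longlonglongrightarrow> t\<^sup>2 * (vnorm H h)\<^sup>2 + 2 * t * (Re (vinner H w h) - Re (\<phi> h)) + 0"
        using LIMSEQ_inverse_real_of_nat
        by (intro tendsto_intros inner_tendsto X w h) (simp add: inverse_eq_divide)
      then show "(\<lambda>n. t\<^sup>2 * (vnorm H h)\<^sup>2 + 2 * t * (Re (vinner H (X n) h) - Re (\<phi> h)) + 1 / real (Suc n))
        \<longlonglongrightarrow> t\<^sup>2 * (vnorm H h)\<^sup>2 + 2 * t * (Re (vinner H w h) - Re (\<phi> h))" by simp
      have "0 \<le> t\<^sup>2 * (vnorm H h)\<^sup>2 + 2 * t * (Re (vinner H (X n) h) - Re (\<phi> h)) + 1 / real (Suc n)" for n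
      proof -
        let ?y = "vplus H (X n) (vscale H (of_real t) h)"
        have "j \<le> J ?y" using X h by (intro jle) (simp add: inner_simps)
        moreover have "(vnorm H ?y)\<^sup>2 = (vnorm H (X n))\<^sup>2 + t\<^sup>2 * (vnorm H h)\<^sup>2 + 2 * t * Re (vinner H (X n) h)"
          using X h by (simp add: vnorm_plus_squared inner_simps vnorm_scale power_mult_distrib)
        moreover have "Re (\<phi> ?y) = Re (\<phi> (X n)) + t * Re (\<phi> h)"
          using X h by (simp add: add scale scale_vec)
        ultimately show ?thesis using X(2)[of n] by (simp add: J_def algebra_simps)
      qed
      then show "\<exists>N. \<forall>n\<ge>N. 0 \<le> t\<^sup>2 * (vnorm H h)\<^sup>2 + 2 * t * (Re (vinner H (X n) h) - Re (\<phi> h)) + 1 / real (Suc n)"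
        by blast
    qed simp
    then have "Re (vinner H w h) - Re (\<phi> h) = 0" by (rule linear_coefficient_zero[rotated]) simp
    then show ?thesis using Re_inner_commute[OF h w(1)] by simp
  qed
  have "\<phi> u = vinner H u w" if u: "u \<in> vectors H" for u
    using Re_eq[OF u] Re_eq[OF scale_vec[OF u], of \<i>] u w(1)
    by (simp add: scale inner_scale complex_eq_iff)
  with w(1) show ?thesis using that by blast
qed

lemma bounded_operator_iff:
  "T \<in> bounded_operators H \<longleftrightarrow> T \<in> extensional (vectors H) \<and> T \<in> vectors H \<rightarrow> vectors H \<and>
    (\<forall>u\<in>vectors H. \<forall>w\<in>vectors H. T (vplus H u w) = vplus H (T u) (T w)) \<and>
    (\<forall>z. \<forall>u\<in>vectors H. T (vscale H z u) = vscale H z (T u)) \<and>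
    (\<exists>C\<ge>0. \<forall>u\<in>vectors H. vnorm H (T u) \<le> C * vnorm H u)"
proof -
  have "(\<exists>C\<ge>0. \<forall>u\<in>vectors H. vnorm H (T u) \<le> C * vnorm H u)"
    if C: "\<forall>u\<in>vectors H. vnorm H (T u) \<le> C * vnorm H u" for C
  proof (intro exI[of _ "\<bar>C\<bar>"] conjI ballI)
    fix u assume u: "u \<in> vectors H"
    then have "C * vnorm H u \<le> \<bar>C\<bar> * vnorm H u" by (intro mult_right_mono) (simp_all add: vnorm_nonneg)
    with C u show "vnorm H (T u) \<le> \<bar>C\<bar> * vnorm H u" by force
  qed simp
  then show ?thesis unfolding bounded_operators_def linear_on_def by blast
qed

lemma bounded_operatorD:
  assumes "T \<in> bounded_operators H"
  shows "T \<in> extensional (vectors H)" "\<And>u. u \<in> vectors H \<Longrightarrow> T u \<in> vectors H"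
    "\<And>u w. \<lbrakk>u \<in> vectors H; w \<in> vectors H\<rbrakk> \<Longrightarrow> T (vplus H u w) = vplus H (T u) (T w)"
    "\<And>z u. u \<in> vectors H \<Longrightarrow> T (vscale H z u) = vscale H z (T u)"
  using assms unfolding bounded_operator_iff by auto

lemma bounded_operator_bound:
  assumes "T \<in> bounded_operators H"
  obtains C where "0 \<le> C" "\<And>u. u \<in> vectors H \<Longrightarrow> vnorm H (T u) \<le> C * vnorm H u"
  using assms unfolding bounded_operator_iff by auto

lemma bounded_operatorI:
  assumes "T \<in> extensional (vectors H)" "\<And>u. u \<in> vectors H \<Longrightarrow> T u \<in> vectors H"
    "\<And>u w. \<lbrakk>u \<in> vectors H; w \<in> vectors H\<rbrakk> \<Longrightarrow> T (vplus H u w) = vplus H (T u) (T w)"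
    "\<And>z u. u \<in> vectors H \<Longrightarrow> T (vscale H z u) = vscale H z (T u)"
    "\<And>u. u \<in> vectors H \<Longrightarrow> vnorm H (T u) \<le> C * vnorm H u"
  shows "T \<in> bounded_operators H"
  using assms unfolding bounded_operators_def linear_on_def by blast

lemma operator_ext:
  assumes "S \<in> bounded_operators H" "T \<in> bounded_operators H"
    and "\<And>u. u \<in> vectors H \<Longrightarrow> S u = T u"
  shows "S = T"
  using assms bounded_operatorD(1) extensionalityI by metis

text \<open>
  For each \<open>w\<close>, the functional \<open>u \<mapsto> \<langle>T u, w\<rangle>\<close> is bounded; its representing vector is \<open>S w\<close>.
\<close>

lemma adjoint_exists:
  assumes T: "T \<in> bounded_operators H"
  obtains S where "S \<in> bounded_operators H"
    "\<And>u w. \<lbrakk>u \<in> vectors H; w \<in> vectors H\<rbrakk> \<Longrightarrow> vinner H (T u) w = vinner H u (S w)"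
proof -
  note TD = bounded_operatorD[OF T]
  obtain C where C: "0 \<le> C" "\<And>u. u \<in> vectors H \<Longrightarrow> vnorm H (T u) \<le> C * vnorm H u"
    using bounded_operator_bound[OF T] by blast
  have "\<exists>s. s \<in> vectors H \<and> (\<forall>u\<in>vectors H. vinner H (T u) w = vinner H u s)" if w: "w \<in> vectors H" for w
  proof -
    obtain s where "s \<in> vectors H" "\<And>u. u \<in> vectors H \<Longrightarrow> vinner H (T u) w = vinner H u s"
    proof (rule riesz_representation[of "\<lambda>u. vinner H (T u) w" "C * vnorm H w"])
      fix u assume u: "u \<in> vectors H"
      have "cmod (vinner H (T u) w) \<le> vnorm H (T u) * vnorm H w" using cauchy_schwarz TD u w by blast
      also have "\<dots> \<le> C * vnorm H u * vnorm H w" using C(2)[OF u] vnorm_nonneg[OF w] by (rule mult_right_mono)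
      finally show "cmod (vinner H (T u) w) \<le> C * vnorm H w * vnorm H u" by (simp add: ac_simps)
    qed (use TD w in \<open>simp_all add: inner_simps\<close>)
    then show ?thesis by blast
  qed
  then obtain S where S: "\<And>w. w \<in> vectors H \<Longrightarrow> S w \<in> vectors H"
    "\<And>u w. \<lbrakk>u \<in> vectors H; w \<in> vectors H\<rbrakk> \<Longrightarrow> vinner H (T u) w = vinner H u (S w)" by metis
  have S': "vinner H (S w) u = vinner H w (T u)" if "u \<in> vectors H" "w \<in> vectors H" for u w
    using S(2)[OF that] inner_commute[of "S w" u] inner_commute[of w "T u"] S(1) TD(2) that by simp
  let ?S = "restrict S (vectors H)"
  have "?S \<in> bounded_operators H"
  proof (rule bounded_operatorI[of _ C])
    fix u w assume "u \<in> vectors H" "w \<in> vectors H"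
    then show "?S (vplus H u w) = vplus H (?S u) (?S w)"
      by (intro inner_ext) (simp_all add: S S' inner_simps TD)
  next
    fix z u assume "u \<in> vectors H"
    then show "?S (vscale H z u) = vscale H z (?S u)"
      by (intro inner_ext) (simp_all add: S S' inner_simps TD)
  next
    fix w assume w: "w \<in> vectors H"
    have "(vnorm H (S w))\<^sup>2 = Re (vinner H (S w) (S w))" using S w by (simp add: vnorm_squared)
    also have "\<dots> \<le> cmod (vinner H w (T (S w)))" using S'[of "S w" w] S w complex_Re_le_cmod by simp
    also have "\<dots> \<le> vnorm H w * vnorm H (T (S w))" using cauchy_schwarz S w TD by simp
    also have "\<dots> \<le> vnorm H w * (C * vnorm H (S w))"
      using C(2)[of "S w"] S w vnorm_nonneg by (intro mult_left_mono) auto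
    finally have le: "(vnorm H (S w))\<^sup>2 \<le> (C * vnorm H w) * vnorm H (S w)" by (simp add: ac_simps)
    have "vnorm H (S w) \<le> C * vnorm H w"
    proof (cases "vnorm H (S w) = 0")
      case False
      then have "vnorm H (S w) > 0" using vnorm_nonneg[of "S w"] S w by simp
      then show ?thesis using le by (simp add: power2_eq_square)
    qed (use C vnorm_nonneg w in simp)
    then show "vnorm H (?S w) \<le> C * vnorm H w" using w by simp
  qed (simp_all add: S)
  then show ?thesis using that[of ?S] S by simp
qed

lemma adjoint_op_eqI:
  assumes "S \<in> bounded_operators H" 
    and "\<And>u w. \<lbrakk>u \<in> vectors H; w \<in> vectors H\<rbrakk> \<Longrightarrow> vinner H (T u) w = vinner H u (S w)"
  shows "adjoint_op H T = S"
  unfolding adjoint_op_def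
proof (rule the_equality)
  fix R assume R: "R \<in> bounded_operators H \<and> (\<forall>u\<in>vectors H. \<forall>w\<in>vectors H. vinner H (T u) w = vinner H u (R w))"
  show "R = S"
  proof (rule operator_ext)
    fix w assume w: "w \<in> vectors H"
    show "R w = S w"
    proof (rule inner_ext)
      fix t assume t: "t \<in> vectors H"
      have "vinner H t (R w) = vinner H t (S w)" using R assms(2) w t by metis
      then show "vinner H (R w) t = vinner H (S w) t"
        using inner_commute[of t "R w"] inner_commute[of t "S w"] t w R assms(1) bounded_operatorD(2) by metis
    qed (use w R assms(1) bounded_operatorD(2) in auto)
  qed (use R assms in auto)
qed (use assms in blast)

lemma adjoint_op:
  assumes "T \<in> bounded_operators H"
  shows "adjoint_op H T \<in> bounded_operators H"
    "\<And>u w. \<lbrakk>u \<in> vectors H; w \<in> vectors H\<rbrakk> \<Longrightarrow> vinner H (T u) w = vinner H u (adjoint_op H T w)"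
    "\<And>u w. \<lbrakk>u \<in> vectors H; w \<in> vectors H\<rbrakk> \<Longrightarrow> vinner H (adjoint_op H T u) w = vinner H u (T w)"
proof -
  obtain S where S: "S \<in> bounded_operators H"
    "\<And>u w. \<lbrakk>u \<in> vectors H; w \<in> vectors H\<rbrakk> \<Longrightarrow> vinner H (T u) w = vinner H u (S w)"
    using adjoint_exists[OF assms] by blast
  have e: "adjoint_op H T = S" using adjoint_op_eqI[OF S] .
  show "adjoint_op H T \<in> bounded_operators H" using S e by simp
  show 1: "vinner H (T u) w = vinner H u (adjoint_op H T w)" if "u \<in> vectors H" "w \<in> vectors H" for u w
    using S e that by simp
  show "vinner H (adjoint_op H T u) w = vinner H u (T w)" if "u \<in> vectors H" "w \<in> vectors H" for u w
    using 1[OF that(2,1)] inner_commute[of "T w" u] inner_commute[of w "adjoint_op H T u"] that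
      bounded_operatorD(2)[OF assms] bounded_operatorD(2)[OF S(1)] e by simp
qed

abbreviation opnorm :: "('v \<Rightarrow> 'v) \<Rightarrow> real" where
  "opnorm T \<equiv> nrm (BH H) T"

lemma unit_ball_image_bounded:
  assumes "T \<in> bounded_operators H"
  shows "bdd_above {vnorm H (T u) |u. u \<in> vectors H \<and> vnorm H u \<le> 1}"
proof -
  obtain C where C: "0 \<le> C" "\<And>u. u \<in> vectors H \<Longrightarrow> vnorm H (T u) \<le> C * vnorm H u"
    using bounded_operator_bound[OF assms] by blast
  have "vnorm H (T w) \<le> C" if "w \<in> vectors H" "vnorm H w \<le> 1" for w
    using C(2)[OF that(1)] mult_left_mono[OF that(2) C(1)] by simp
  then show ?thesis by (intro bdd_aboveI[of _ C]) auto
qed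

text \<open>
  Rescale \<open>u\<close> to norm 1; a vector of norm 0 is mapped to a vector of norm 0.
\<close>

lemma opnorm_bound:
  assumes T: "T \<in> bounded_operators H" and u: "u \<in> vectors H"
  shows "vnorm H (T u) \<le> opnorm T * vnorm H u"
proof -
  let ?A = "{vnorm H (T u) |u. u \<in> vectors H \<and> vnorm H u \<le> 1}"
  note TD = bounded_operatorD[OF T]
  obtain C where C: "0 \<le> C" "\<And>u. u \<in> vectors H \<Longrightarrow> vnorm H (T u) \<le> C * vnorm H u"
    using bounded_operator_bound[OF T] by blast
  have bdd: "bdd_above ?A" by (rule unit_ball_image_bounded[OF T])
  show ?thesis
  proof (cases "vnorm H u = 0")
    case True then show ?thesis using C(2)[OF u] by simp
  next
    case False
    then have n: "vnorm H u > 0" using vnorm_nonneg[OF u] by simp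
    let ?w = "vscale H (complex_of_real (1 / vnorm H u)) u"
    have "vnorm H ?w = 1" using n by (simp add: vnorm_scale[OF u] norm_divide)
    then have "vnorm H (T ?w) \<in> ?A" using scale_vec[OF u] by auto
    then have "vnorm H (T ?w) \<le> opnorm T" unfolding BH_def by (simp add: cSup_upper[OF _ bdd])
    moreover have "vnorm H (T ?w) = vnorm H (T u) / vnorm H u"
      using n by (simp add: TD vnorm_scale u norm_divide)
    ultimately show ?thesis using n by (simp add: divide_le_eq)
  qed
qed

lemma opnorm_le:
  assumes "\<And>u. u \<in> vectors H \<Longrightarrow> vnorm H (T u) \<le> C * vnorm H u" "0 \<le> C"
  shows "opnorm T \<le> C"
proof -
  have "Sup {vnorm H (T u) |u. u \<in> vectors H \<and> vnorm H u \<le> 1} \<le> C"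
  proof (rule cSup_least)
    have "vnorm H (vzero H) \<le> 1" using vnorm_eq_0[OF zero_vec] by simp
    then show "{vnorm H (T u) |u. u \<in> vectors H \<and> vnorm H u \<le> 1} \<noteq> {}" using zero_vec by blast
  next
    fix r assume "r \<in> {vnorm H (T u) |u. u \<in> vectors H \<and> vnorm H u \<le> 1}"
    then obtain u where u: "u \<in> vectors H" "vnorm H u \<le> 1" "r = vnorm H (T u)" by blast
    then have "r \<le> C * vnorm H u" using assms by simp
    also have "\<dots> \<le> C * 1" using u assms by (intro mult_left_mono) auto
    finally show "r \<le> C" by simp
  qed
  then show ?thesis by (simp add: BH_def)
qed

lemma opnorm_nonneg:
  assumes "T \<in> bounded_operators H" shows "0 \<le> opnorm T"
proof -
  let ?A = "{vnorm H (T u) |u. u \<in> vectors H \<and> vnorm H u \<le> 1}"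
  note TD = bounded_operatorD[OF assms]
  have bdd: "bdd_above ?A" by (rule unit_ball_image_bounded[OF assms])
  have "vnorm H (vzero H) \<le> 1" using vnorm_eq_0[OF zero_vec] by simp
  then have "vnorm H (T (vzero H)) \<in> ?A" using zero_vec by blast
  then have "vnorm H (T (vzero H)) \<le> Sup ?A" by (rule cSup_upper[OF _ bdd])
  then show ?thesis using vnorm_nonneg[OF TD(2)[OF zero_vec]] by (simp add: BH_def)
qed

lemma BH_sel [simp]:
  "carrier (BH H) = bounded_operators H"
  "S \<otimes>\<^bsub>BH H\<^esub> T = (\<lambda>u\<in>vectors H. S (T u))"
  "\<zero>\<^bsub>BH H\<^esub> = (\<lambda>u\<in>vectors H. vzero H)"
  "S \<oplus>\<^bsub>BH H\<^esub> T = (\<lambda>u\<in>vectors H. vplus H (S u) (T u))"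
  "z \<odot>\<^bsub>BH H\<^esub> T = (\<lambda>u\<in>vectors H. vscale H z (T u))"
  "star (BH H) T = adjoint_op H T"
  by (simp_all add: BH_def)

lemma vnorm_mult_le:
  assumes S: "S \<in> bounded_operators H" and T: "T \<in> bounded_operators H" and u: "u \<in> vectors H"
  shows "vnorm H ((\<lambda>u\<in>vectors H. S (T u)) u) \<le> opnorm S * opnorm T * vnorm H u"
proof -
  have "vnorm H (S (T u)) \<le> opnorm S * (opnorm T * vnorm H u)"
    using opnorm_bound[OF S, of "T u"] mult_left_mono[OF opnorm_bound[OF T u] opnorm_nonneg[OF S]]
      bounded_operatorD(2)[OF T u] by simp
  then show ?thesis using u by (simp add: mult.assoc)
qed

lemma mult_bounded:
  assumes S: "S \<in> bounded_operators H" and T: "T \<in> bounded_operators H"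
  shows "(\<lambda>u\<in>vectors H. S (T u)) \<in> bounded_operators H"
  by (rule bounded_operatorI[OF _ _ _ _ vnorm_mult_le[OF S T]])
     (use bounded_operatorD(2-4)[OF S] bounded_operatorD(2-4)[OF T] in
      \<open>simp_all add: plus_vec scale_vec restrict_extensional restrict_apply' del: restrict_apply\<close>)

lemma opnorm_mult:
  assumes S: "S \<in> bounded_operators H" and T: "T \<in> bounded_operators H"
  shows "opnorm (\<lambda>u\<in>vectors H. S (T u)) \<le> opnorm S * opnorm T"
  by (rule opnorm_le[OF vnorm_mult_le[OF S T]]) (simp_all add: opnorm_nonneg S T)

lemma vnorm_add_le:
  assumes S: "S \<in> bounded_operators H" and T: "T \<in> bounded_operators H" and u: "u \<in> vectors H"
  shows "vnorm H ((\<lambda>u\<in>vectors H. vplus H (S u) (T u)) u) \<le> (opnorm S + opnorm T) * vnorm H u"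
  using opnorm_bound[OF S u] opnorm_bound[OF T u] vnorm_triangle[of "S u" "T u"]
    bounded_operatorD(2)[OF S u] bounded_operatorD(2)[OF T u] u
  by (simp add: distrib_right)

lemma add_bounded:
  assumes S: "S \<in> bounded_operators H" and T: "T \<in> bounded_operators H"
  shows "(\<lambda>u\<in>vectors H. vplus H (S u) (T u)) \<in> bounded_operators H"
proof (rule bounded_operatorI[OF _ _ _ _ vnorm_add_le[OF S T]])
  note D = bounded_operatorD[OF S] bounded_operatorD[OF T]
  fix u w assume "u \<in> vectors H" "w \<in> vectors H"
  then show "(\<lambda>u\<in>vectors H. vplus H (S u) (T u)) (vplus H u w) =
      vplus H ((\<lambda>u\<in>vectors H. vplus H (S u) (T u)) u) ((\<lambda>u\<in>vectors H. vplus H (S u) (T u)) w)"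
    by (intro inner_ext) (simp_all add: D inner_simps)
next
  note D = bounded_operatorD[OF S] bounded_operatorD[OF T]
  fix z u assume "u \<in> vectors H"
  then show "(\<lambda>u\<in>vectors H. vplus H (S u) (T u)) (vscale H z u) =
      vscale H z ((\<lambda>u\<in>vectors H. vplus H (S u) (T u)) u)"
    by (intro inner_ext) (simp_all add: D inner_simps distrib_left)
qed (use bounded_operatorD(2-4)[OF S] bounded_operatorD(2-4)[OF T] in \<open>simp_all add: plus_vec restrict_extensional del: restrict_apply add: restrict_apply'\<close>)

lemma vnorm_smult_le:
  assumes T: "T \<in> bounded_operators H" and u: "u \<in> vectors H"
  shows "vnorm H ((\<lambda>u\<in>vectors H. vscale H z (T u)) u) \<le> (cmod z * opnorm T) * vnorm H u"
  using mult_left_mono[OF opnorm_bound[OF T u], of "cmod z"] bounded_operatorD(2)[OF T u] u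
  by (simp add: vnorm_scale mult.assoc)

lemma scale_bounded:
  assumes T: "T \<in> bounded_operators H"
  shows "(\<lambda>u\<in>vectors H. vscale H z (T u)) \<in> bounded_operators H"
proof (rule bounded_operatorI[OF _ _ _ _ vnorm_smult_le[OF T]])
  note D = bounded_operatorD[OF T]
  fix u w assume "u \<in> vectors H" "w \<in> vectors H"
  then show "(\<lambda>u\<in>vectors H. vscale H z (T u)) (vplus H u w) =
      vplus H ((\<lambda>u\<in>vectors H. vscale H z (T u)) u) ((\<lambda>u\<in>vectors H. vscale H z (T u)) w)"
    by (intro inner_ext) (simp_all add: D inner_simps distrib_left)
next
  note D = bounded_operatorD[OF T]
  fix y u assume "u \<in> vectors H"
  then show "(\<lambda>u\<in>vectors H. vscale H z (T u)) (vscale H y u) =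
      vscale H y ((\<lambda>u\<in>vectors H. vscale H z (T u)) u)"
    by (intro inner_ext) (simp_all add: D inner_simps)
qed (use bounded_operatorD(2-4)[OF T] in \<open>simp_all add: scale_vec restrict_extensional restrict_apply' del: restrict_apply\<close>)

lemma zero_bounded: "(\<lambda>u\<in>vectors H. vzero H) \<in> bounded_operators H"
proof (rule bounded_operatorI[of _ 0])
  fix u w assume "u \<in> vectors H" "w \<in> vectors H"
  then show "(\<lambda>u\<in>vectors H. vzero H) (vplus H u w) =
      vplus H ((\<lambda>u\<in>vectors H. vzero H) u) ((\<lambda>u\<in>vectors H. vzero H) w)"
    by (intro inner_ext) (simp_all add: inner_simps)
next
  fix z u assume "u \<in> vectors H"
  then show "(\<lambda>u\<in>vectors H. vzero H) (vscale H z u) = vscale H z ((\<lambda>u\<in>vectors H. vzero H) u)"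
    by (intro inner_ext) (simp_all add: inner_simps)
qed (use vnorm_eq_0[OF zero_vec] in \<open>simp_all add: zero_vec\<close>)

lemma BH_abelian_group: "abelian_group (BH H)"
proof (rule abelian_groupI)
  show "x \<oplus>\<^bsub>BH H\<^esub> y \<in> carrier (BH H)" if "x \<in> carrier (BH H)" "y \<in> carrier (BH H)" for x y
    using that by (simp add: add_bounded)
  show "\<zero>\<^bsub>BH H\<^esub> \<in> carrier (BH H)" by (simp add: zero_bounded)
  show "x \<oplus>\<^bsub>BH H\<^esub> y \<oplus>\<^bsub>BH H\<^esub> z = x \<oplus>\<^bsub>BH H\<^esub> (y \<oplus>\<^bsub>BH H\<^esub> z)"
    if "x \<in> carrier (BH H)" "y \<in> carrier (BH H)" "z \<in> carrier (BH H)" for x y z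
  proof -
    note D = that[simplified, THEN bounded_operatorD(2)]
    show ?thesis
      by (simp, intro restrict_ext inner_ext) (simp_all add: D inner_simps)
  qed
  show "x \<oplus>\<^bsub>BH H\<^esub> y = y \<oplus>\<^bsub>BH H\<^esub> x" if "x \<in> carrier (BH H)" "y \<in> carrier (BH H)" for x y
  proof -
    note D = that[simplified, THEN bounded_operatorD(2)]
    show ?thesis
      by (simp, intro restrict_ext inner_ext) (simp_all add: D inner_simps)
  qed
  show "\<zero>\<^bsub>BH H\<^esub> \<oplus>\<^bsub>BH H\<^esub> x = x" if x: "x \<in> carrier (BH H)" for x
  proof -
    have "vplus H (vzero H) (x u) = x u" if "u \<in> vectors H" for u
      using x that bounded_operatorD(2)[of x u] by (intro inner_ext) (simp_all add: inner_simps)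
    then show ?thesis using x bounded_operatorD(1)[of x]
      by (auto intro!: extensionalityI[of _ "vectors H"])
  qed
  show "\<exists>y\<in>carrier (BH H). y \<oplus>\<^bsub>BH H\<^esub> x = \<zero>\<^bsub>BH H\<^esub>" if x: "x \<in> carrier (BH H)" for x
  proof (rule bexI[of _ "-1 \<odot>\<^bsub>BH H\<^esub> x"])
    show "-1 \<odot>\<^bsub>BH H\<^esub> x \<in> carrier (BH H)" using x by (simp add: scale_bounded)
    note D = x[simplified, THEN bounded_operatorD(2)]
    show "(-1 \<odot>\<^bsub>BH H\<^esub> x) \<oplus>\<^bsub>BH H\<^esub> x = \<zero>\<^bsub>BH H\<^esub>"
      by (simp, intro restrict_ext inner_ext) (simp_all add: D inner_simps)
  qed
qed

lemma BH_minus: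
  assumes "S \<in> bounded_operators H" "T \<in> bounded_operators H"
  shows "S \<ominus>\<^bsub>BH H\<^esub> T = (\<lambda>u\<in>vectors H. vminus (S u) (T u))"
proof -
  interpret abelian_group "BH H" by (rule BH_abelian_group)
  note D = bounded_operatorD(2)[OF assms(2)]
  have "(-1 \<odot>\<^bsub>BH H\<^esub> T) \<oplus>\<^bsub>BH H\<^esub> T = \<zero>\<^bsub>BH H\<^esub>"
    by (simp, intro restrict_ext inner_ext) (simp_all add: D inner_simps)
  then have "\<ominus>\<^bsub>BH H\<^esub> T = -1 \<odot>\<^bsub>BH H\<^esub> T"
    using assms scale_bounded[OF assms(2)] by (intro minus_equality) auto
  then show ?thesis unfolding a_minus_def by (auto intro!: restrict_ext)
qed

lemma minus_bounded:
  assumes "S \<in> bounded_operators H" "T \<in> bounded_operators H"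
  shows "(\<lambda>u\<in>vectors H. vminus (S u) (T u)) \<in> bounded_operators H"
  using add_bounded[OF assms(1) scale_bounded[OF assms(2), of "-1"]]
  by (metis (no_types, lifting) restrict_apply' restrict_ext)

text \<open>
  The limit is taken pointwise in the Hilbert space.  Linearity passes to the limit through inner
  products, and the uniform Cauchy estimate on the unit ball gives boundedness and norm convergence.
\<close>

lemma BH_complete:
  assumes X: "\<And>n. X n \<in> bounded_operators H"
    and cauchy: "\<And>\<epsilon>. 0 < \<epsilon> \<Longrightarrow> \<exists>N. \<forall>m\<ge>N. \<forall>n\<ge>N. opnorm (X m \<ominus>\<^bsub>BH H\<^esub> X n) < \<epsilon>"
  shows "\<exists>a\<in>bounded_operators H. limit_in (BH H) X a"
proof -
  note XD = bounded_operatorD[OF X]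
  have diff: "vnorm H (vminus (X m u) (X n u)) \<le> opnorm (X m \<ominus>\<^bsub>BH H\<^esub> X n) * vnorm H u"
    if "u \<in> vectors H" for m n u
    using opnorm_bound[OF minus_bounded[OF X X], of u m n] that by (simp add: BH_minus[OF X X])
  have small: "\<exists>N. \<forall>m\<ge>N. \<forall>n\<ge>N. \<forall>u\<in>vectors H. vnorm H (vminus (X m u) (X n u)) \<le> \<epsilon> * vnorm H u"
    if e: "0 < \<epsilon>" for \<epsilon>
  proof -
    obtain N where N: "\<And>m n. \<lbrakk>N \<le> m; N \<le> n\<rbrakk> \<Longrightarrow> opnorm (X m \<ominus>\<^bsub>BH H\<^esub> X n) < \<epsilon>" using cauchy[OF e] by blast
    show ?thesis
    proof (intro exI allI impI ballI)
      fix m n u assume a: "N \<le> m" "N \<le> n" "u \<in> vectors H"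
      show "vnorm H (vminus (X m u) (X n u)) \<le> \<epsilon> * vnorm H u"
        using diff[OF a(3), of m n] mult_right_mono[OF less_imp_le[OF N[OF a(1,2)]] vnorm_nonneg[OF a(3)]] by linarith
    qed
  qed
  have "\<exists>a. a \<in> vectors H \<and> (\<lambda>n. vnorm H (vminus (X n u) a)) \<longlonglongrightarrow> 0" if u: "u \<in> vectors H" for u
  proof -
    have "\<exists>a\<in>vectors H. (\<lambda>n. vnorm H (vminus (X n u) a)) \<longlonglongrightarrow> 0"
    proof (rule norm_complete)
      fix \<epsilon> :: real assume e: "0 < \<epsilon>"
      let ?e = "\<epsilon> / (vnorm H u + 1)"
      have p: "vnorm H u + 1 > 0" using vnorm_nonneg[OF u] by simp
      then have "0 < ?e" using e by simp
      then obtain N where N: "\<And>m n. \<lbrakk>N \<le> m; N \<le> n\<rbrakk> \<Longrightarrow> vnorm H (vminus (X m u) (X n u)) \<le> ?e * vnorm H u"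
        using small u by blast
      have "?e * vnorm H u < \<epsilon>" using e p by (simp add: field_simps)
      then show "\<exists>N. \<forall>m\<ge>N. \<forall>n\<ge>N. vnorm H (vminus (X m u) (X n u)) < \<epsilon>" using N by (meson le_less_trans)
    qed (use XD u in simp)
    then show ?thesis by blast
  qed
  then obtain a where a: "\<And>u. u \<in> vectors H \<Longrightarrow> a u \<in> vectors H"
    "\<And>u. u \<in> vectors H \<Longrightarrow> (\<lambda>n. vnorm H (vminus (X n u) (a u))) \<longlonglongrightarrow> 0" by metis
  have lim: "(\<lambda>n. vinner H (X n u) t) \<longlonglongrightarrow> vinner H (a u) t" if "u \<in> vectors H" "t \<in> vectors H" for u t
    by (rule inner_tendsto[OF XD(2)[OF that(1)] a(1)[OF that(1)] that(2) a(2)[OF that(1)]])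
  have close: "\<exists>N. \<forall>n\<ge>N. \<forall>u\<in>vectors H. vnorm H (vminus (X n u) (a u)) \<le> \<epsilon> * vnorm H u"
    if e: "0 < \<epsilon>" for \<epsilon>
  proof -
    obtain N where N: "\<And>m n u. \<lbrakk>N \<le> m; N \<le> n; u \<in> vectors H\<rbrakk> \<Longrightarrow> vnorm H (vminus (X m u) (X n u)) \<le> \<epsilon> * vnorm H u"
      using small[OF e] by blast
    show ?thesis
    proof (intro exI allI impI ballI)
      fix n u assume n: "N \<le> n" and u: "u \<in> vectors H"
      show "vnorm H (vminus (X n u) (a u)) \<le> \<epsilon> * vnorm H u"
      proof (rule LIMSEQ_le[OF tendsto_const])
        show "(\<lambda>m. \<epsilon> * vnorm H u + vnorm H (vminus (X m u) (a u))) \<longlonglongrightarrow> \<epsilon> * vnorm H u"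
          using tendsto_add[OF tendsto_const a(2)[OF u], of "\<epsilon> * vnorm H u"] by simp
        show "\<exists>M. \<forall>m\<ge>M. vnorm H (vminus (X n u) (a u)) \<le> \<epsilon> * vnorm H u + vnorm H (vminus (X m u) (a u))"
        proof (intro exI allI impI)
          fix m assume "N \<le> m"
          then show "vnorm H (vminus (X n u) (a u)) \<le> \<epsilon> * vnorm H u + vnorm H (vminus (X m u) (a u))"
            using vnorm_minus_triangle[of "X n u" "X m u" "a u"] N[OF n _ u, of m] XD a u by fastforce
        qed
      qed
    qed
  qed
  let ?a = "restrict a (vectors H)"
  have ab: "?a \<in> bounded_operators H"
  proof -
    obtain N where N: "\<And>u. u \<in> vectors H \<Longrightarrow> vnorm H (vminus (X N u) (a u)) \<le> 1 * vnorm H u"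
      using close[of 1] by auto
    show ?thesis
    proof (rule bounded_operatorI[of _ "opnorm (X N) + 1"])
      fix u w assume uw: "u \<in> vectors H" "w \<in> vectors H"
      have "a (vplus H u w) = vplus H (a u) (a w)"
      proof (rule inner_ext)
        fix t assume t: "t \<in> vectors H"
        have "(\<lambda>n. vinner H (X n (vplus H u w)) t) \<longlonglongrightarrow> vinner H (a u) t + vinner H (a w) t"
          using tendsto_add[OF lim[OF uw(1) t] lim[OF uw(2) t]] uw t by (simp add: XD inner_simps)
        then show "vinner H (a (vplus H u w)) t = vinner H (vplus H (a u) (a w)) t"
          using LIMSEQ_unique lim[OF plus_vec[OF uw] t] uw t by (simp add: inner_simps a) blast
      qed (simp_all add: uw a inner_simps)
      then show "?a (vplus H u w) = vplus H (?a u) (?a w)" using uw by (simp add: inner_simps)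
    next
      fix z u assume u: "u \<in> vectors H"
      have "a (vscale H z u) = vscale H z (a u)"
      proof (rule inner_ext)
        fix t assume t: "t \<in> vectors H"
        have "(\<lambda>n. vinner H (X n (vscale H z u)) t) \<longlonglongrightarrow> z * vinner H (a u) t"
          using tendsto_mult_left[OF lim[OF u t], of z] u t by (simp add: XD inner_simps)
        then show "vinner H (a (vscale H z u)) t = vinner H (vscale H z (a u)) t"
          using LIMSEQ_unique lim[OF scale_vec[OF u] t] u t by (simp add: inner_simps a) blast
      qed (simp_all add: u a inner_simps)
      then show "?a (vscale H z u) = vscale H z (?a u)" using u by (simp add: inner_simps)
    next
      fix u assume u: "u \<in> vectors H"
      show "vnorm H (?a u) \<le> (opnorm (X N) + 1) * vnorm H u"
        using vnorm_le_minus[of "a u" "X N u"] opnorm_bound[OF X u, of N] N[OF u] a XD u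
        by (simp add: distrib_right)
    qed (simp_all add: a)
  qed
  have "(\<lambda>n. opnorm (X n \<ominus>\<^bsub>BH H\<^esub> ?a)) \<longlonglongrightarrow> 0"
  proof (rule LIMSEQ_I)
    fix r :: real assume "0 < r"
    then have r: "0 < r / 2" by simp
    obtain N where N: "\<And>n u. \<lbrakk>N \<le> n; u \<in> vectors H\<rbrakk> \<Longrightarrow> vnorm H (vminus (X n u) (a u)) \<le> r / 2 * vnorm H u"
      using close[OF r] by blast
    have "opnorm (X n \<ominus>\<^bsub>BH H\<^esub> ?a) \<le> r / 2" if "N \<le> n" for n
      using N[OF that] r by (intro opnorm_le) (simp_all add: BH_minus[OF X ab])
    moreover have "0 \<le> opnorm (X n \<ominus>\<^bsub>BH H\<^esub> ?a)" for n
      unfolding BH_minus[OF X ab] by (intro opnorm_nonneg minus_bounded X ab)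
    ultimately have "norm (opnorm (X n \<ominus>\<^bsub>BH H\<^esub> ?a) - 0) < r" if "N \<le> n" for n
      using that \<open>0 < r\<close> by (smt (verit) field_sum_of_halves real_norm_def)
    then show "\<exists>N. \<forall>n\<ge>N. norm (opnorm (X n \<ominus>\<^bsub>BH H\<^esub> ?a) - 0) < r" by blast
  qed
  then show ?thesis using ab by (auto simp: limit_in_def)
qed

text \<open>
  \<open>\<parallel>T u\<parallel>\<^sup>2 = \<langle>T\<^sup>* T u, u\<rangle> \<le> \<parallel>T\<^sup>* T\<parallel> \<parallel>u\<parallel>\<^sup>2\<close>.  The reverse inequality in the C*-identity is
  submultiplicativity together with \<open>\<parallel>T\<^sup>*\<parallel> \<le> \<parallel>T\<parallel>\<close>, which itself follows from this lemma for \<open>T\<^sup>*\<close>.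
\<close>

lemma opnorm_adjoint_le:
  assumes T: "T \<in> bounded_operators H"
  shows "opnorm T ^ 2 \<le> opnorm (\<lambda>u\<in>vectors H. adjoint_op H T (T u))"
proof -
  note A = adjoint_op[OF T]
  let ?c = "opnorm (\<lambda>u\<in>vectors H. adjoint_op H T (T u))"
  have c: "0 \<le> ?c" by (intro opnorm_nonneg mult_bounded A T)
  have "vnorm H (T u) \<le> sqrt ?c * vnorm H u" if u: "u \<in> vectors H" for u
  proof -
    note TD = bounded_operatorD(2)[OF T] bounded_operatorD(2)[OF A(1)]
    have "(vnorm H (T u))\<^sup>2 = Re (vinner H (adjoint_op H T (T u)) u)"
      using u TD by (simp add: vnorm_squared A(3))
    also have "\<dots> \<le> vnorm H (adjoint_op H T (T u)) * vnorm H u"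
      using cauchy_schwarz[of "adjoint_op H T (T u)" u] complex_Re_le_cmod u TD order_trans by blast
    also have "\<dots> \<le> (?c * vnorm H u) * vnorm H u"
      using opnorm_bound[OF mult_bounded[OF A(1) T] u] u vnorm_nonneg[OF u]
      by (intro mult_right_mono) simp_all
    also have "\<dots> = (sqrt ?c * vnorm H u)\<^sup>2"
      using c by (simp add: power_mult_distrib) (simp add: power2_eq_square)
    finally show ?thesis by (rule power2_le_imp_le) (simp add: c vnorm_nonneg u)
  qed
  then have "opnorm T \<le> sqrt ?c" by (rule opnorm_le) (use c in simp_all)
  then have "opnorm T ^ 2 \<le> (sqrt ?c)\<^sup>2" using opnorm_nonneg[OF T] by (rule power_mono)
  then show ?thesis using c by simp
qed

lemma opnorm_le_adjoint:
  assumes T: "T \<in> bounded_operators H"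
  shows "opnorm T \<le> opnorm (adjoint_op H T)"
proof (cases "opnorm T = 0")
  case False
  then have "0 < opnorm T" using opnorm_nonneg[OF T] by simp
  moreover have "opnorm T ^ 2 \<le> opnorm (adjoint_op H T) * opnorm T"
    using opnorm_adjoint_le[OF T] opnorm_mult[OF adjoint_op(1)[OF T] T] by linarith
  ultimately show ?thesis by (simp add: power2_eq_square)
qed (simp add: opnorm_nonneg adjoint_op(1)[OF T])

lemma adjoint_adjoint: "T \<in> bounded_operators H \<Longrightarrow> adjoint_op H (adjoint_op H T) = T"
  by (rule adjoint_op_eqI) (simp_all add: adjoint_op(3))

theorem BH_cstar_algebra: "cstar_algebra (BH H)"
proof (intro cstar_algebra.intro cstar_algebra_axioms.intro, unfold BH_sel, goal_cases)
  case 1 show ?case by (rule BH_abelian_group)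
next
  case 2 then show ?case by (rule mult_bounded)
next
  case 3 then show ?case by (rule scale_bounded)
next
  case 4 then show ?case by (rule adjoint_op(1))
next
  case (5 a b z)
  then show ?case using bounded_operatorD[OF 5(1)] bounded_operatorD[OF 5(2)]
    by (intro operator_ext scale_bounded add_bounded) (auto intro!: inner_ext simp: inner_simps algebra_simps)
next
  case (6 a z w)
  then show ?case using bounded_operatorD[OF 6(1)]
    by (intro operator_ext scale_bounded add_bounded) (auto intro!: inner_ext simp: inner_simps algebra_simps)
next
  case (7 a z w)
  then show ?case using bounded_operatorD[OF 7(1)]
    by (intro operator_ext scale_bounded add_bounded) (auto intro!: inner_ext simp: inner_simps algebra_simps)
next
  case (8 a)
  then show ?case using bounded_operatorD[OF 8(1)]
    by (intro operator_ext scale_bounded add_bounded) (auto intro!: inner_ext simp: inner_simps algebra_simps)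
next
  case (9 a b c)
  then show ?case using bounded_operatorD(2)[OF 9(3)]
    by (intro operator_ext mult_bounded) auto
next
  case (10 a b c)
  then show ?case using bounded_operatorD[OF 10(1)] bounded_operatorD[OF 10(2)] bounded_operatorD[OF 10(3)]
    by (intro operator_ext mult_bounded add_bounded) (auto simp: inner_simps)
next
  case (11 a b c)
  then show ?case using bounded_operatorD[OF 11(1)] bounded_operatorD[OF 11(2)] bounded_operatorD[OF 11(3)]
    by (intro operator_ext mult_bounded add_bounded) (auto simp: inner_simps)
next
  case (12 a b z)
  then show ?case using bounded_operatorD[OF 12(1)] bounded_operatorD[OF 12(2)]
    by (intro operator_ext mult_bounded scale_bounded) (auto simp: inner_simps)
next
  case (13 a b z)
  then show ?case using bounded_operatorD[OF 13(1)] bounded_operatorD[OF 13(2)]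
    by (intro operator_ext mult_bounded scale_bounded) (auto simp: inner_simps)
next
  case (14 a) then show ?case by (rule adjoint_adjoint)
next
  case (15 a b)
  note A = adjoint_op[OF 15(1)] adjoint_op[OF 15(2)]
  note D = bounded_operatorD(2)[OF 15(1)] bounded_operatorD(2)[OF 15(2)]
    bounded_operatorD(2)[OF A(1)] bounded_operatorD(2)[OF A(4)]
  show ?case by (rule adjoint_op_eqI) (simp_all add: A add_bounded D inner_simps)
next
  case (16 a z)
  note A = adjoint_op[OF 16(1)]
  note D = bounded_operatorD(2)[OF 16(1)] bounded_operatorD(2)[OF A(1)]
  show ?case by (rule adjoint_op_eqI) (simp_all add: A scale_bounded D inner_simps)
next
  case (17 a b)
  note A = adjoint_op[OF 17(1)] adjoint_op[OF 17(2)]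
  note D = bounded_operatorD(2)[OF 17(1)] bounded_operatorD(2)[OF 17(2)]
    bounded_operatorD(2)[OF A(1)] bounded_operatorD(2)[OF A(4)]
  show ?case by (rule adjoint_op_eqI) (simp_all add: A mult_bounded D)
next
  case 18 then show ?case by (rule opnorm_nonneg)
next
  case (19 a)
  note D = bounded_operatorD(2)[OF 19]
  show ?case
  proof
    assume 0: "opnorm a = 0"
    show "a = (\<lambda>u\<in>vectors H. vzero H)"
    proof (rule operator_ext[OF 19 zero_bounded])
      fix u assume u: "u \<in> vectors H"
      then have "vnorm H (a u) = 0" using opnorm_bound[OF 19 u] vnorm_nonneg[OF D[OF u]] 0 by simp
      then show "a u = (\<lambda>u\<in>vectors H. vzero H) u" using vnorm_eq_0[OF D[OF u]] u by simp
    qed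
  next
    assume "a = (\<lambda>u\<in>vectors H. vzero H)"
    then have "opnorm a \<le> 0" by (intro opnorm_le) (simp_all add: vnorm_eq_0[OF zero_vec, THEN iffD2])
    then show "opnorm a = 0" using opnorm_nonneg[OF 19] by simp
  qed
next
  case (20 a b)
  then show ?case by (intro opnorm_le vnorm_add_le add_nonneg_nonneg opnorm_nonneg) auto
next
  case (21 a z)
  show ?case
  proof (rule antisym)
    show "opnorm (\<lambda>u\<in>vectors H. vscale H z (a u)) \<le> cmod z * opnorm a"
      using 21 by (intro opnorm_le vnorm_smult_le mult_nonneg_nonneg opnorm_nonneg) auto
    show "cmod z * opnorm a \<le> opnorm (\<lambda>u\<in>vectors H. vscale H z (a u))"
    proof (cases "z = 0")
      case True then show ?thesis using opnorm_nonneg[OF scale_bounded[OF 21]] by simp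
    next
      case False
      have "opnorm a \<le> opnorm (\<lambda>u\<in>vectors H. vscale H z (a u)) / cmod z"
      proof (rule opnorm_le)
        fix u assume u: "u \<in> vectors H"
        show "vnorm H (a u) \<le> opnorm (\<lambda>u\<in>vectors H. vscale H z (a u)) / cmod z * vnorm H u"
          using opnorm_bound[OF scale_bounded[OF 21] u, of z] u bounded_operatorD(2)[OF 21 u] False
          by (simp add: vnorm_scale field_simps)
      qed (simp add: opnorm_nonneg scale_bounded 21)
      then show ?thesis using False by (simp add: field_simps)
    qed
  qed
next
  case 22 then show ?case by (rule opnorm_mult)
next
  case (23 a)
  note A = adjoint_op(1)[OF 23]
  have "opnorm (adjoint_op H a) \<le> opnorm a"
    using opnorm_le_adjoint[OF A] by (simp add: adjoint_adjoint 23)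
  then have "opnorm (adjoint_op H a) * opnorm a \<le> opnorm a * opnorm a"
    using opnorm_nonneg[OF 23] by (rule mult_right_mono)
  then show ?case
    using opnorm_adjoint_le[OF 23] opnorm_mult[OF A 23] by (simp add: power2_eq_square)
next
  case (24 X) then show ?case by (rule BH_complete)
qed

end

section \<open>Conjugation by a unitary\<close>

text \<open>
  A unitary transports operators, hence *-homomorphisms into the bounded operators.
\<close>

locale unitary_pair = H: hilbert H + K: hilbert K
  for H :: "'v hilbert_data" and K :: "'w hilbert_data" +
  fixes U :: "'v \<Rightarrow> 'w"
  assumes unitary: "unitary H K U"
begin

definition V :: "'w \<Rightarrow> 'v" where
  "V = inv_into (vectors H) U"

lemma U_vec: "u \<in> vectors H \<Longrightarrow> U u \<in> vectors K"
  and U_plus: "\<lbrakk>u \<in> vectors H; u' \<in> vectors H\<rbrakk> \<Longrightarrow> U (vplus H u u') = vplus K (U u) (U u')"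
  and U_scale: "u \<in> vectors H \<Longrightarrow> U (vscale H z u) = vscale K z (U u)"
  and U_inner: "\<lbrakk>u \<in> vectors H; u' \<in> vectors H\<rbrakk> \<Longrightarrow> vinner K (U u) (U u') = vinner H u u'"
  and U_bij: "bij_betw U (vectors H) (vectors K)"
  using unitary unfolding unitary_def linear_on_def by auto

lemma V_vec: "w \<in> vectors K \<Longrightarrow> V w \<in> vectors H"
  and U_V: "w \<in> vectors K \<Longrightarrow> U (V w) = w"
  and V_U: "u \<in> vectors H \<Longrightarrow> V (U u) = u"
  using U_bij inv_into_into[of _ U "vectors H"] f_inv_into_f[of _ U "vectors H"]
  by (auto simp: V_def bij_betw_def)

lemma V_inner: "\<lbrakk>w \<in> vectors K; u \<in> vectors H\<rbrakk> \<Longrightarrow> vinner H (V w) u = vinner K w (U u)"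
  using U_inner[of "V w" u] by (simp add: V_vec U_V)

lemma V_inner_right: "\<lbrakk>w \<in> vectors K; u \<in> vectors H\<rbrakk> \<Longrightarrow> vinner H u (V w) = vinner K (U u) w"
  using U_inner[of u "V w"] by (simp add: V_vec U_V)

lemma V_plus: "\<lbrakk>w \<in> vectors K; w' \<in> vectors K\<rbrakk> \<Longrightarrow> V (vplus K w w') = vplus H (V w) (V w')"
  using V_U[of "vplus H (V w) (V w')"] by (simp add: U_plus V_vec U_V H.plus_vec)

lemma V_scale: "w \<in> vectors K \<Longrightarrow> V (vscale K z w) = vscale H z (V w)"
  using V_U[of "vscale H z (V w)"] by (simp add: U_scale V_vec U_V H.scale_vec)

lemma unitary_V: "unitary K H V"
  unfolding unitary_def linear_on_def V_def[symmetric]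
proof (intro conjI ballI allI)
  show "bij_betw V (vectors K) (vectors H)" unfolding V_def by (rule bij_betw_inv_into[OF U_bij])
qed (auto simp: V_vec V_plus V_scale V_inner U_V)

lemma vnorm_U: "u \<in> vectors H \<Longrightarrow> vnorm K (U u) = vnorm H u"
  by (simp add: vnorm_def U_inner)

lemma vnorm_V: "w \<in> vectors K \<Longrightarrow> vnorm H (V w) = vnorm K w"
  by (simp add: vnorm_def V_inner V_vec U_V)

definition conj_op :: "('v \<Rightarrow> 'v) \<Rightarrow> 'w \<Rightarrow> 'w" where
  "conj_op T = (\<lambda>w\<in>vectors K. U (T (V w)))"

lemma conj_op_bounded:
  assumes T: "T \<in> bounded_operators H"
  shows "conj_op T \<in> bounded_operators K"
proof -
  note D = H.bounded_operatorD(2-4)[OF T]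
  obtain C where C: "\<And>u. u \<in> vectors H \<Longrightarrow> vnorm H (T u) \<le> C * vnorm H u"
    using H.bounded_operator_bound[OF T] by blast
  show ?thesis
  proof (rule K.bounded_operatorI[of _ C])
    show "conj_op T \<in> extensional (vectors K)" by (simp add: conj_op_def)
    fix w assume w: "w \<in> vectors K"
    show "vnorm K (conj_op T w) \<le> C * vnorm K w"
      using C[OF V_vec[OF w]] w by (simp add: conj_op_def vnorm_U vnorm_V V_vec D)
  qed (simp_all add: conj_op_def U_vec V_vec D V_plus V_scale U_plus U_scale K.plus_vec K.scale_vec)
qed

lemma conj_op_apply: "w \<in> vectors K \<Longrightarrow> conj_op T w = U (T (V w))"
  by (simp add: conj_op_def)

lemma conj_op_add:
  assumes "S \<in> bounded_operators H" "T \<in> bounded_operators H"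
  shows "conj_op (S \<oplus>\<^bsub>BH H\<^esub> T) = conj_op S \<oplus>\<^bsub>BH K\<^esub> conj_op T"
  using assms[THEN H.bounded_operatorD(2)]
  by (auto simp: conj_op_def V_vec U_plus intro!: restrict_ext)

lemma conj_op_mult:
  assumes "T \<in> bounded_operators H"
  shows "conj_op (S \<otimes>\<^bsub>BH H\<^esub> T) = conj_op S \<otimes>\<^bsub>BH K\<^esub> conj_op T"
  using assms[THEN H.bounded_operatorD(2)]
  by (auto simp: conj_op_def V_vec U_vec V_U intro!: restrict_ext)

lemma conj_op_smult:
  assumes "T \<in> bounded_operators H"
  shows "conj_op (z \<odot>\<^bsub>BH H\<^esub> T) = z \<odot>\<^bsub>BH K\<^esub> conj_op T"
  using assms[THEN H.bounded_operatorD(2)]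
  by (auto simp: conj_op_def V_vec U_scale intro!: restrict_ext)

text \<open>
  \<open>U T\<^sup>* U\<^sup>*\<close> satisfies the defining property of the adjoint of \<open>U T U\<^sup>*\<close>.
\<close>

lemma conj_op_star:
  assumes T: "T \<in> bounded_operators H"
  shows "conj_op (star (BH H) T) = star (BH K) (conj_op T)"
proof -
  note A = H.adjoint_op[OF T]
  have "adjoint_op K (conj_op T) = conj_op (adjoint_op H T)"
  proof (rule K.adjoint_op_eqI)
    show "conj_op (adjoint_op H T) \<in> bounded_operators K" by (rule conj_op_bounded[OF A(1)])
    fix u w assume "u \<in> vectors K" "w \<in> vectors K"
    then show "vinner K (conj_op T u) w = vinner K u (conj_op (adjoint_op H T) w)"
      using H.bounded_operatorD(2)[OF T] H.bounded_operatorD(2)[OF A(1)]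
      by (simp add: conj_op_apply V_vec A(2) V_inner flip: V_inner_right)
  qed
  then show ?thesis by simp
qed

lemma star_hom_conj:
  assumes A: "cstar_algebra A" and hom: "\<pi> \<in> star_hom A (BH H)"
  shows "(\<lambda>a\<in>carrier A. conj_op (\<pi> a)) \<in> star_hom A (BH K)"
proof -
  interpret A: cstar_algebra A by (rule A)
  have c: "\<pi> \<in> carrier A \<rightarrow>\<^sub>E carrier (BH H)"
    and add: "\<And>a b. \<lbrakk>a \<in> carrier A; b \<in> carrier A\<rbrakk> \<Longrightarrow> \<pi> (a \<oplus>\<^bsub>A\<^esub> b) = \<pi> a \<oplus>\<^bsub>BH H\<^esub> \<pi> b"
    and mult: "\<And>a b. \<lbrakk>a \<in> carrier A; b \<in> carrier A\<rbrakk> \<Longrightarrow> \<pi> (a \<otimes>\<^bsub>A\<^esub> b) = \<pi> a \<otimes>\<^bsub>BH H\<^esub> \<pi> b"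
    and smult: "\<And>z a. a \<in> carrier A \<Longrightarrow> \<pi> (z \<odot>\<^bsub>A\<^esub> a) = z \<odot>\<^bsub>BH H\<^esub> \<pi> a"
    and star: "\<And>a. a \<in> carrier A \<Longrightarrow> \<pi> (star A a) = star (BH H) (\<pi> a)"
    using hom unfolding star_hom_def by blast+
  have b: "\<pi> a \<in> bounded_operators H" if "a \<in> carrier A" for a
    using PiE_mem[OF c that] by (simp add: BH_def)
  show ?thesis
    unfolding star_hom_def
  proof (intro CollectI conjI ballI allI)
    show "(\<lambda>a\<in>carrier A. conj_op (\<pi> a)) \<in> carrier A \<rightarrow>\<^sub>E carrier (BH K)"
      using b conj_op_bounded by (auto simp: BH_def)
  next
    fix a a' assume a: "a \<in> carrier A" "a' \<in> carrier A"
    show "(\<lambda>a\<in>carrier A. conj_op (\<pi> a)) (a \<oplus>\<^bsub>A\<^esub> a') =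
        (\<lambda>a\<in>carrier A. conj_op (\<pi> a)) a \<oplus>\<^bsub>BH K\<^esub> (\<lambda>a\<in>carrier A. conj_op (\<pi> a)) a'"
      unfolding restrict_apply'[OF a(1)] restrict_apply'[OF a(2)] restrict_apply'[OF A.a_closed[OF a]] add[OF a]
      by (rule conj_op_add[OF b[OF a(1)] b[OF a(2)]])
    show "(\<lambda>a\<in>carrier A. conj_op (\<pi> a)) (a \<otimes>\<^bsub>A\<^esub> a') =
        (\<lambda>a\<in>carrier A. conj_op (\<pi> a)) a \<otimes>\<^bsub>BH K\<^esub> (\<lambda>a\<in>carrier A. conj_op (\<pi> a)) a'"
      unfolding restrict_apply'[OF a(1)] restrict_apply'[OF a(2)] restrict_apply'[OF A.mult_closed[OF a]] mult[OF a]
      by (rule conj_op_mult[OF b[OF a(2)]])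
  next
    fix a z assume a: "a \<in> carrier A"
    show "(\<lambda>a\<in>carrier A. conj_op (\<pi> a)) (z \<odot>\<^bsub>A\<^esub> a) = z \<odot>\<^bsub>BH K\<^esub> (\<lambda>a\<in>carrier A. conj_op (\<pi> a)) a"
      unfolding restrict_apply'[OF a] restrict_apply'[OF A.smult_closed[OF a]] smult[OF a]
      by (rule conj_op_smult[OF b[OF a]])
  next
    fix a assume a: "a \<in> carrier A"
    show "(\<lambda>a\<in>carrier A. conj_op (\<pi> a)) (star A a) = star (BH K) ((\<lambda>a\<in>carrier A. conj_op (\<pi> a)) a)"
      unfolding restrict_apply'[OF a] restrict_apply'[OF A.star_closed[OF a]] star[OF a]
      by (rule conj_op_star[OF b[OF a]])
  qed
qed

end

section \<open>The Hilbert space \<open>L\<^sup>2\<close>\<close>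

lemma L2_functionsD:
  "f \<in> L2_functions M \<Longrightarrow> f \<in> borel_measurable M"
  "f \<in> L2_functions M \<Longrightarrow> integrable M (\<lambda>x. (cmod (f x))\<^sup>2)"
  by (simp_all add: L2_functions_def)

lemma L2_functions_bounded:
  assumes "f \<in> borel_measurable M" "integrable M g" "\<And>x. (cmod (f x))\<^sup>2 \<le> g x"
  shows "f \<in> L2_functions M"
  unfolding L2_functions_def
proof (intro CollectI conjI assms(1) Bochner_Integration.integrable_bound[OF assms(2)])
  show "(\<lambda>x. (cmod (f x))\<^sup>2) \<in> borel_measurable M" using assms(1) by measurable
  show "AE x in M. norm ((cmod (f x))\<^sup>2) \<le> norm (g x)"
    using assms(3) by (auto intro!: AE_I2 order_trans[OF _ abs_ge_self])
qed

lemma L2_functions_plus: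
  assumes f: "f \<in> L2_functions M" and g: "g \<in> L2_functions M"
  shows "(\<lambda>x. f x + g x) \<in> L2_functions M"
proof (rule L2_functions_bounded)
  show "(\<lambda>x. f x + g x) \<in> borel_measurable M"
    using L2_functionsD(1)[OF f] L2_functionsD(1)[OF g] by measurable
  show "integrable M (\<lambda>x. 2 * (cmod (f x))\<^sup>2 + 2 * (cmod (g x))\<^sup>2)"
    using L2_functionsD(2)[OF f] L2_functionsD(2)[OF g] by simp
  fix x
  have "(cmod (f x + g x))\<^sup>2 \<le> (cmod (f x) + cmod (g x))\<^sup>2"
    by (intro power_mono norm_triangle_ineq) simp
  also have "\<dots> \<le> 2 * (cmod (f x))\<^sup>2 + 2 * (cmod (g x))\<^sup>2"
    using zero_le_power2[of "cmod (f x) - cmod (g x)"] by (simp add: power2_sum power2_diff)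
  finally show "(cmod (f x + g x))\<^sup>2 \<le> 2 * (cmod (f x))\<^sup>2 + 2 * (cmod (g x))\<^sup>2" .
qed

lemma L2_functions_scale:
  assumes f: "f \<in> L2_functions M"
  shows "(\<lambda>x. z * f x) \<in> L2_functions M"
proof (rule L2_functions_bounded[of _ _ "\<lambda>x. (cmod z)\<^sup>2 * (cmod (f x))\<^sup>2"])
  show "(\<lambda>x. z * f x) \<in> borel_measurable M" using L2_functionsD(1)[OF f] by measurable
qed (use L2_functionsD(2)[OF f] in \<open>simp_all add: norm_mult power_mult_distrib\<close>)

lemma L2_functions_zero: "(\<lambda>x. 0) \<in> L2_functions M"
  by (simp add: L2_functions_def)

lemma L2_functions_diff:
  assumes "f \<in> L2_functions M" "g \<in> L2_functions M"
  shows "(\<lambda>x. f x - g x) \<in> L2_functions M"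
  using L2_functions_plus[OF assms(1) L2_functions_scale[OF assms(2), of "-1"]] by simp

lemma L2_integrable_product:
  assumes f: "f \<in> L2_functions M" and g: "g \<in> L2_functions M"
  shows "integrable M (\<lambda>x. f x * cnj (g x))"
proof (rule Bochner_Integration.integrable_bound)
  show "integrable M (\<lambda>x. (cmod (f x))\<^sup>2 + (cmod (g x))\<^sup>2)"
    using L2_functionsD(2)[OF f] L2_functionsD(2)[OF g] by simp
  have m: "f \<in> borel_measurable M" "g \<in> borel_measurable M" using f g by (simp_all add: L2_functionsD)
  have "(\<lambda>x. cnj (g x)) \<in> borel_measurable M"
    by (rule borel_measurable_continuous_on[OF _ m(2)]) (intro continuous_intros)
  then show "(\<lambda>x. f x * cnj (g x)) \<in> borel_measurable M" using m by measurable
  show "AE x in M. norm (f x * cnj (g x)) \<le> norm ((cmod (f x))\<^sup>2 + (cmod (g x))\<^sup>2)"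
  proof (rule AE_I2)
    fix x
    have "2 * (cmod (f x) * cmod (g x)) \<le> (cmod (f x))\<^sup>2 + (cmod (g x))\<^sup>2"
      using zero_le_power2[of "cmod (f x) - cmod (g x)"] by (simp add: power2_diff)
    moreover have "0 \<le> cmod (f x) * cmod (g x)" by simp
    ultimately have "cmod (f x) * cmod (g x) \<le> (cmod (f x))\<^sup>2 + (cmod (g x))\<^sup>2" by linarith
    then show "norm (f x * cnj (g x)) \<le> norm ((cmod (f x))\<^sup>2 + (cmod (g x))\<^sup>2)" by (simp add: norm_mult)
  qed
qed

lemma L2_rel_equiv: "equiv (L2_functions M) (L2_rel M)"
proof (rule equivI)
  show "L2_rel M \<subseteq> L2_functions M \<times> L2_functions M" by (auto simp: L2_rel_def)
  show "refl_on (L2_functions M) (L2_rel M)" by (auto simp: refl_on_def L2_rel_def)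
  show "sym (L2_rel M)" by (auto simp: sym_def L2_rel_def elim: eventually_mono)
  show "trans (L2_rel M)"
  proof (rule transI)
    fix f g h assume "(f, g) \<in> L2_rel M" "(g, h) \<in> L2_rel M"
    then have "f \<in> L2_functions M" "h \<in> L2_functions M" "AE x in M. f x = g x" "AE x in M. g x = h x"
      by (auto simp: L2_rel_def)
    moreover from this(3,4) have "AE x in M. f x = h x" by eventually_elim simp
    ultimately show "(f, h) \<in> L2_rel M" by (simp add: L2_rel_def)
  qed
qed

lemma L2_vectors: "vectors (L2 M) = L2_functions M // L2_rel M"
  by (simp add: L2_def)

lemma L2_class_vec: "f \<in> L2_functions M \<Longrightarrow> L2_class M f \<in> vectors (L2 M)"
  by (simp add: L2_vectors L2_class_def quotientI)

lemma L2_class_eq_iff: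
  "\<lbrakk>f \<in> L2_functions M; g \<in> L2_functions M\<rbrakk>
    \<Longrightarrow> L2_class M f = L2_class M g \<longleftrightarrow> (AE x in M. f x = g x)"
  using eq_equiv_class_iff[OF L2_rel_equiv, of f M g] by (simp add: L2_class_def) (simp add: L2_rel_def)

lemma L2_rep:
  assumes "\<xi> \<in> vectors (L2 M)"
  shows "L2_rep \<xi> \<in> L2_functions M" "L2_class M (L2_rep \<xi>) = \<xi>"
proof -
  obtain f where f: "f \<in> L2_functions M" "\<xi> = L2_rel M `` {f}"
    using assms unfolding L2_vectors by (rule quotientE)
  have "f \<in> \<xi>" using f equiv_class_self[OF L2_rel_equiv] by simp
  then have r: "L2_rep \<xi> \<in> \<xi>" unfolding L2_rep_def by (rule someI[of "\<lambda>f. f \<in> \<xi>"])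
  then show "L2_rep \<xi> \<in> L2_functions M" using f by (auto simp: L2_rel_def)
  have "(f, L2_rep \<xi>) \<in> L2_rel M" using r f by simp
  then show "L2_class M (L2_rep \<xi>) = \<xi>"
    using equiv_class_eq[OF L2_rel_equiv] f by (auto simp: L2_class_def)
qed

lemma L2_vec_cases:
  assumes "\<xi> \<in> vectors (L2 M)"
  obtains f where "f \<in> L2_functions M" "\<xi> = L2_class M f"
  using L2_rep[OF assms] by metis

lemma L2_rep_class:
  assumes "f \<in> L2_functions M"
  shows "AE x in M. L2_rep (L2_class M f) x = f x"
  using L2_class_eq_iff[of "L2_rep (L2_class M f)" M f] L2_rep[OF L2_class_vec[OF assms]] assms by simp

lemma L2_class_eqI:
  assumes "f \<in> L2_functions M" "g \<in> borel_measurable M" "AE x in M. g x = f x"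
  shows "L2_class M g = L2_class M f"
proof -
  have "integrable M (\<lambda>x. (cmod (g x))\<^sup>2)"
  proof (rule integrable_cong_AE_imp[OF L2_functionsD(2)[OF assms(1)]])
    show "(\<lambda>x. (cmod (g x))\<^sup>2) \<in> borel_measurable M" using assms(2) by measurable
    show "AE x in M. (cmod (f x))\<^sup>2 = (cmod (g x))\<^sup>2" using assms(3) by eventually_elim simp
  qed
  then have "g \<in> L2_functions M" using assms(2) by (simp add: L2_functions_def)
  then show ?thesis using L2_class_eq_iff assms by blast
qed

lemma L2_zero: "vzero (L2 M) = L2_class M (\<lambda>x. 0)"
  by (simp add: L2_def)

lemma L2_plus:
  assumes f: "f \<in> L2_functions M" and g: "g \<in> L2_functions M"
  shows "vplus (L2 M) (L2_class M f) (L2_class M g) = L2_class M (\<lambda>x. f x + g x)"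
proof -
  have "AE x in M. L2_rep (L2_class M f) x + L2_rep (L2_class M g) x = f x + g x"
    using L2_rep_class[OF f] L2_rep_class[OF g] by eventually_elim simp
  moreover have "(\<lambda>x. L2_rep (L2_class M f) x + L2_rep (L2_class M g) x) \<in> borel_measurable M"
    using L2_functionsD(1)[OF L2_functions_plus[OF L2_rep(1)[OF L2_class_vec[OF f]] L2_rep(1)[OF L2_class_vec[OF g]]]] .
  ultimately show ?thesis using L2_class_eqI[OF L2_functions_plus[OF f g]] by (simp add: L2_def)
qed

lemma L2_scale:
  assumes f: "f \<in> L2_functions M"
  shows "vscale (L2 M) z (L2_class M f) = L2_class M (\<lambda>x. z * f x)"
proof -
  have "AE x in M. z * L2_rep (L2_class M f) x = z * f x"
    using L2_rep_class[OF f] by eventually_elim simp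
  moreover have "(\<lambda>x. z * L2_rep (L2_class M f) x) \<in> borel_measurable M"
    using L2_functionsD(1)[OF L2_functions_scale[OF L2_rep(1)[OF L2_class_vec[OF f]]]] .
  ultimately show ?thesis using L2_class_eqI[OF L2_functions_scale[OF f]] by (simp add: L2_def)
qed

lemma L2_inner:
  assumes f: "f \<in> L2_functions M" and g: "g \<in> L2_functions M"
  shows "vinner (L2 M) (L2_class M f) (L2_class M g) = (\<integral>x. f x * cnj (g x) \<partial>M)"
proof -
  have "(\<integral>x. L2_rep (L2_class M f) x * cnj (L2_rep (L2_class M g) x) \<partial>M) = (\<integral>x. f x * cnj (g x) \<partial>M)"
  proof (rule integral_cong_AE)
    show "AE x in M. L2_rep (L2_class M f) x * cnj (L2_rep (L2_class M g) x) = f x * cnj (g x)"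
      using L2_rep_class[OF f] L2_rep_class[OF g] by eventually_elim simp
  qed (use L2_integrable_product[OF f g] L2_integrable_product[OF L2_rep(1)[OF L2_class_vec[OF f]] L2_rep(1)[OF L2_class_vec[OF g]]]
      in \<open>auto dest: borel_measurable_integrable\<close>)
  then show ?thesis by (simp add: L2_def)
qed

lemma L2_inner_self:
  assumes f: "f \<in> L2_functions M"
  shows "vinner (L2 M) (L2_class M f) (L2_class M f) = complex_of_real (\<integral>x. (cmod (f x))\<^sup>2 \<partial>M)"
  unfolding L2_inner[OF f f] by (simp add: complex_norm_square[symmetric] flip: of_real_power)

lemma L2_vminus:
  assumes "f \<in> L2_functions M" "g \<in> L2_functions M"
  shows "vplus (L2 M) (L2_class M f) (vscale (L2 M) (-1) (L2_class M g)) = L2_class M (\<lambda>x. f x - g x)"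
  using L2_plus[OF assms(1) L2_functions_scale[OF assms(2), of "-1"]] by (simp add: L2_scale assms)

lemma L2_vnorm:
  assumes "f \<in> L2_functions M"
  shows "vnorm (L2 M) (L2_class M f) = sqrt (\<integral>x. (cmod (f x))\<^sup>2 \<partial>M)"
  by (simp add: vnorm_def L2_inner_self[OF assms])

lemma L2_nn_integral:
  assumes "f \<in> L2_functions M"
  shows "(\<integral>\<^sup>+x. ennreal ((cmod (f x))\<^sup>2) \<partial>M) = ennreal (\<integral>x. (cmod (f x))\<^sup>2 \<partial>M)"
  by (rule nn_integral_eq_integral[OF L2_functionsD(2)[OF assms]]) simp

text \<open>
  The increments are at most \<open>\<surd>s (\<surd>(1/2))\<^sup>k\<close>, which is summable.
\<close>

lemma convergent_if_weighted_square_sum_bounded: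
  fixes g :: "nat \<Rightarrow> complex"
  assumes "\<And>k. 2 ^ k * (cmod (g (Suc k) - g k))\<^sup>2 \<le> s"
  shows "convergent g"
proof -
  have s: "0 \<le> s" using order_trans[OF zero_le_power2 assms[of 0, simplified]] .
  have b: "norm (g (Suc k) - g k) \<le> sqrt s * sqrt (1 / 2) ^ k" for k
  proof -
    let ?D = "(cmod (g (Suc k) - g k))\<^sup>2"
    have "(sqrt (1 / 2) ^ k)\<^sup>2 = ((sqrt (1 / 2))\<^sup>2) ^ k"
      unfolding power_mult[symmetric] by (simp only: mult.commute)
    also have "\<dots> = (1 / 2 :: real) ^ k" by (subst real_sqrt_pow2) simp_all
    finally have "(sqrt s * sqrt (1 / 2) ^ k)\<^sup>2 = s * (1 / 2) ^ k"
      using s by (simp only: power_mult_distrib real_sqrt_pow2)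
    moreover have "?D = (2 ^ k * ?D) * (1 / 2) ^ k"
      by (simp add: power_one_over)
    moreover have "(2 ^ k * ?D) * (1 / 2) ^ k \<le> s * (1 / 2) ^ k"
      by (rule mult_right_mono[OF assms]) simp
    ultimately have "?D \<le> (sqrt s * sqrt (1 / 2) ^ k)\<^sup>2" by linarith
    moreover have "0 \<le> sqrt s * sqrt (1 / 2) ^ k" using s by simp
    ultimately show ?thesis by (rule power2_le_imp_le)
  qed
  have "summable (\<lambda>k. sqrt s * sqrt (1 / 2) ^ k)"
    by (intro summable_mult summable_geometric) (simp add: real_sqrt_lt_1_iff)
  then have "summable (\<lambda>k. g (Suc k) - g k)" using b by (rule summable_comparison_test'[where N = 0])
  then have "convergent (\<lambda>n. \<Sum>k<n. g (Suc k) - g k)" by (simp add: summable_iff_convergent)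
  then have "convergent (\<lambda>n. g n - g 0)" by (simp add: sum_lessThan_telescope)
  then show ?thesis using convergent_add[OF _ convergent_const[of "g 0"], of "\<lambda>n. g n - g 0"] by simp
qed

text \<open>
  Pass to a subsequence with squared increments of integral at most \<open>4\<^sup>-\<^sup>k\<close>.  The sum of the squared
  increments, weighted by \<open>2\<^sup>k\<close>, is then integrable, hence finite almost everywhere, and this forces
  pointwise convergence.  Fatou's lemma bounds the distance to the pointwise limit.
\<close>

lemma riesz_fischer:
  assumes f: "\<And>n. f n \<in> L2_functions M"
    and cauchy: "\<And>\<epsilon>. 0 < \<epsilon> \<Longrightarrow> \<exists>N. \<forall>m\<ge>N. \<forall>n\<ge>N. (\<integral>x. (cmod (f m x - f n x))\<^sup>2 \<partial>M) < \<epsilon>"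
  obtains g where "g \<in> L2_functions M" "(\<lambda>n. \<integral>x. (cmod (f n x - g x))\<^sup>2 \<partial>M) \<longlonglongrightarrow> 0"
proof -
  have [measurable]: "f n \<in> borel_measurable M" for n by (rule L2_functionsD(1)[OF f])
  have diff: "(\<lambda>x. f m x - f n x) \<in> L2_functions M" for m n by (rule L2_functions_diff[OF f f])
  have "\<exists>N. \<forall>m\<ge>N. \<forall>n\<ge>N. (\<integral>x. (cmod (f m x - f n x))\<^sup>2 \<partial>M) < (1 / 4) ^ k" for k :: nat
    by (rule cauchy) simp
  then obtain r where r: "\<And>k m n. \<lbrakk>r k \<le> m; r k \<le> n\<rbrakk> \<Longrightarrow> (\<integral>x. (cmod (f m x - f n x))\<^sup>2 \<partial>M) < (1 / 4) ^ k"
    by metis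
  \<comment> \<open>Summing makes the indices increasing, so that \<open>R k\<close> is beyond every earlier threshold.\<close>
  define R where "R k = (\<Sum>i\<le>k. r i)" for k :: nat
  have R: "r j \<le> R k" if "j \<le> k" for j k
    unfolding R_def using that by (intro member_le_sum) auto
  define h where "h k = f (R k)" for k
  have [measurable]: "h k \<in> borel_measurable M" for k unfolding h_def by (rule L2_functionsD(1)[OF f])
  \<comment> \<open>The weights \<open>2\<^sup>k\<close> against \<open>4\<^sup>-\<^sup>k\<close> leave a convergent sum, and still give summable increments.\<close>
  define S where "S x = (\<Sum>k. ennreal (2 ^ k * (cmod (h (Suc k) x - h k x))\<^sup>2))" for x
  have "(\<integral>\<^sup>+x. S x \<partial>M) = (\<Sum>k. \<integral>\<^sup>+x. ennreal (2 ^ k * (cmod (h (Suc k) x - h k x))\<^sup>2) \<partial>M)"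
    unfolding S_def by (rule nn_integral_suminf) measurable
  also have "\<dots> \<le> (\<Sum>k. ennreal ((1 / 2) ^ k))"
  proof (rule suminf_le)
    fix k :: nat
    have "(\<integral>\<^sup>+x. ennreal (2 ^ k * (cmod (h (Suc k) x - h k x))\<^sup>2) \<partial>M)
        = ennreal (2 ^ k) * (\<integral>\<^sup>+x. ennreal ((cmod (h (Suc k) x - h k x))\<^sup>2) \<partial>M)"
      by (subst nn_integral_cmult[symmetric]) (simp_all add: ennreal_mult)
    also have "(\<integral>\<^sup>+x. ennreal ((cmod (h (Suc k) x - h k x))\<^sup>2) \<partial>M) \<le> ennreal ((1 / 4) ^ k)"
      unfolding h_def L2_nn_integral[OF diff]
      using r[of k "R (Suc k)" "R k"] R[of k "Suc k"] R[of k k] by (intro ennreal_leI) simp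
    also have "ennreal (2 ^ k) * ennreal ((1 / 4) ^ k) = ennreal ((1 / 2) ^ k)"
      by (simp add: ennreal_mult[symmetric] power_mult_distrib[symmetric])
    finally show "(\<integral>\<^sup>+x. ennreal (2 ^ k * (cmod (h (Suc k) x - h k x))\<^sup>2) \<partial>M) \<le> ennreal ((1 / 2) ^ k)"
      by (simp add: mult_left_mono)
  qed simp_all
  also have "\<dots> = ennreal (\<Sum>k. (1 / 2) ^ k)" by (rule suminf_ennreal2) (simp_all add: summable_geometric)
  also have "\<dots> < \<infinity>" by simp
  finally have "(\<integral>\<^sup>+x. S x \<partial>M) \<noteq> \<infinity>" by simp
  moreover have "S \<in> borel_measurable M" unfolding S_def by measurable
  ultimately have fin: "AE x in M. S x \<noteq> \<infinity>" by (intro nn_integral_noteq_infinite)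
  define g where "g x = lim (\<lambda>k. h k x)" for x
  have gm [measurable]: "g \<in> borel_measurable M" 
    unfolding g_def by (rule borel_measurable_lim_metric) fact
  have conv: "AE x in M. (\<lambda>k. h k x) \<longlonglongrightarrow> g x"
    using fin
  proof eventually_elim
    case (elim x)
    have "convergent (\<lambda>k. h k x)"
    proof (rule convergent_if_weighted_square_sum_bounded)
      fix k
      define t where "t k = 2 ^ k * (cmod (h (Suc k) x - h k x))\<^sup>2" for k
      have "(\<Sum>k\<in>{k}. ennreal (t k)) \<le> (\<Sum>k. ennreal (t k))"
        by (rule sum_le_suminf) simp_all
      then have "ennreal (t k) \<le> S x" by (simp add: S_def t_def)
      also have "S x = ennreal (enn2real (S x))" using elim by (simp add: less_top)
      finally have "t k \<le> enn2real (S x)" by (simp add: ennreal_le_iff)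
      then show "2 ^ k * (cmod (h (Suc k) x - h k x))\<^sup>2 \<le> enn2real (S x)" by (simp only: t_def)
    qed
    then show ?case unfolding g_def by (simp add: convergent_LIMSEQ_iff)
  qed
  have fatou: "(\<integral>\<^sup>+x. ennreal ((cmod (f m x - g x))\<^sup>2) \<partial>M) \<le> ennreal ((1 / 4) ^ j)" if m: "r j \<le> m" for m j
  proof -
    have "(\<integral>\<^sup>+x. ennreal ((cmod (f m x - g x))\<^sup>2) \<partial>M)
        = (\<integral>\<^sup>+x. liminf (\<lambda>k. ennreal ((cmod (f m x - h k x))\<^sup>2)) \<partial>M)"
    proof (rule nn_integral_cong_AE)
      show "AE x in M. ennreal ((cmod (f m x - g x))\<^sup>2) = liminf (\<lambda>k. ennreal ((cmod (f m x - h k x))\<^sup>2))"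
        using conv
      proof eventually_elim
        case (elim x)
        have "(\<lambda>k. ennreal ((cmod (f m x - h k x))\<^sup>2)) \<longlonglongrightarrow> ennreal ((cmod (f m x - g x))\<^sup>2)"
          by (intro tendsto_ennrealI tendsto_intros elim)
        then show ?case by (intro lim_imp_Liminf[symmetric]) simp_all
      qed
    qed
    also have "\<dots> \<le> liminf (\<lambda>k. \<integral>\<^sup>+x. ennreal ((cmod (f m x - h k x))\<^sup>2) \<partial>M)"
      by (rule nn_integral_liminf) measurable
    also have "\<dots> \<le> limsup (\<lambda>k. \<integral>\<^sup>+x. ennreal ((cmod (f m x - h k x))\<^sup>2) \<partial>M)"
      by (rule Liminf_le_Limsup) simp
    also have "\<dots> \<le> ennreal ((1 / 4) ^ j)"
    proof (rule Limsup_bounded)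
      show "\<forall>\<^sub>F k in sequentially. (\<integral>\<^sup>+x. ennreal ((cmod (f m x - h k x))\<^sup>2) \<partial>M) \<le> ennreal ((1 / 4) ^ j)"
        using eventually_ge_at_top[of j]
      proof eventually_elim
        case (elim k)
        then show ?case unfolding h_def L2_nn_integral[OF diff]
          using r[of j m "R k"] R[of j k] m by (intro ennreal_leI) simp
      qed
    qed
    finally show ?thesis .
  qed
  have diffg: "(\<lambda>x. f m x - g x) \<in> L2_functions M" if "r 0 \<le> m" for m
  proof -
    have "(\<integral>\<^sup>+x. ennreal ((cmod (f m x - g x))\<^sup>2) \<partial>M) < \<infinity>"
      using fatou[OF that] by (simp add: le_less_trans)
    then show ?thesis unfolding L2_functions_def by (auto intro!: integrableI_nonneg)
  qed
  have gL: "g \<in> L2_functions M"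
    using L2_functions_diff[OF f diffg[OF order_refl], of "r 0"] by simp
  have dg: "(\<lambda>x. f m x - g x) \<in> L2_functions M" for m by (rule L2_functions_diff[OF f gL])
  have "(\<lambda>n. \<integral>x. (cmod (f n x - g x))\<^sup>2 \<partial>M) \<longlonglongrightarrow> 0"
  proof (rule LIMSEQ_I)
    fix e :: real assume "0 < e"
    then obtain j where j: "(1 / 4) ^ j < e" using real_arch_pow_inv[of e "1 / 4"] by auto
    have "norm ((\<integral>x. (cmod (f n x - g x))\<^sup>2 \<partial>M) - 0) < e" if "r j \<le> n" for n
    proof -
      have "ennreal (\<integral>x. (cmod (f n x - g x))\<^sup>2 \<partial>M) \<le> ennreal ((1 / 4) ^ j)"
        using fatou[OF that] by (simp add: L2_nn_integral[OF dg])
      then have "(\<integral>x. (cmod (f n x - g x))\<^sup>2 \<partial>M) \<le> (1 / 4) ^ j" by (simp add: ennreal_le_iff)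
      then show ?thesis using j by simp
    qed
    then show "\<exists>N. \<forall>n\<ge>N. norm ((\<integral>x. (cmod (f n x - g x))\<^sup>2 \<partial>M) - 0) < e" by blast
  qed
  with gL show ?thesis by (rule that)
qed

text \<open>
  All operations can be computed on arbitrary square integrable representatives, so the axioms
  become statements about integrals; \<open>inner_ext\<close> is tested on the difference of two functions.
\<close>

theorem L2_hilbert: "hilbert (L2 M)"
proof
  fix \<xi> \<eta> :: "('a \<Rightarrow> complex) set" and z
  show "vzero (L2 M) \<in> vectors (L2 M)" by (simp add: L2_zero L2_class_vec L2_functions_zero)
  assume x: "\<xi> \<in> vectors (L2 M)"
  then obtain f where f: "f \<in> L2_functions M" "\<xi> = L2_class M f" by (rule L2_vec_cases)
  show "vscale (L2 M) z \<xi> \<in> vectors (L2 M)" using f by (simp add: L2_scale L2_class_vec L2_functions_scale)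
  show "vinner (L2 M) (vzero (L2 M)) \<xi> = 0" using f by (simp add: L2_zero L2_inner L2_functions_zero)
  show "0 \<le> Re (vinner (L2 M) \<xi> \<xi>)" using f by (simp add: L2_inner_self)
  assume y: "\<eta> \<in> vectors (L2 M)"
  then obtain g where g: "g \<in> L2_functions M" "\<eta> = L2_class M g" by (rule L2_vec_cases)
  show "vplus (L2 M) \<xi> \<eta> \<in> vectors (L2 M)" using f g by (simp add: L2_plus L2_class_vec L2_functions_plus)
  show "vinner (L2 M) \<eta> \<xi> = cnj (vinner (L2 M) \<xi> \<eta>)"
  proof -
    have "(\<integral>x. g x * cnj (f x) \<partial>M) = (\<integral>x. cnj (f x * cnj (g x)) \<partial>M)" by (simp add: mult.commute)
    also have "\<dots> = cnj (\<integral>x. f x * cnj (g x) \<partial>M)" by (rule Bochner_Integration.integral_cnj)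
    finally show ?thesis using f g by (simp add: L2_inner)
  qed
  show "vinner (L2 M) (vscale (L2 M) z \<xi>) \<eta> = z * vinner (L2 M) \<xi> \<eta>"
    using f g by (simp add: L2_inner L2_scale L2_functions_scale mult.assoc)
next
  fix \<xi> \<xi>' \<eta> :: "('a \<Rightarrow> complex) set"
  assume "\<xi> \<in> vectors (L2 M)" "\<xi>' \<in> vectors (L2 M)" "\<eta> \<in> vectors (L2 M)"
  then obtain f f' g where "f \<in> L2_functions M" "f' \<in> L2_functions M" "g \<in> L2_functions M"
    "\<xi> = L2_class M f" "\<xi>' = L2_class M f'" "\<eta> = L2_class M g" by (metis L2_vec_cases)
  then show "vinner (L2 M) (vplus (L2 M) \<xi> \<xi>') \<eta> = vinner (L2 M) \<xi> \<eta> + vinner (L2 M) \<xi>' \<eta>"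
    by (simp add: L2_inner L2_plus L2_functions_plus distrib_right L2_integrable_product)
next
  fix \<xi> \<eta> :: "('a \<Rightarrow> complex) set"
  assume "\<xi> \<in> vectors (L2 M)" "\<eta> \<in> vectors (L2 M)"
    and eq: "\<And>t. t \<in> vectors (L2 M) \<Longrightarrow> vinner (L2 M) \<xi> t = vinner (L2 M) \<eta> t"
  then obtain f g where f: "f \<in> L2_functions M" "\<xi> = L2_class M f"
    and g: "g \<in> L2_functions M" "\<eta> = L2_class M g" by (metis L2_vec_cases)
  let ?d = "\<lambda>x. f x - g x"
  have d: "?d \<in> L2_functions M" by (rule L2_functions_diff[OF f(1) g(1)])
  have "(\<integral>x. f x * cnj (?d x) \<partial>M) = (\<integral>x. g x * cnj (?d x) \<partial>M)"
    using eq[OF L2_class_vec[OF d]] unfolding f(2) g(2) L2_inner[OF f(1) d] L2_inner[OF g(1) d] .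
  then have "(\<integral>x. ?d x * cnj (?d x) \<partial>M) = 0"
    using Bochner_Integration.integral_diff[OF L2_integrable_product[OF f(1) d] L2_integrable_product[OF g(1) d]]
    by (simp add: left_diff_distrib)
  then have "(\<integral>x. (cmod (?d x))\<^sup>2 \<partial>M) = 0"
    using L2_inner[OF d d] L2_inner_self[OF d] by simp
  then have "AE x in M. (cmod (?d x))\<^sup>2 = 0"
    using integral_nonneg_eq_0_iff_AE[OF L2_functionsD(2)[OF d]] by simp
  then have "AE x in M. f x = g x" by eventually_elim simp
  then show "\<xi> = \<eta>" using L2_class_eq_iff f g by blast
next
  fix X :: "nat \<Rightarrow> ('a \<Rightarrow> complex) set"
  assume X: "\<And>n. X n \<in> vectors (L2 M)"
    and cauchy: "\<And>\<epsilon>. 0 < \<epsilon> \<Longrightarrow> \<exists>N. \<forall>m\<ge>N. \<forall>n\<ge>N.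
      vnorm (L2 M) (vplus (L2 M) (X m) (vscale (L2 M) (-1) (X n))) < \<epsilon>"
  have "\<exists>f. f \<in> L2_functions M \<and> X n = L2_class M f" for n using L2_vec_cases[OF X] by metis
  then obtain f where f: "\<And>n. f n \<in> L2_functions M" "\<And>n. X n = L2_class M (f n)" by metis
  have nrm: "vnorm (L2 M) (vplus (L2 M) (X m) (vscale (L2 M) (-1) (L2_class M g)))
      = sqrt (\<integral>x. (cmod (f m x - g x))\<^sup>2 \<partial>M)" if "g \<in> L2_functions M" for m g
    using f that by (simp add: L2_vminus L2_vnorm L2_functions_diff)
  obtain g where g: "g \<in> L2_functions M" "(\<lambda>n. \<integral>x. (cmod (f n x - g x))\<^sup>2 \<partial>M) \<longlonglongrightarrow> 0"
  proof (rule riesz_fischer[OF f(1)])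
    fix \<epsilon> :: real assume "0 < \<epsilon>"
    then have "0 < sqrt \<epsilon>" by simp
    then obtain N where "\<forall>m\<ge>N. \<forall>n\<ge>N. vnorm (L2 M) (vplus (L2 M) (X m) (vscale (L2 M) (-1) (X n))) < sqrt \<epsilon>"
      using cauchy by blast
    then show "\<exists>N. \<forall>m\<ge>N. \<forall>n\<ge>N. (\<integral>x. (cmod (f m x - f n x))\<^sup>2 \<partial>M) < \<epsilon>"
      using nrm[OF f(1)] f(2) by auto
  qed
  have "(\<lambda>n. vnorm (L2 M) (vplus (L2 M) (X n) (vscale (L2 M) (-1) (L2_class M g)))) \<longlonglongrightarrow> 0"
    using tendsto_real_sqrt[OF g(2)] nrm[OF g(1)] by simp
  then show "\<exists>u\<in>vectors (L2 M). (\<lambda>n. vnorm (L2 M) (vplus (L2 M) (X n) (vscale (L2 M) (-1) u))) \<longlonglongrightarrow> 0"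
    using L2_class_vec[OF g(1)] by blast
qed

lemma L2_functions_nn_integral:
  assumes "f \<in> borel_measurable M" "(\<integral>\<^sup>+x. ennreal ((cmod (f x))\<^sup>2) \<partial>M) < \<infinity>"
  shows "f \<in> L2_functions M"
  unfolding L2_functions_def using assms by (auto intro!: integrableI_nonneg)

lemma L2_functions_indicator:
  assumes f: "f \<in> L2_functions M" and A: "A \<in> sets M"
  shows "(\<lambda>x. indicator A x * f x) \<in> L2_functions M"
proof (rule L2_functions_bounded[of _ _ "\<lambda>x. (cmod (f x))\<^sup>2"])
  show "(\<lambda>x. indicator A x * f x) \<in> borel_measurable M" using L2_functionsD(1)[OF f] A by measurable
qed (use L2_functionsD(2)[OF f] in \<open>auto simp: indicator_def\<close>)

lemma L2_class_cong:
  assumes "f \<in> L2_functions M" "g \<in> L2_functions M" "\<And>x. x \<in> space M \<Longrightarrow> f x = g x"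
  shows "L2_class M f = L2_class M g"
  using assms by (subst L2_class_eq_iff) (auto intro: AE_I2)

section \<open>The combinatorics of the flip graph\<close>

locale flip = kgraph L for L :: "('a, 2) kgraph_data" +
  fixes v f1 f2 e :: 'a
  assumes flip: "flip_graph L v f1 f2 e"
begin

lemma vertices_flip: "vertices L = {v}"
  and edges1: "paths_of_degree L (axis 1 1) = {f1, f2}"
  and f1_neq_f2: "f1 \<noteq> f2"
  and edges2: "paths_of_degree L (axis 2 1) = {e}"
  using flip by (auto simp: flip_graph_def)

lemma v_mor: "v \<in> mor L" "deg L v = 0"
  using vertices_flip by (auto simp: paths_of_degree_def)

lemma e_mor: "e \<in> mor L" "deg L e = axis 2 1"
  using edges2 by (auto simp: paths_of_degree_def)

lemma f_mor: "g \<in> {f1, f2} \<Longrightarrow> g \<in> mor L" "g \<in> {f1, f2} \<Longrightarrow> deg L g = axis 1 1"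
  using edges1 by (auto simp: paths_of_degree_def)

lemma src_v: "l \<in> mor L \<Longrightarrow> src L l = v"
  and rng_v: "l \<in> mor L \<Longrightarrow> rng L l = v"
  using vertices_flip deg_identity src_mor rng_mor by (auto simp: paths_of_degree_def)

lemma cmp_mor_flip: "\<lbrakk>l \<in> mor L; m \<in> mor L\<rbrakk> \<Longrightarrow> cmp L l m \<in> mor L"
  by (simp add: cmp_mor src_v rng_v)

lemma deg_cmp_flip: "\<lbrakk>l \<in> mor L; m \<in> mor L\<rbrakk> \<Longrightarrow> deg L (cmp L l m) = deg L l + deg L m"
  by (simp add: deg_cmp src_v rng_v)

lemma cmp_assoc_flip:
  "\<lbrakk>l \<in> mor L; m \<in> mor L; n \<in> mor L\<rbrakk> \<Longrightarrow> cmp L (cmp L l m) n = cmp L l (cmp L m n)"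
  by (simp add: cmp_assoc src_v rng_v)

lemma cmp_v_left: "l \<in> mor L \<Longrightarrow> cmp L v l = l"
  using cmp_rng[of l] by (simp add: rng_v)

text \<open>
  With a single vertex all paths are composable, so factorization is a bijection with a full
  product set.
\<close>

lemma factor_bij:
  "bij_betw (\<lambda>(a, b). cmp L a b) (paths_of_degree L m \<times> paths_of_degree L n) (paths_of_degree L (m + n))"
  unfolding bij_betw_def
proof
  show "inj_on (\<lambda>(a, b). cmp L a b) (paths_of_degree L m \<times> paths_of_degree L n)"
  proof (rule inj_onI)
    fix p q
    assume p: "p \<in> paths_of_degree L m \<times> paths_of_degree L n" and q: "q \<in> paths_of_degree L m \<times> paths_of_degree L n"
      and eq: "(case p of (a, b) \<Rightarrow> cmp L a b) = (case q of (a, b) \<Rightarrow> cmp L a b)"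
    obtain a b a' b' where pq: "p = (a, b)" "q = (a', b')" by fastforce
    have m: "a \<in> mor L" "b \<in> mor L" "a' \<in> mor L" "b' \<in> mor L" "deg L a = deg L a'"
      using p q pq by (auto simp: paths_of_degree_def)
    then show "p = q"
      using factorization_unique[of a b a' b'] eq pq by (simp add: src_v rng_v)
  qed
  show "(\<lambda>(a, b). cmp L a b) ` (paths_of_degree L m \<times> paths_of_degree L n) = paths_of_degree L (m + n)"
  proof
    show "(\<lambda>(a, b). cmp L a b) ` (paths_of_degree L m \<times> paths_of_degree L n) \<subseteq> paths_of_degree L (m + n)"
      by (auto simp: paths_of_degree_def cmp_mor_flip deg_cmp_flip)
    show "paths_of_degree L (m + n) \<subseteq> (\<lambda>(a, b). cmp L a b) ` (paths_of_degree L m \<times> paths_of_degree L n)"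
    proof
      fix l assume "l \<in> paths_of_degree L (m + n)"
      then have "l \<in> mor L" "deg L l = m + n" by (auto simp: paths_of_degree_def)
      then obtain a b where "a \<in> mor L" "b \<in> mor L" "l = cmp L a b" "deg L a = m" "deg L b = n"
        by (rule factorization_exists)
      then show "l \<in> (\<lambda>(a, b). cmp L a b) ` (paths_of_degree L m \<times> paths_of_degree L n)"
        by (force simp: paths_of_degree_def)
    qed
  qed
qed

lemma vec2_eq: "(m :: nat ^ 2) = (\<chi> i. if i = 1 then m $ 1 else m $ 2)"
  unfolding vec_eq_iff forall_2 by simp

lemma paths_of_degree_count:
  "finite (paths_of_degree L m) \<and> card (paths_of_degree L m) = 2 ^ (m $ 1)"
proof -
  define E :: "nat \<Rightarrow> nat \<Rightarrow> nat ^ 2" where "E a b = (\<chi> i. if i = 1 then a else b)" for a b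
  have E0: "E 0 0 = 0" unfolding vec_eq_iff forall_2 by (simp add: E_def)
  have Eb: "E 0 (Suc b) = E 0 b + axis 2 1" for b unfolding vec_eq_iff forall_2 by (simp add: E_def axis_def)
  have Ea: "E (Suc a) b = E a b + axis 1 1" for a b unfolding vec_eq_iff forall_2 by (simp add: E_def axis_def)
  have "finite (paths_of_degree L (E a b)) \<and> card (paths_of_degree L (E a b)) = 2 ^ a" for a b
  proof (induction a)
    case 0
    show ?case
    proof (induction b)
      case 0 then show ?case unfolding E0 vertices_flip by simp
    next
      case (Suc b)
      then show ?case unfolding Eb
        using bij_betw_finite[OF factor_bij, of "E 0 b" "axis 2 1", unfolded edges2]
          bij_betw_same_card[OF factor_bij, of "E 0 b" "axis 2 1", unfolded edges2]
        by (simp add: card_cartesian_product)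
    qed
  next
    case (Suc a)
    then show ?case unfolding Ea
      using bij_betw_finite[OF factor_bij, of "E a b" "axis 1 1", unfolded edges1]
        bij_betw_same_card[OF factor_bij, of "E a b" "axis 1 1", unfolded edges1] f1_neq_f2
      by (simp add: card_cartesian_product)
  qed
  from this[of "m $ 1" "m $ 2"] show ?thesis unfolding E_def vec2_eq[symmetric] .
qed

abbreviation sq :: "'a list \<Rightarrow> 'a" where
  "sq gs \<equiv> square_path L v e gs"

lemma sq_Nil: "sq [] = v"
  and sq_Cons: "sq (g # gs) = cmp L e (cmp L g (sq gs))"
  by (simp_all add: square_path_def)

lemma diagonal_Suc: "(diagonal (Suc n) :: nat ^ 2) = axis 2 1 + (axis 1 1 + diagonal n)"
  unfolding vec_eq_iff forall_2 by (simp add: axis_def)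

lemma sq_mor: "set gs \<subseteq> {f1, f2} \<Longrightarrow> sq gs \<in> mor L \<and> deg L (sq gs) = diagonal (length gs)"
proof (induction gs)
  case Nil then show ?case by (simp add: sq_Nil v_mor diagonal_0)
next
  case (Cons g gs)
  then have "sq gs \<in> mor L" "deg L (sq gs) = diagonal (length gs)" "g \<in> mor L" "deg L g = axis 1 1"
    using f_mor[of g] by auto
  then show ?case by (simp add: sq_Cons cmp_mor_flip deg_cmp_flip e_mor diagonal_Suc del: diagonal_nth)
qed

lemma sq_append: "\<lbrakk>set gs \<subseteq> {f1, f2}; set hs \<subseteq> {f1, f2}\<rbrakk> \<Longrightarrow> sq (gs @ hs) = cmp L (sq gs) (sq hs)"
proof (induction gs)
  case Nil then show ?case using sq_mor[of hs] by (simp add: sq_Nil cmp_v_left)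
next
  case (Cons g gs)
  then have "sq gs \<in> mor L" "sq hs \<in> mor L" "g \<in> mor L" using f_mor(1)[of g] sq_mor by auto
  then show ?case using Cons by (simp add: sq_Cons cmp_mor_flip cmp_assoc_flip e_mor)
qed

text \<open>
  Cancel \<open>e\<close> and compare the next edges; both have degree \<open>e\<^sub>1\<close>, so unique factorization applies.
\<close>

lemma sq_inj:
  "\<lbrakk>set gs \<subseteq> {f1, f2}; set hs \<subseteq> {f1, f2}; sq gs = sq hs\<rbrakk> \<Longrightarrow> gs = hs"
proof (induction gs arbitrary: hs)
  case Nil
  then have "deg L (sq hs) = 0" by (simp add: sq_Nil v_mor flip: Nil.prems(3))
  then have "length hs = 0" using sq_mor[OF Nil.prems(2)] diagonal_0 diagonal_eq_iff by metis
  then show ?case by simp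
next
  case (Cons g gs)
  have "length (g # gs) = length hs"
    using sq_mor[OF Cons.prems(1)] sq_mor[OF Cons.prems(2)] Cons.prems(3) diagonal_eq_iff by metis
  then obtain h hs' where hs: "hs = h # hs'" by (cases hs) auto
  have gm: "g \<in> mor L" "sq gs \<in> mor L" "h \<in> mor L" "sq hs' \<in> mor L" "deg L g = deg L h"
    using Cons.prems hs f_mor[of g] f_mor[of h] sq_mor[of gs] sq_mor[of hs'] by auto
  have "cmp L e (cmp L g (sq gs)) = cmp L e (cmp L h (sq hs'))" using Cons.prems(3) hs by (simp add: sq_Cons)
  then have "cmp L g (sq gs) = cmp L h (sq hs')"
    using factorization_unique(2)[of e "cmp L g (sq gs)" e "cmp L h (sq hs')"]
    by (simp add: e_mor cmp_mor_flip gm src_v rng_v)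
  then have "g = h" "sq gs = sq hs'"
    using factorization_unique[of g "sq gs" h "sq hs'"] gm by (simp_all add: src_v rng_v)
  then show ?case using Cons.IH[of hs'] Cons.prems hs by simp
qed

lemma sq_surj:
  "\<lbrakk>l \<in> mor L; deg L l = diagonal n\<rbrakk> \<Longrightarrow> \<exists>gs. set gs \<subseteq> {f1, f2} \<and> length gs = n \<and> l = sq gs"
proof (induction n arbitrary: l)
  case 0
  then have "l \<in> vertices L" by (simp add: paths_of_degree_def diagonal_0)
  then have "l = sq []" by (simp add: vertices_flip sq_Nil)
  then show ?case by (intro exI[of _ "[]"]) simp
next
  case (Suc n)
  obtain a m where a: "a \<in> mor L" "m \<in> mor L" "l = cmp L a m" "deg L a = axis 2 1" "deg L m = axis 1 1 + diagonal n"
    using factorization_exists[OF Suc.prems(1) Suc.prems(2)[unfolded diagonal_Suc]] by blast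
  obtain g l' where g: "g \<in> mor L" "l' \<in> mor L" "m = cmp L g l'" "deg L g = axis 1 1" "deg L l' = diagonal n"
    using factorization_exists[OF a(2,5)] by blast
  obtain gs where gs: "set gs \<subseteq> {f1, f2}" "length gs = n" "l' = sq gs" using Suc.IH[OF g(2,5)] by blast
  have "a = e" using a edges2 by (auto simp: paths_of_degree_def)
  moreover have "g \<in> {f1, f2}" using g edges1 by (auto simp: paths_of_degree_def)
  ultimately show ?case using a g gs by (intro exI[of _ "g # gs"]) (auto simp: sq_Cons)
qed

text \<open>
  Entries are counted from 0, so \<open>edge x i\<close> is the \<open>(i + 1)\<close>-st edge \<open>g\<close> in \<open>x = e g\<^sub>1 e g\<^sub>2 \<dots>\<close>; it is
  read off from the initial segment with \<open>i + 1\<close> squares.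
\<close>

definition edge :: "('a, 2) infpath \<Rightarrow> nat \<Rightarrow> 'a" where
  "edge x i = (THE gs. set gs \<subseteq> {f1, f2} \<and> x (0, diagonal (Suc i)) = sq gs) ! i"

lemma edge_eqI:
  assumes "set gs \<subseteq> {f1, f2}" "x (0, diagonal (Suc i)) = sq gs"
  shows "edge x i = gs ! i"
proof -
  have "(THE hs. set hs \<subseteq> {f1, f2} \<and> x (0, diagonal (Suc i)) = sq hs) = gs"
  proof (rule the_equality)
    show "set gs \<subseteq> {f1, f2} \<and> x (0, diagonal (Suc i)) = sq gs" using assms by blast
    show "hs = gs" if "set hs \<subseteq> {f1, f2} \<and> x (0, diagonal (Suc i)) = sq hs" for hs
      by (rule sq_inj[OF conjunct1[OF that] assms(1) trans[OF conjunct2[OF that, symmetric] assms(2)]])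
  qed
  then show ?thesis by (simp add: edge_def)
qed

text \<open>
  The word of the longer initial segment extends that of the shorter one, because its first \<open>n\<close>
  squares are an initial segment of degree \<open>(n, n)\<close> as well.
\<close>

lemma infinite_path_edges:
  assumes x: "x \<in> infinite_paths L"
  shows "x (0, diagonal n) = sq (map (edge x) [0..<n]) \<and> set (map (edge x) [0..<n]) \<subseteq> {f1, f2}"
proof (induction n)
  case 0
  have "x (0, diagonal 0) \<in> vertices L"
    using infinite_path_mor0[OF x, of "diagonal 0"] infinite_path_deg0[OF x, of "diagonal 0"]
    by (simp add: paths_of_degree_def diagonal_0)
  then show ?case by (simp add: vertices_flip sq_Nil)
next
  case (Suc n)
  obtain gs where gs: "set gs \<subseteq> {f1, f2}" "length gs = Suc n" "x (0, diagonal (Suc n)) = sq gs"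
    using sq_surj[OF infinite_path_mor0[OF x] infinite_path_deg0[OF x]] by blast
  define hs g where "hs = butlast gs" "g = last gs"
  have gsd: "gs = hs @ [g]" using gs(2) by (cases gs rule: rev_cases) (auto simp: hs_g_def)
  have hs: "set hs \<subseteq> {f1, f2}" "set [g] \<subseteq> {f1, f2}" "length hs = n" using gs gsd by auto
  have "prefix (sq hs) (sq gs)"
    unfolding gsd sq_append[OF hs(1,2)] using sq_mor[OF hs(1)] sq_mor[OF hs(2)]
    by (intro prefix_cmp) (simp_all add: src_v rng_v)
  moreover have "prefix (x (0, diagonal n)) (sq gs)"
    using infinite_path_prefix[OF x diagonal_mono[of n "Suc n"]] gs(3) by simp
  ultimately have "x (0, diagonal n) = sq hs"
    using prefix_unique[of "x (0, diagonal n)" "sq gs" "sq hs"] sq_mor[OF hs(1)] hs(3)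
    by (simp add: infinite_path_deg0[OF x])
  then have "hs = map (edge x) [0..<n]"
    by (intro sq_inj[OF hs(1) conjunct2[OF Suc]] trans[OF _ conjunct1[OF Suc]]) (rule sym)
  moreover have "edge x n = g" using edge_eqI[of gs x n, OF gs(1,3)] gsd hs(3) by (simp add: nth_append)
  ultimately have "gs = map (edge x) [0..<Suc n]" using gsd by simp
  then show ?case using gs by simp
qed

lemma edge_in: "x \<in> infinite_paths L \<Longrightarrow> edge x i \<in> {f1, f2}"
  using infinite_path_edges[of x "Suc i"] by auto

lemma mem_square_cylinder_iff:
  assumes gs: "set gs \<subseteq> {f1, f2}"
  shows "x \<in> cylinder L (sq gs) \<longleftrightarrow> x \<in> infinite_paths L \<and> (\<forall>i<length gs. edge x i = gs ! i)"
proof (cases "x \<in> infinite_paths L")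
  case True
  have "x \<in> cylinder L (sq gs) \<longleftrightarrow> sq (map (edge x) [0..<length gs]) = sq gs"
    using True infinite_path_edges[OF True, of "length gs"] sq_mor[OF gs] by (simp add: cylinder_def)
  also have "\<dots> \<longleftrightarrow> map (edge x) [0..<length gs] = gs"
    by (rule iffI, rule sq_inj[OF conjunct2[OF infinite_path_edges[OF True]] gs]) simp_all
  also have "\<dots> \<longleftrightarrow> (\<forall>i<length gs. edge x i = gs ! i)"
    unfolding list_eq_iff_nth_eq by simp
  finally show ?thesis using True by blast
qed (auto simp: cylinder_def)

lemma infinite_path_of_edges:
  assumes g: "\<And>i. g i \<in> {f1, f2}"
  shows "\<exists>x. x \<in> infinite_paths L \<and> (\<forall>i. edge x i = g i)"
proof -
  let ?p = "\<lambda>n. sq (map g [0..<n])"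
  have s: "set (map g xs) \<subseteq> {f1, f2}" for xs using g by auto
  note m = sq_mor[OF s]
  have pre: "prefix (?p m) (?p n)" if "m \<le> n" for m n
  proof -
    have "[0..<n] = [0..<m] @ [m..<n]" using that by (metis le_add_diff_inverse upt_add_eq_append zero_le)
    then have "?p n = cmp L (?p m) (sq (map g [m..<n]))" using sq_append[OF s s] by simp
    then show ?thesis using m by (simp add: prefix_cmp src_v rng_v)
  qed
  obtain x where x: "x \<in> infinite_paths L" "\<And>a. a \<in> range ?p \<Longrightarrow> x (0, deg L a) = a"
  proof (rule infinite_path_of_directed_set[of "range ?p"])
    show "range ?p \<subseteq> mor L" using m by auto
    fix a b assume "a \<in> range ?p" "b \<in> range ?p"
    then obtain m n where "a = ?p m" "b = ?p n" by blast
    then have "prefix a (?p (max m n))" "prefix b (?p (max m n))" using pre by simp_all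
    then show "\<exists>c\<in>range ?p. prefix a c \<and> prefix b c" by blast
  next
    fix q :: "nat ^ 2"
    have "deg L (?p (Max (range (\<lambda>i. q $ i)))) = diagonal (Max (range (\<lambda>i. q $ i)))" using m by simp
    then have "q \<le> deg L (?p (Max (range (\<lambda>i. q $ i))))" using le_diagonal_Max[of q] by simp
    then show "\<exists>a\<in>range ?p. q \<le> deg L a" by blast
  qed blast
  have "edge x i = g i" for i
  proof -
    have "x (0, diagonal (Suc i)) = ?p (Suc i)" using x(2)[OF rangeI, of "Suc i"] m[of "[0..<Suc i]"] by (simp del: upt_Suc)
    then have "edge x i = map g [0..<Suc i] ! i" by (rule edge_eqI[of "map g [0..<Suc i]" x i, OF s])
    then show ?thesis by (simp del: upt_Suc)
  qed
  with x(1) show ?thesis by blast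
qed

lemma cylinder_v: "cylinder L v = infinite_paths L"
  using mem_square_cylinder_iff[of "[]"] by (auto simp: sq_Nil)

lemma diagonal_cylinders_flip:
  "diagonal_cylinders = {cylinder L (sq gs) |gs. set gs \<subseteq> {f1, f2}}"
  unfolding diagonal_cylinders_def using sq_mor sq_surj by fastforce

lemma mem_square_cylinder_snoc:
  assumes "set gs \<subseteq> {f1, f2}" "g \<in> {f1, f2}"
  shows "x \<in> cylinder L (sq (gs @ [g])) \<longleftrightarrow> x \<in> cylinder L (sq gs) \<and> edge x (length gs) = g"
proof -
  have "set (gs @ [g]) \<subseteq> {f1, f2}" using assms by simp
  then show ?thesis
    unfolding mem_square_cylinder_iff[OF \<open>set (gs @ [g]) \<subseteq> {f1, f2}\<close>] mem_square_cylinder_iff[OF assms(1)]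
    by (simp add: All_less_Suc nth_append conj_commute conj_left_commute cong: conj_cong)
qed

lemma square_cylinder_split:
  assumes "set gs \<subseteq> {f1, f2}"
  shows "cylinder L (sq gs) = cylinder L (sq (gs @ [f1])) \<union> cylinder L (sq (gs @ [f2]))"
    "cylinder L (sq (gs @ [f1])) \<inter> cylinder L (sq (gs @ [f2])) = {}"
proof -
  have s: "x \<in> cylinder L (sq (gs @ [f1])) \<longleftrightarrow> x \<in> cylinder L (sq gs) \<and> edge x (length gs) = f1"
    "x \<in> cylinder L (sq (gs @ [f2])) \<longleftrightarrow> x \<in> cylinder L (sq gs) \<and> edge x (length gs) = f2" for x
    using mem_square_cylinder_snoc[OF assms] by blast+
  have "edge x (length gs) = f1 \<or> edge x (length gs) = f2" if "x \<in> cylinder L (sq gs)" for x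
    using edge_in[of x "length gs"] that cylinder_subset by blast
  then show "cylinder L (sq gs) = cylinder L (sq (gs @ [f1])) \<union> cylinder L (sq (gs @ [f2]))"
    using s by blast
  show "cylinder L (sq (gs @ [f1])) \<inter> cylinder L (sq (gs @ [f2])) = {}"
    using s f1_neq_f2 by (simp add: set_eq_iff)
qed

section \<open>Measures on the path space\<close>

text \<open>
  This gives the uniqueness of \<open>\<mu>\<close>, the identification of the Perron--Frobenius measure and its
  scaling under shifts.
\<close>

lemma measure_eqI_square_cylinders:
  assumes M: "sets M = sets (path_borel L)" and N: "sets N = sets (path_borel L)"
    and fin: "emeasure M (infinite_paths L) \<noteq> \<infinity>"
    and eq: "\<And>gs. set gs \<subseteq> {f1, f2} \<Longrightarrow> emeasure M (cylinder L (sq gs)) = emeasure N (cylinder L (sq gs))"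
  shows "M = N"
proof (rule measure_eqI_generator_eq[OF diagonal_cylinders_Int_stable, of "infinite_paths L" _ _ "\<lambda>_. infinite_paths L"])
  show "insert {} diagonal_cylinders \<subseteq> Pow (infinite_paths L)"
    using cylinder_subset by (auto simp: diagonal_cylinders_def)
  show "emeasure M X = emeasure N X" if "X \<in> insert {} diagonal_cylinders" for X
    using that eq by (auto simp: diagonal_cylinders_flip)
  show "sets M = sigma_sets (infinite_paths L) (insert {} diagonal_cylinders)"
    "sets N = sigma_sets (infinite_paths L) (insert {} diagonal_cylinders)"
    using M N sets_path_borel_insert by simp_all
  have "cylinder L (sq []) \<in> diagonal_cylinders"
    unfolding diagonal_cylinders_flip by (rule CollectI, rule exI[of _ "[]"]) simp
  then have "infinite_paths L \<in> diagonal_cylinders" by (simp add: sq_Nil cylinder_v)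
  then show "range (\<lambda>_ :: nat. infinite_paths L) \<subseteq> insert {} diagonal_cylinders" by auto
qed (use fin in auto)

text \<open>
  The inverse of the coding of infinite paths by sequences of edges, with \<open>True\<close> for \<open>f1\<close>.
\<close>

definition coin_path :: "(nat \<Rightarrow> bool) \<Rightarrow> ('a, 2) infpath" where
  "coin_path b = (SOME x. x \<in> infinite_paths L \<and> (\<forall>i. edge x i = (if b i then f1 else f2)))"

lemma coin_path: "coin_path b \<in> infinite_paths L" "edge (coin_path b) i = (if b i then f1 else f2)"
proof -
  have "\<exists>x. x \<in> infinite_paths L \<and> (\<forall>i. edge x i = (if b i then f1 else f2))"
    by (rule infinite_path_of_edges) simp
  from someI_ex[OF this] show "coin_path b \<in> infinite_paths L"
    "edge (coin_path b) i = (if b i then f1 else f2)" unfolding coin_path_def by blast+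
qed

definition fair :: "('a, 2) infpath measure" where
  "fair = distr (Pi\<^sub>M UNIV (\<lambda>_ :: nat. measure_pmf (bernoulli_pmf (1 / 2)))) (path_borel L) coin_path"

lemma coin_path_vimage:
  assumes gs: "set gs \<subseteq> {f1, f2}"
  shows "coin_path -` cylinder L (sq gs) = {b. \<forall>i\<in>{..<length gs}. b i \<in> {gs ! i = f1}}"
proof -
  have *: "(if c then f1 else f2) = gs ! i \<longleftrightarrow> c = (gs ! i = f1)" if "i < length gs" for i c
  proof -
    have "gs ! i = f1 \<or> gs ! i = f2" using gs nth_mem[OF that] by blast
    then show ?thesis using f1_neq_f2 by (metis (full_types))
  qed
  show ?thesis
  proof (rule Set.set_eqI)
    fix b
    have "b \<in> coin_path -` cylinder L (sq gs) \<longleftrightarrow> (\<forall>i<length gs. (if b i then f1 else f2) = gs ! i)"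
      unfolding vimage_eq mem_square_cylinder_iff[OF gs] coin_path(2) by (simp add: coin_path(1))
    also have "\<dots> \<longleftrightarrow> (\<forall>i<length gs. b i = (gs ! i = f1))" by (simp only: * cong: imp_cong)
    also have "\<dots> \<longleftrightarrow> b \<in> {b. \<forall>i\<in>{..<length gs}. b i \<in> {gs ! i = f1}}"
      unfolding mem_Collect_eq Ball_def lessThan_iff singleton_iff by (rule refl)
    finally show "b \<in> coin_path -` cylinder L (sq gs) \<longleftrightarrow> b \<in> {b. \<forall>i\<in>{..<length gs}. b i \<in> {gs ! i = f1}}" .
  qed
qed

lemma coin_path_measurable [measurable]:
  "coin_path \<in> Pi\<^sub>M UNIV (\<lambda>_ :: nat. measure_pmf (bernoulli_pmf (1 / 2))) \<rightarrow>\<^sub>M path_borel L"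
proof (rule measurable_path_borelI)
  fix l n assume "l \<in> mor L" "deg L l = diagonal n"
  then obtain gs where gs: "set gs \<subseteq> {f1, f2}" "l = sq gs" using sq_surj by blast
  show "coin_path -` cylinder L l \<inter> space (Pi\<^sub>M UNIV (\<lambda>_ :: nat. measure_pmf (bernoulli_pmf (1 / 2))))
      \<in> sets (Pi\<^sub>M UNIV (\<lambda>_ :: nat. measure_pmf (bernoulli_pmf (1 / 2))))"
    (is "_ \<inter> space ?P \<in> _")
  proof -
    have "{b \<in> space ?P. b i \<in> {gs ! i = f1}} \<in> sets ?P" for i
      by (rule measurable_sets_Collect[OF measurable_component_singleton]) auto
    then have "{b \<in> space ?P. \<forall>i\<in>{..<length gs}. b i \<in> {gs ! i = f1}} \<in> sets ?P"
      by (intro sets.sets_Collect_finite_All) auto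
    also have "{b \<in> space ?P. \<forall>i\<in>{..<length gs}. b i \<in> {gs ! i = f1}} = coin_path -` cylinder L l \<inter> space ?P"
      unfolding gs(2) coin_path_vimage[OF gs(1)] by blast
    finally show ?thesis .
  qed
qed (auto simp: coin_path)

lemma fair_square_cylinder:
  assumes gs: "set gs \<subseteq> {f1, f2}"
  shows "emeasure fair (cylinder L (sq gs)) = ennreal ((1 / 2) ^ length gs)"
proof -
  let ?B = "\<lambda>_ :: nat. measure_pmf (bernoulli_pmf (1 / 2))"
  interpret product_prob_space ?B UNIV ..
  have "emeasure fair (cylinder L (sq gs)) = emeasure (Pi\<^sub>M UNIV ?B) (coin_path -` cylinder L (sq gs) \<inter> space (Pi\<^sub>M UNIV ?B))"
    unfolding fair_def using sq_mor[OF gs] by (intro emeasure_distr) (auto intro: cylinder_sets)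
  also have "coin_path -` cylinder L (sq gs) \<inter> space (Pi\<^sub>M UNIV ?B)
      = {b \<in> space (Pi\<^sub>M UNIV ?B). \<forall>i\<in>{..<length gs}. b i \<in> {gs ! i = f1}}"
    unfolding coin_path_vimage[OF gs] by auto
  also have "emeasure (Pi\<^sub>M UNIV ?B) \<dots> = (\<Prod>i\<in>{..<length gs}. emeasure (measure_pmf (bernoulli_pmf (1 / 2))) {gs ! i = f1})"
    by (rule emeasure_PiM_Collect) auto
  also have "\<dots> = (\<Prod>i\<in>{..<length gs}. ennreal (1 / 2))"
    by (rule prod.cong) (auto simp: emeasure_pmf_single pmf_bernoulli_half)
  also have "\<dots> = ennreal ((1 / 2) ^ length gs)"
    unfolding prod_constant card_lessThan by (rule ennreal_power) simp
  finally show ?thesis .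
qed

lemma sets_fair [simp, measurable_cong]: "sets fair = sets (path_borel L)"
  by (simp add: fair_def)

lemma space_fair [simp]: "space fair = infinite_paths L"
  by (simp add: fair_def)

lemma prob_space_fair: "prob_space fair"
  by (rule prob_spaceI) (use fair_square_cylinder[of "[]"] in \<open>simp add: sq_Nil cylinder_v\<close>)

end

section \<open>Shift and prefixing maps\<close>

context kgraph
begin

text \<open>
  Cutting a cylinder set at a larger degree; the pieces are disjoint because the segments that
  distinguish them have the same degree.
\<close>

lemma cylinder_extend:
  assumes l: "l \<in> mor L"
  shows "cylinder L l = (\<Union>m\<in>{m \<in> paths_of_degree L q. rng L m = src L l}. cylinder L (cmp L l m))"
    "disjoint_family_on (\<lambda>m. cylinder L (cmp L l m)) {m \<in> paths_of_degree L q. rng L m = src L l}"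
proof -
  let ?P = "{m \<in> paths_of_degree L q. rng L m = src L l}"
  have iff: "x \<in> cylinder L (cmp L l m) \<longleftrightarrow> x \<in> cylinder L l \<and> path_shift (deg L l) x \<in> cylinder L m"
    if "m \<in> ?P" for x m
    by (rule cylinder_cmp_iff) (use that l in \<open>simp_all add: paths_of_degree_def\<close>)
  have "\<exists>m\<in>?P. x \<in> cylinder L (cmp L l m)" if x: "x \<in> cylinder L l" for x
  proof -
    have xi: "x \<in> infinite_paths L" and xl: "x (0, deg L l) = l" using x by (simp_all add: cylinder_def)
    let ?y = "path_shift (deg L l) x"
    have y: "?y \<in> infinite_paths L" by (rule path_shift_infinite_path[OF xi])
    have m: "?y (0, q) \<in> ?P"
      using path_shift_segment(2)[OF xi, of "deg L l" q] xl infinite_path_mor0[OF y] infinite_path_deg0[OF y]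
      by (simp add: paths_of_degree_def)
    moreover have "?y \<in> cylinder L (?y (0, q))" using y by (simp add: cylinder_def infinite_path_deg0)
    ultimately show ?thesis using iff[OF m] x by (intro bexI[OF _ m]) blast
  qed
  then show "cylinder L l = (\<Union>m\<in>?P. cylinder L (cmp L l m))" using iff by blast
  show "disjoint_family_on (\<lambda>m. cylinder L (cmp L l m)) ?P"
    unfolding disjoint_family_on_def
  proof (intro ballI impI)
    fix m n assume mn: "m \<in> ?P" "n \<in> ?P" "m \<noteq> n"
    then have "cylinder L m \<inter> cylinder L n = {}" by (auto simp: cylinder_def paths_of_degree_def)
    then show "cylinder L (cmp L l m) \<inter> cylinder L (cmp L l n) = {}" using iff[OF mn(1)] iff[OF mn(2)] by blast
  qed
qed

lemma prefixing_segment: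
  assumes "l \<in> mor L" "x \<in> infinite_paths L" "src L l = x (0, 0)"
  shows "prefixing L l x (0, deg L l + q) = cmp L l (x (0, q))"
proof -
  note p = prefixing_properties[OF assms]
  have y: "prefixing L l x \<in> infinite_paths L" "prefixing L l x (0, deg L l) = l"
    using p(1) by (simp_all add: cylinder_def)
  show ?thesis using path_shift_segment(1)[OF y(1), of "deg L l" q] unfolding y(2) p(2) .
qed

end

context flip
begin

lemma path_at_zero: "x \<in> infinite_paths L \<Longrightarrow> x (0, 0) = v"
  using infinite_path_mor0[of x 0] infinite_path_deg0[of x 0] vertices_flip by (auto simp: paths_of_degree_def)

lemma prefixing_flip:
  assumes "l \<in> mor L" "x \<in> infinite_paths L"
  shows "prefixing L l x \<in> cylinder L l" "path_shift (deg L l) (prefixing L l x) = x"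
    "prefixing L l x \<in> infinite_paths L"
proof -
  have s: "src L l = x (0, 0)" using assms by (simp add: src_v path_at_zero)
  show "prefixing L l x \<in> cylinder L l" "path_shift (deg L l) (prefixing L l x) = x"
    using prefixing_properties[OF assms s] .
  then show "prefixing L l x \<in> infinite_paths L" using cylinder_subset by blast
qed

lemma prefixing_image:
  assumes "l \<in> mor L" "A \<subseteq> infinite_paths L"
  shows "prefixing L l ` A = cylinder L l \<inter> path_shift (deg L l) -` A"
proof
  show "prefixing L l ` A \<subseteq> cylinder L l \<inter> path_shift (deg L l) -` A"
    using assms prefixing_flip by auto
  show "cylinder L l \<inter> path_shift (deg L l) -` A \<subseteq> prefixing L l ` A"
  proof
    fix y assume "y \<in> cylinder L l \<inter> path_shift (deg L l) -` A"
    then have "prefixing L l (path_shift (deg L l) y) = y" "path_shift (deg L l) y \<in> A"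
      using prefixing_eqI[OF assms(1)] by auto
    then show "y \<in> prefixing L l ` A" by (metis imageI)
  qed
qed

text \<open>
  The preimage of \<open>Z(l)\<close> is the union of the \<open>Z(k l)\<close> over the finitely many \<open>k\<close> of degree \<open>m\<close>.
\<close>

lemma path_shift_measurable [measurable]: "path_shift m \<in> path_borel L \<rightarrow>\<^sub>M path_borel L"
proof (rule measurable_path_borelI)
  show "path_shift m \<in> space (path_borel L) \<rightarrow> infinite_paths L" by (simp add: path_shift_infinite_path)
  fix l n assume l: "l \<in> mor L" "deg L l = diagonal n"
  have "path_shift m -` cylinder L l \<inter> space (path_borel L) = (\<Union>k\<in>paths_of_degree L m. cylinder L (cmp L k l))"
  proof
    show "path_shift m -` cylinder L l \<inter> space (path_borel L) \<subseteq> (\<Union>k\<in>paths_of_degree L m. cylinder L (cmp L k l))"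
    proof
      fix x assume "x \<in> path_shift m -` cylinder L l \<inter> space (path_borel L)"
      then have x: "x \<in> infinite_paths L" "path_shift m x \<in> cylinder L l" by simp_all
      have k: "x (0, m) \<in> mor L" "deg L (x (0, m)) = m" using infinite_path_mor0[OF x(1)] infinite_path_deg0[OF x(1)] .
      have "x \<in> cylinder L (x (0, m))" using x k by (simp add: cylinder_def)
      then have "x \<in> cylinder L (cmp L (x (0, m)) l)"
        using cylinder_cmp_iff[OF k(1) l(1), of x] x k src_v[OF k(1)] rng_v[OF l(1)] by simp
      then show "x \<in> (\<Union>k\<in>paths_of_degree L m. cylinder L (cmp L k l))"
        using k by (auto simp: paths_of_degree_def)
    qed
    show "(\<Union>k\<in>paths_of_degree L m. cylinder L (cmp L k l)) \<subseteq> path_shift m -` cylinder L l \<inter> space (path_borel L)"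
    proof
      fix x assume "x \<in> (\<Union>k\<in>paths_of_degree L m. cylinder L (cmp L k l))"
      then obtain k where k: "k \<in> mor L" "deg L k = m" "x \<in> cylinder L (cmp L k l)"
        by (auto simp: paths_of_degree_def)
      then have "path_shift m x \<in> cylinder L l"
        using cylinder_cmp_iff[OF k(1) l(1), of x] src_v[OF k(1)] rng_v[OF l(1)] by simp
      then show "x \<in> path_shift m -` cylinder L l \<inter> space (path_borel L)" using k(3) cylinder_subset by auto
    qed
  qed
  also have "\<dots> \<in> sets (path_borel L)"
    using paths_of_degree_count[of m] l
    by (intro sets.finite_UN cylinder_sets) (auto simp: paths_of_degree_def cmp_mor_flip)
  finally show "path_shift m -` cylinder L l \<inter> space (path_borel L) \<in> sets (path_borel L)" .
qed

text \<open>
  Whether \<open>l x\<close> lies in \<open>Z(k)\<close> depends only on the initial segment of \<open>x\<close> of the degree of \<open>k\<close>.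
\<close>

lemma prefixing_measurable [measurable]:
  assumes l: "l \<in> mor L"
  shows "prefixing L l \<in> path_borel L \<rightarrow>\<^sub>M path_borel L"
proof (rule measurable_path_borelI)
  show "prefixing L l \<in> space (path_borel L) \<rightarrow> infinite_paths L" using prefixing_flip[OF l] by simp
  fix k n assume k: "k \<in> mor L" "deg L k = diagonal n"
  let ?B = "{b \<in> paths_of_degree L (diagonal n). prefix k (cmp L l b)}"
  have iff: "prefixing L l x \<in> cylinder L k \<longleftrightarrow> prefix k (cmp L l (x (0, diagonal n)))"
    if x: "x \<in> infinite_paths L" for x
  proof -
    have "deg L k \<le> deg L l + diagonal n"
      unfolding k(2) by (subst add.commute) (rule vec_nat_le_add)
    moreover have "src L l = x (0, 0)" using l x by (simp add: src_v path_at_zero)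
    ultimately show ?thesis
      using mem_cylinder_iff_prefix[OF prefixing_flip(3)[OF l x], of k "deg L l + diagonal n"]
        prefixing_segment[OF l x, of "diagonal n"] by simp
  qed
  have "prefixing L l -` cylinder L k \<inter> space (path_borel L) = (\<Union>b\<in>?B. cylinder L b)"
  proof
    show "prefixing L l -` cylinder L k \<inter> space (path_borel L) \<subseteq> (\<Union>b\<in>?B. cylinder L b)"
    proof
      fix x assume "x \<in> prefixing L l -` cylinder L k \<inter> space (path_borel L)"
      then have x: "x \<in> infinite_paths L" "prefixing L l x \<in> cylinder L k" by simp_all
      have "x (0, diagonal n) \<in> ?B"
        using iff[OF x(1)] x infinite_path_mor0[OF x(1)] infinite_path_deg0[OF x(1)]
        by (simp add: paths_of_degree_def)
      moreover have "x \<in> cylinder L (x (0, diagonal n))" using x by (simp add: cylinder_def infinite_path_deg0)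
      ultimately show "x \<in> (\<Union>b\<in>?B. cylinder L b)" by blast
    qed
    show "(\<Union>b\<in>?B. cylinder L b) \<subseteq> prefixing L l -` cylinder L k \<inter> space (path_borel L)"
    proof
      fix x assume "x \<in> (\<Union>b\<in>?B. cylinder L b)"
      then obtain b where b: "deg L b = diagonal n" "prefix k (cmp L l b)" "x \<in> cylinder L b"
        by (auto simp: paths_of_degree_def)
      then have x: "x \<in> infinite_paths L" "x (0, diagonal n) = b" by (auto simp: cylinder_def)
      then show "x \<in> prefixing L l -` cylinder L k \<inter> space (path_borel L)" using iff[OF x(1)] b by simp
    qed
  qed
  also have "\<dots> \<in> sets (path_borel L)"
  proof (intro sets.finite_UN cylinder_sets)
    show "finite ?B" using paths_of_degree_count[of "diagonal n"] by simp
  qed (simp add: paths_of_degree_def)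
  finally show "prefixing L l -` cylinder L k \<inter> space (path_borel L) \<in> sets (path_borel L)" .
qed

text \<open>
  Cut \<open>Z(l)\<close> into square cylinder sets of side \<open>n\<close>.  There are \<open>2 ^ (n - d(l)\<^sub>1)\<close> of them, each of mass
  \<open>2 ^ -n\<close>.
\<close>

lemma fair_cylinder:
  assumes l: "l \<in> mor L"
  shows "emeasure fair (cylinder L l) = ennreal ((1 / 2) ^ (deg L l $ 1))"
proof -
  define n where "n = Max (range (\<lambda>i. deg L l $ i))"
  have le: "deg L l \<le> diagonal n" unfolding n_def by (rule le_diagonal_Max)
  let ?q = "diagonal n - deg L l"
  have q: "{m \<in> paths_of_degree L ?q. rng L m = src L l} = paths_of_degree L ?q"
    using l by (auto simp: paths_of_degree_def src_v rng_v)
  have each: "emeasure fair (cylinder L (cmp L l m)) = ennreal ((1 / 2) ^ n)" "cmp L l m \<in> mor L"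
    if m: "m \<in> paths_of_degree L ?q" for m
  proof -
    have mm: "m \<in> mor L" "deg L m = ?q" using m by (auto simp: paths_of_degree_def)
    then have "deg L (cmp L l m) = diagonal n" using vec_le_add_diff[OF le] by (simp add: deg_cmp_flip l)
    moreover show "cmp L l m \<in> mor L" using mm l by (simp add: cmp_mor_flip)
    ultimately obtain gs where "set gs \<subseteq> {f1, f2}" "length gs = n" "cmp L l m = sq gs"
      using sq_surj by blast
    then show "emeasure fair (cylinder L (cmp L l m)) = ennreal ((1 / 2) ^ n)"
      using fair_square_cylinder[of gs] by simp
  qed
  have d: "deg L l $ 1 \<le> n" using le by (simp add: less_eq_vec_def)
  have "emeasure fair (cylinder L l) = emeasure fair (\<Union>m\<in>paths_of_degree L ?q. cylinder L (cmp L l m))"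
    using cylinder_extend(1)[OF l, of ?q] q by simp
  also have "\<dots> = (\<Sum>m\<in>paths_of_degree L ?q. emeasure fair (cylinder L (cmp L l m)))"
    using cylinder_extend(2)[OF l, of ?q] paths_of_degree_count[of ?q] each(2) unfolding q
    by (intro sum_emeasure[symmetric]) (auto intro: cylinder_sets)
  also have "\<dots> = of_nat (2 ^ (n - deg L l $ 1)) * ennreal ((1 / 2) ^ n)"
    using paths_of_degree_count[of ?q] by (simp add: each(1))
  also have "\<dots> = ennreal (2 ^ (n - deg L l $ 1) * (1 / 2) ^ n)"
    by (simp add: ennreal_mult ennreal_of_nat_eq_real_of_nat)
  also have "2 ^ (n - deg L l $ 1) * (1 / 2 :: real) ^ n = (1 / 2) ^ (deg L l $ 1)"
    using d by (simp add: power_one_over power_diff field_simps)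
  finally show ?thesis .
qed

section \<open>The Perron--Frobenius measure is the fair measure\<close>

lemma vertex_matrix_flip: "vertex_matrix L i v v = 2 ^ (axis i 1 $ 1 :: nat)"
proof -
  have "{l \<in> paths_of_degree L (axis i 1). rng L l = v \<and> src L l = v} = paths_of_degree L (axis i 1)"
    by (auto simp: paths_of_degree_def src_v rng_v)
  then show ?thesis using paths_of_degree_count[of "axis i 1"] by (simp add: vertex_matrix_def)
qed

text \<open>
  The vertex matrices are of size one, with entries 2 and 1.
\<close>

lemma vertex_spectral_radius_flip: "vertex_spectral_radius L i = 2 ^ (axis i 1 $ 1 :: nat)"
proof -
  let ?c = "2 ^ (axis i 1 $ 1 :: nat)"
  have "vertex_eigenvalue L i z \<longleftrightarrow> z = ?c" for z
    unfolding vertex_eigenvalue_def vertices_flip by (auto simp: vertex_matrix_flip intro!: exI[of _ "\<lambda>_. 1"])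
  then have "{cmod z |z. vertex_eigenvalue L i z} = {?c}" by (simp add: norm_power)
  then show ?thesis unfolding vertex_spectral_radius_def by simp
qed

lemma pf_vector_flip: "pf_vector L v = 1"
proof -
  have "pf_vector L = (\<lambda>w\<in>{v}. 1)"
    unfolding pf_vector_def vertices_flip
  proof (rule the_equality)
    fix k :: "'a \<Rightarrow> real"
    assume "k \<in> extensional {v} \<and> (\<forall>w\<in>{v}. 0 < k w) \<and> (\<Sum>w\<in>{v}. k w) = 1 \<and>
      (\<forall>i. \<forall>w\<in>{v}. (\<Sum>u\<in>{v}. real (vertex_matrix L i w u) * k u) = vertex_spectral_radius L i * k w)"
    then have "k \<in> extensional {v}" "k v = 1" by simp_all
    then show "k = (\<lambda>w\<in>{v}. 1)" by (intro extensionalityI[of _ "{v}"]) auto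
  qed (simp add: vertex_matrix_flip vertex_spectral_radius_flip)
  then show ?thesis by simp
qed

lemma pf_weight_flip:
  assumes "l \<in> mor L"
  shows "inverse (\<Prod>i\<in>UNIV. vertex_spectral_radius L i ^ (deg L l $ i)) * pf_vector L (src L l) = (1 / 2) ^ (deg L l $ 1)"
  using assms by (simp add: src_v pf_vector_flip vertex_spectral_radius_flip UNIV_2 axis_def power_one_over inverse_eq_divide)

theorem pf_measure_flip: "pf_measure L = fair"
  unfolding pf_measure_def
proof (rule the_equality)
  show "borel_probability L fair \<and> (\<forall>l\<in>mor L. measure fair (cylinder L l) =
      inverse (\<Prod>i\<in>UNIV. vertex_spectral_radius L i ^ (deg L l $ i)) * pf_vector L (src L l))"
    by (simp add: borel_probability_def prob_space_fair pf_weight_flip measure_def fair_cylinder)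
  fix M assume M: "borel_probability L M \<and> (\<forall>l\<in>mor L. measure M (cylinder L l) =
      inverse (\<Prod>i\<in>UNIV. vertex_spectral_radius L i ^ (deg L l $ i)) * pf_vector L (src L l))"
  then interpret prob_space M by (simp add: borel_probability_def)
  show "M = fair"
  proof (rule measure_eqI_square_cylinders)
    fix gs assume gs: "set gs \<subseteq> {f1, f2}"
    then have "measure M (cylinder L (sq gs)) = (1 / 2) ^ length gs"
      using M sq_mor[OF gs] by (simp add: pf_weight_flip)
    then show "emeasure M (cylinder L (sq gs)) = emeasure fair (cylinder L (sq gs))"
      by (simp add: emeasure_eq_measure fair_square_cylinder[OF gs])
  qed (use M in \<open>auto simp: borel_probability_def\<close>)
qed

section \<open>The product measures have densities\<close>

definition factor :: "(nat \<Rightarrow> real) \<Rightarrow> ('a, 2) infpath \<Rightarrow> nat \<Rightarrow> real" where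
  "factor \<gamma> x i = (if edge x i = f1 then 1 + 2 * \<gamma> (Suc i) else 1 - 2 * \<gamma> (Suc i))"

text \<open>
  The density of \<open>\<mu>\<close> with respect to the fair measure: the quotient of the weights
  \<open>1/2 \<plusminus> \<gamma>\<^sub>i\<close> by \<open>1/2\<close>, multiplied over all edges of the path.
\<close>

definition dens :: "(nat \<Rightarrow> real) \<Rightarrow> ('a, 2) infpath \<Rightarrow> real" where
  "dens \<gamma> x = prodinf (factor \<gamma> x)"

text \<open>
  There are countably many finite paths, so the map \<open>x \<mapsto> x(0, q)\<close> is measurable into a countable
  discrete space, and \<open>edge x i\<close> is a function of its value.
\<close>

lemma edge_measurable [measurable]: "(\<lambda>x. edge x i) \<in> path_borel L \<rightarrow>\<^sub>M count_space UNIV"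
proof -
  let ?d = "diagonal (Suc i)"
  have m: "(\<lambda>x. x (0, ?d)) \<in> path_borel L \<rightarrow>\<^sub>M count_space (mor L)"
    unfolding measurable_count_space_eq_countable[OF countable_mor]
  proof (intro conjI ballI)
    show "(\<lambda>x. x (0, ?d)) \<in> space (path_borel L) \<rightarrow> mor L" by (simp add: infinite_path_mor0)
    fix l assume l: "l \<in> mor L"
    have "(\<lambda>x. x (0, ?d)) -` {l} \<inter> space (path_borel L) = (if deg L l = ?d then cylinder L l else {})"
      using infinite_path_deg0 by (auto simp: cylinder_def)
    then show "(\<lambda>x. x (0, ?d)) -` {l} \<inter> space (path_borel L) \<in> sets (path_borel L)"
      using cylinder_sets[OF l] by simp
  qed
  have "(\<lambda>l. (THE gs. set gs \<subseteq> {f1, f2} \<and> l = sq gs) ! i) \<in> count_space (mor L) \<rightarrow>\<^sub>M count_space UNIV" by simp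
  from measurable_compose[OF m this] show ?thesis unfolding edge_def .
qed

lemma factor_measurable [measurable]: "(\<lambda>x. factor \<gamma> x i) \<in> borel_measurable (path_borel L)"
proof -
  have "(\<lambda>g. if g = f1 then 1 + 2 * \<gamma> (Suc i) else 1 - 2 * \<gamma> (Suc i)) \<in> borel_measurable (count_space UNIV)" by simp
  from measurable_compose[OF edge_measurable this] show ?thesis unfolding factor_def .
qed

context
  fixes \<gamma> :: "nat \<Rightarrow> real"
  assumes adm: "admissible \<gamma>"
begin

lemma gamma_lt: "\<bar>\<gamma> (Suc i)\<bar> < 1 / 2"
  using adm by (simp add: admissible_def)

lemma gamma_summable: "summable (\<lambda>i. 2 * \<bar>\<gamma> (Suc i)\<bar>)"
  using adm by (simp add: admissible_def)

lemma factor_pos: "0 < factor \<gamma> x i"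
  using gamma_lt[of i] by (auto simp: factor_def abs_less_iff)

lemma factor_dist: "norm (factor \<gamma> x i - 1) = 2 * \<bar>\<gamma> (Suc i)\<bar>"
  by (simp add: factor_def)

lemma factor_convergent: "convergent_prod (factor \<gamma> x)"
  by (rule abs_convergent_prod_imp_convergent_prod, rule summable_imp_abs_convergent_prod)
     (simp only: factor_dist gamma_summable)

lemma dens_LIMSEQ: "(\<lambda>N. \<Prod>i<N. factor \<gamma> x i) \<longlonglongrightarrow> dens \<gamma> x"
proof -
  have "(\<lambda>N. \<Prod>i<Suc N. factor \<gamma> x i) \<longlonglongrightarrow> dens \<gamma> x"
    using convergent_prod_LIMSEQ[OF factor_convergent, of x] unfolding dens_def lessThan_Suc_atMost .
  then show ?thesis by (rule LIMSEQ_imp_Suc)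
qed

lemma dens_pos: "0 < dens \<gamma> x"
proof -
  have "0 \<le> dens \<gamma> x"
    by (rule LIMSEQ_le_const[OF dens_LIMSEQ]) (auto intro!: prod_nonneg less_imp_le[OF factor_pos])
  moreover have "dens \<gamma> x \<noteq> 0"
    unfolding dens_def by (rule prodinf_nonzero[OF factor_convergent less_imp_neq[OF factor_pos, symmetric]])
  ultimately show ?thesis by simp
qed

lemma partial_dens_bound: "(\<Prod>i<N. factor \<gamma> x i) \<le> exp (\<Sum>i. 2 * \<bar>\<gamma> (Suc i)\<bar>)"
proof -
  have "(\<Prod>i<N. factor \<gamma> x i) \<le> (\<Prod>i<N. exp (2 * \<bar>\<gamma> (Suc i)\<bar>))"
  proof (rule prod_mono, intro conjI)
    fix i
    show "0 \<le> factor \<gamma> x i" using factor_pos less_imp_le by blast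
    have "factor \<gamma> x i \<le> 1 + 2 * \<bar>\<gamma> (Suc i)\<bar>" using factor_dist[of x i] by simp
    also have "\<dots> \<le> exp (2 * \<bar>\<gamma> (Suc i)\<bar>)" by (rule exp_ge_add_one_self)
    finally show "factor \<gamma> x i \<le> exp (2 * \<bar>\<gamma> (Suc i)\<bar>)" .
  qed
  also have "\<dots> = exp (\<Sum>i<N. 2 * \<bar>\<gamma> (Suc i)\<bar>)" by (simp add: exp_sum)
  also have "\<dots> \<le> exp (\<Sum>i. 2 * \<bar>\<gamma> (Suc i)\<bar>)"
    using gamma_summable by (intro exp_le_cancel_iff[THEN iffD2] sum_le_suminf) auto
  finally show ?thesis .
qed

lemma dens_measurable [measurable]: "dens \<gamma> \<in> borel_measurable (path_borel L)"
  by (rule borel_measurable_LIMSEQ_real[OF dens_LIMSEQ]) measurable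

definition weight :: "'a list \<Rightarrow> real" where
  "weight gs = (\<Prod>i<length gs. if gs ! i = f1 then 1 / 2 + \<gamma> (Suc i) else 1 / 2 - \<gamma> (Suc i))"

lemma weight_snoc:
  "weight (gs @ [f1]) + weight (gs @ [f2]) = weight gs"
proof -
  have "weight (gs @ [g]) = weight gs * (if g = f1 then 1 / 2 + \<gamma> (Suc (length gs)) else 1 / 2 - \<gamma> (Suc (length gs)))" for g
    unfolding weight_def by (simp add: nth_append)
  then show ?thesis using f1_neq_f2 by (simp add: algebra_simps)
qed

lemma integrable_partial_dens: "integrable fair (\<lambda>x. indicator A x * (\<Prod>i<N. factor \<gamma> x i))"
  if [measurable]: "A \<in> sets (path_borel L)"
proof -
  interpret prob_space fair by (rule prob_space_fair)
  have "\<bar>\<Prod>i<N. factor \<gamma> x i\<bar> \<le> exp (\<Sum>i. 2 * \<bar>\<gamma> (Suc i)\<bar>)" for x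
    using partial_dens_bound[where x = x and N = N] factor_pos
    by (simp add: prod_nonneg less_imp_le abs_of_nonneg)
  then have b: "\<bar>indicator A x * (\<Prod>i<N. factor \<gamma> x i)\<bar> \<le> exp (\<Sum>i. 2 * \<bar>\<gamma> (Suc i)\<bar>)" for x
    by (simp add: indicator_def)
  show ?thesis
  proof (rule integrable_const_bound[of _ "exp (\<Sum>i. 2 * \<bar>\<gamma> (Suc i)\<bar>)"])
    show "AE x in fair. norm (indicator A x * (\<Prod>i<N. factor \<gamma> x i)) \<le> exp (\<Sum>i. 2 * \<bar>\<gamma> (Suc i)\<bar>)"
      using b by simp
  qed measurable
qed

text \<open>
  Induction on the number \<open>k\<close> of surplus factors.  Without surplus factors the product is constant on
  the cylinder set; a surplus factor integrates to 1 because the weights of the two continuations add up to 1.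
\<close>

lemma integral_partial_dens:
  assumes gs: "set gs \<subseteq> {f1, f2}"
  shows "(\<integral>x. indicator (cylinder L (sq gs)) x * (\<Prod>i<length gs + k. factor \<gamma> x i) \<partial>fair) = weight gs"
  using gs
proof (induction k arbitrary: gs)
  case 0
  have "indicator (cylinder L (sq gs)) x * (\<Prod>i<length gs + 0. factor \<gamma> x i) =
      indicator (cylinder L (sq gs)) x * (2 ^ length gs * weight gs)" for x
  proof (cases "x \<in> cylinder L (sq gs)")
    case True
    then have "(\<Prod>i<length gs. factor \<gamma> x i) =
        (\<Prod>i<length gs. 2 * (if gs ! i = f1 then 1 / 2 + \<gamma> (Suc i) else 1 / 2 - \<gamma> (Suc i)))"
      by (intro prod.cong) (auto simp: mem_square_cylinder_iff[OF 0] factor_def)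
    also have "\<dots> = 2 ^ length gs * weight gs" unfolding weight_def prod.distrib by simp
    finally show ?thesis by simp
  qed simp
  then have "(\<integral>x. indicator (cylinder L (sq gs)) x * (\<Prod>i<length gs + 0. factor \<gamma> x i) \<partial>fair)
      = measure fair (cylinder L (sq gs)) * (2 ^ length gs * weight gs)"
    using cylinder_subset by (simp only:) (simp add: Int_absorb2)
  also have "measure fair (cylinder L (sq gs)) = (1 / 2) ^ length gs"
    by (simp add: measure_def fair_square_cylinder[OF 0])
  finally show ?case by (simp add: power_one_over)
next
  case (Suc k)
  have s: "set (gs @ [f1]) \<subseteq> {f1, f2}" "set (gs @ [f2]) \<subseteq> {f1, f2}" using Suc.prems by auto
  have m: "cylinder L (sq hs) \<in> sets (path_borel L)" if "set hs \<subseteq> {f1, f2}" for hs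
    using sq_mor[OF that] by (intro cylinder_sets) simp
  have "indicator (cylinder L (sq gs)) x * (\<Prod>i<length gs + Suc k. factor \<gamma> x i) =
      indicator (cylinder L (sq (gs @ [f1]))) x * (\<Prod>i<length (gs @ [f1]) + k. factor \<gamma> x i) +
      indicator (cylinder L (sq (gs @ [f2]))) x * (\<Prod>i<length (gs @ [f2]) + k. factor \<gamma> x i)" for x
  proof -
    have "indicator (cylinder L (sq gs)) x =
        indicator (cylinder L (sq (gs @ [f1]))) x + (indicator (cylinder L (sq (gs @ [f2]))) x :: real)"
      using square_cylinder_split[OF Suc.prems] by (auto simp: indicator_def)
    then show ?thesis by (simp only: length_append list.size distrib_right) simp
  qed
  then have "(\<integral>x. indicator (cylinder L (sq gs)) x * (\<Prod>i<length gs + Suc k. factor \<gamma> x i) \<partial>fair) =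
      weight (gs @ [f1]) + weight (gs @ [f2])"
    unfolding Suc.IH[OF s(1), symmetric] Suc.IH[OF s(2), symmetric]
    using Bochner_Integration.integral_add[OF integrable_partial_dens[OF m[OF s(1)]] integrable_partial_dens[OF m[OF s(2)]]]
    by (simp only:)
  then show ?case by (simp add: weight_snoc)
qed

lemma dens_bound: "dens \<gamma> x \<le> exp (\<Sum>i. 2 * \<bar>\<gamma> (Suc i)\<bar>)"
  by (rule LIMSEQ_le_const2[OF dens_LIMSEQ]) (use partial_dens_bound in blast)

lemma integrable_dens:
  assumes [measurable]: "A \<in> sets (path_borel L)"
  shows "integrable fair (\<lambda>x. indicator A x * dens \<gamma> x)"
proof -
  interpret prob_space fair by (rule prob_space_fair)
  have b: "\<bar>indicator A x * dens \<gamma> x\<bar> \<le> exp (\<Sum>i. 2 * \<bar>\<gamma> (Suc i)\<bar>)" for x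
    using dens_bound[of x] dens_pos[of x] by (simp add: indicator_def)
  show ?thesis
    by (rule integrable_const_bound[of _ "exp (\<Sum>i. 2 * \<bar>\<gamma> (Suc i)\<bar>)"]) (use b in simp, measurable)
qed

text \<open>
  The integrals of the partial products are eventually constant, and the partial products are
  uniformly bounded.
\<close>

lemma integral_dens:
  assumes gs: "set gs \<subseteq> {f1, f2}"
  shows "(\<integral>x. indicator (cylinder L (sq gs)) x * dens \<gamma> x \<partial>fair) = weight gs"
proof -
  interpret prob_space fair by (rule prob_space_fair)
  let ?C = "exp (\<Sum>i. 2 * \<bar>\<gamma> (Suc i)\<bar>)"
  have [measurable]: "cylinder L (sq gs) \<in> sets (path_borel L)"
    using sq_mor[OF gs] by (intro cylinder_sets) simp
  have "(\<lambda>k. \<integral>x. indicator (cylinder L (sq gs)) x * (\<Prod>i<length gs + k. factor \<gamma> x i) \<partial>fair)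
      \<longlonglongrightarrow> (\<integral>x. indicator (cylinder L (sq gs)) x * dens \<gamma> x \<partial>fair)"
  proof (rule integral_dominated_convergence[of _ _ _ "\<lambda>_. ?C"])
    show "AE x in fair. (\<lambda>k. indicator (cylinder L (sq gs)) x * (\<Prod>i<length gs + k. factor \<gamma> x i))
        \<longlonglongrightarrow> indicator (cylinder L (sq gs)) x * dens \<gamma> x"
    proof (rule AE_I2, rule tendsto_mult_left)
      fix x
      show "(\<lambda>k. \<Prod>i<length gs + k. factor \<gamma> x i) \<longlonglongrightarrow> dens \<gamma> x"
        using LIMSEQ_ignore_initial_segment[OF dens_LIMSEQ, of x "length gs"] by (simp add: add.commute)
    qed
    fix k
    have "\<bar>\<Prod>i<length gs + k. factor \<gamma> x i\<bar> \<le> ?C" for x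
      using partial_dens_bound[where x = x and N = "length gs + k"] factor_pos
      by (simp add: prod_nonneg less_imp_le abs_of_nonneg)
    then show "AE x in fair. norm (indicator (cylinder L (sq gs)) x * (\<Prod>i<length gs + k. factor \<gamma> x i)) \<le> ?C"
      by (intro AE_I2) (simp add: indicator_def)
    show "(\<lambda>x. indicator (cylinder L (sq gs)) x * (\<Prod>i<length gs + k. factor \<gamma> x i)) \<in> borel_measurable fair"
      by (rule borel_measurable_integrable[OF integrable_partial_dens]) measurable
  next
    show "(\<lambda>x. indicator (cylinder L (sq gs)) x * dens \<gamma> x) \<in> borel_measurable fair"
      by (rule borel_measurable_integrable[OF integrable_dens]) measurable
  qed simp
  then show ?thesis unfolding integral_partial_dens[OF gs] by (simp add: LIMSEQ_const_iff)
qed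

lemma density_square_cylinder:
  assumes gs: "set gs \<subseteq> {f1, f2}"
  shows "emeasure (density fair (\<lambda>x. ennreal (dens \<gamma> x))) (cylinder L (sq gs)) = ennreal (weight gs)"
proof -
  have c [measurable]: "cylinder L (sq gs) \<in> sets (path_borel L)"
    using sq_mor[OF gs] by (intro cylinder_sets) simp
  have "emeasure (density fair (\<lambda>x. ennreal (dens \<gamma> x))) (cylinder L (sq gs))
      = (\<integral>\<^sup>+x. ennreal (indicator (cylinder L (sq gs)) x * dens \<gamma> x) \<partial>fair)"
    by (subst emeasure_density) (auto intro!: nn_integral_cong simp: indicator_def)
  also have "\<dots> = ennreal (\<integral>x. indicator (cylinder L (sq gs)) x * dens \<gamma> x \<partial>fair)"
    by (intro nn_integral_eq_integral integrable_dens c AE_I2) (simp add: less_imp_le[OF dens_pos])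
  finally show ?thesis by (simp add: integral_dens[OF gs])
qed

text \<open>
  Part (a) up to the statement on the standard maps: the weights determine \<open>\<mu>\<close>, and the density
  gives its existence.
\<close>

theorem extends_square_weights_iff:
  "extends_square_weights L v f1 f2 e \<gamma> \<mu> \<longleftrightarrow> \<mu> = density fair (\<lambda>x. ennreal (dens \<gamma> x))"
proof
  let ?d = "density fair (\<lambda>x. ennreal (dens \<gamma> x))"
  have w: "0 \<le> weight gs" for gs
    unfolding weight_def
  proof (rule prod_nonneg)
    fix i show "0 \<le> (if gs ! i = f1 then 1 / 2 + \<gamma> (Suc i) else 1 / 2 - \<gamma> (Suc i))"
      using gamma_lt[of i] by (auto simp: abs_less_iff)
  qed
  have d: "extends_square_weights L v f1 f2 e \<gamma> ?d"
    unfolding extends_square_weights_def borel_probability_def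
  proof (intro conjI allI impI)
    show "prob_space ?d"
      by (rule prob_spaceI) (use density_square_cylinder[of "[]"] in \<open>simp add: sq_Nil cylinder_v weight_def\<close>)
    show "sets ?d = sets (path_borel L)" by simp
    fix gs assume "set gs \<subseteq> {f1, f2}"
    then show "measure ?d (cylinder L (sq gs)) = (\<Prod>i<length gs. if gs ! i = f1 then 1 / 2 + \<gamma> (Suc i) else 1 / 2 - \<gamma> (Suc i))"
      using density_square_cylinder[of gs] w[of gs] by (simp add: measure_def weight_def)
  qed
  show "\<mu> = ?d" if m: "extends_square_weights L v f1 f2 e \<gamma> \<mu>"
  proof (rule measure_eqI_square_cylinders)
    interpret prob_space \<mu> using m by (simp add: extends_square_weights_def borel_probability_def)
    show "emeasure \<mu> (infinite_paths L) \<noteq> \<infinity>" by simp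
    fix gs assume gs: "set gs \<subseteq> {f1, f2}"
    then have "measure \<mu> (cylinder L (sq gs)) = weight gs"
      using m by (simp add: extends_square_weights_def weight_def)
    then show "emeasure \<mu> (cylinder L (sq gs)) = emeasure ?d (cylinder L (sq gs))"
      by (simp add: density_square_cylinder[OF gs] emeasure_eq_measure)
  qed (use m in \<open>auto simp: extends_square_weights_def borel_probability_def\<close>)
  show "extends_square_weights L v f1 f2 e \<gamma> \<mu>" if "\<mu> = ?d" using d that by simp
qed

end

end

section \<open>Scaling of the fair measure\<close>

lemma restrict_space_space: "restrict_space M (space M) = M"
proof (rule measure_eqI)
  show s: "sets (restrict_space M (space M)) = sets M"
    using sets.Int_space_eq1[of _ M] by (auto simp: sets_restrict_space image_iff)
  show "emeasure (restrict_space M (space M)) A = emeasure M A" if "A \<in> sets (restrict_space M (space M))" for A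
    using that sets.sets_into_space[of A M] unfolding s by (intro emeasure_restrict_space) auto
qed

context flip
begin

lemma standard_domain_flip: "l \<in> mor L \<Longrightarrow> standard_domain L l = infinite_paths L"
  by (simp add: standard_domain_def src_v cylinder_v)

abbreviation cyl_mass :: "'a \<Rightarrow> real" where
  "cyl_mass l \<equiv> (1 / 2) ^ (deg L l $ 1)"

text \<open>
  Self-similarity of the fair measure: the shift maps its restriction to \<open>Z(l)\<close> to a constant multiple of
  it, since \<open>Z(l\<nu>)\<close> has \<open>2 ^ -d(l)\<^sub>1\<close> times the mass of \<open>Z(\<nu>)\<close>.
\<close>

lemma distr_shift_fair:
  assumes l: "l \<in> mor L"
  shows "distr (restrict_space fair (cylinder L l)) (path_borel L) (path_shift (deg L l))
    = density fair (\<lambda>_. ennreal (cyl_mass l))"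
proof (rule measure_eqI_square_cylinders)
  let ?R = "restrict_space fair (cylinder L l)" and ?T = "path_shift (deg L l)"
  have c: "cylinder L l \<in> sets fair" using cylinder_sets[OF l] by simp
  have T: "?T \<in> ?R \<rightarrow>\<^sub>M path_borel L" by (rule measurable_restrict_space1) simp
  have e: "emeasure (distr ?R (path_borel L) ?T) A = emeasure fair (cylinder L l \<inter> ?T -` A)"
    if A: "A \<in> sets (path_borel L)" for A
  proof -
    have "?T -` A \<inter> space ?R = cylinder L l \<inter> ?T -` A"
      using cylinder_subset by (auto simp: space_restrict_space)
    then show ?thesis unfolding emeasure_distr[OF T A]
      using c sets.Int_space_eq2[OF c] by (simp only:) (rule emeasure_restrict_space, auto)
  qed
  have "emeasure (distr ?R (path_borel L) ?T) (infinite_paths L) \<le> emeasure fair (space fair)"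
    using sets.top[of "path_borel L"] by (subst e) (simp_all add: emeasure_space[of fair, simplified])
  then show "emeasure (distr ?R (path_borel L) ?T) (infinite_paths L) \<noteq> \<infinity>"
    using prob_space.emeasure_space_1[OF prob_space_fair] by (auto simp: top_unique)
  fix gs assume gs: "set gs \<subseteq> {f1, f2}"
  have g: "sq gs \<in> mor L" using sq_mor[OF gs] by simp
  have "cylinder L l \<inter> ?T -` cylinder L (sq gs) = cylinder L (cmp L l (sq gs))"
    using cylinder_cmp_iff[OF l g] by (auto simp: src_v rng_v l g)
  then show "emeasure (distr ?R (path_borel L) ?T) (cylinder L (sq gs))
      = emeasure (density fair (\<lambda>_. ennreal (cyl_mass l))) (cylinder L (sq gs))"
    using cylinder_sets[OF g] l g
    by (simp add: e emeasure_density_const fair_cylinder cmp_mor_flip deg_cmp_flip power_add ennreal_mult)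
qed simp_all

lemma nn_integral_shift_fair:
  assumes l: "l \<in> mor L" and F [measurable]: "F \<in> borel_measurable (path_borel L)"
  shows "(\<integral>\<^sup>+x. F (path_shift (deg L l) x) * indicator (cylinder L l) x \<partial>fair) = ennreal (cyl_mass l) * (\<integral>\<^sup>+x. F x \<partial>fair)"
proof -
  let ?R = "restrict_space fair (cylinder L l)" and ?T = "path_shift (deg L l)"
  have T: "?T \<in> ?R \<rightarrow>\<^sub>M path_borel L" by (rule measurable_restrict_space1) simp
  have "(\<integral>\<^sup>+x. F x \<partial>distr ?R (path_borel L) ?T) = (\<integral>\<^sup>+x. F (?T x) \<partial>?R)"
    by (rule nn_integral_distr[OF T]) simp
  also have "\<dots> = (\<integral>\<^sup>+x. F (?T x) * indicator (cylinder L l) x \<partial>fair)"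
    using cylinder_sets[OF l] cylinder_subset[of l] by (intro nn_integral_restrict_space) (simp add: Int_absorb2)
  finally show ?thesis
    unfolding distr_shift_fair[OF l] by (simp add: nn_integral_density nn_integral_cmult)
qed

lemma integral_shift_fair:
  fixes F :: "('a, 2) infpath \<Rightarrow> complex"
  assumes l: "l \<in> mor L" and F [measurable]: "F \<in> borel_measurable (path_borel L)"
  shows "(\<integral>x. indicator (cylinder L l) x * F (path_shift (deg L l) x) \<partial>fair) = cyl_mass l * (\<integral>x. F x \<partial>fair)"
proof -
  let ?R = "restrict_space fair (cylinder L l)" and ?T = "path_shift (deg L l)"
  have T: "?T \<in> ?R \<rightarrow>\<^sub>M path_borel L" by (rule measurable_restrict_space1) simp
  have "(\<integral>x. F x \<partial>distr ?R (path_borel L) ?T) = (\<integral>x. F (?T x) \<partial>?R)"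
    by (rule integral_distr[OF T]) simp
  also have "\<dots> = (\<integral>x. indicator (cylinder L l) x *\<^sub>R F (?T x) \<partial>fair)"
    using cylinder_sets[OF l] cylinder_subset[of l] by (intro integral_restrict_space) (simp add: Int_absorb2)
  also have "\<dots> = (\<integral>x. indicator (cylinder L l) x * F (?T x) \<partial>fair)"
    by (rule Bochner_Integration.integral_cong) (auto simp: indicator_def)
  finally show ?thesis
    unfolding distr_shift_fair[OF l] by (simp add: integral_density scaleR_conv_of_real)
qed

text \<open>
  By the scaling, the part in \<open>Z(l)\<close> of the preimage of a null set under the shift is a null set.  This makes
  operators of composition with the shift well defined on classes of functions.
\<close>

lemma AE_shift_fair:
  assumes l: "l \<in> mor L" and P: "AE x in fair. P x"
  shows "AE x in fair. x \<in> cylinder L l \<longrightarrow> P (path_shift (deg L l) x)"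
proof -
  obtain N where N: "{x \<in> space fair. \<not> P x} \<subseteq> N" "emeasure fair N = 0" "N \<in> sets fair"
    using AE_E[OF P] by blast
  have [measurable]: "N \<in> sets (path_borel L)" using N(3) by simp
  have "(\<integral>\<^sup>+x. indicator N (path_shift (deg L l) x) * indicator (cylinder L l) x \<partial>fair) = 0"
    using N by (subst nn_integral_shift_fair[OF l]) simp_all
  then have "AE x in fair. indicator N (path_shift (deg L l) x) * indicator (cylinder L l) x = (0 :: ennreal)"
    using l by (subst (asm) nn_integral_0_iff_AE) simp_all
  then show ?thesis
  proof (rule AE_mp, intro AE_I2 impI)
    fix x assume "indicator N (path_shift (deg L l) x) * indicator (cylinder L l) x = (0 :: ennreal)" "x \<in> cylinder L l"
    then have "path_shift (deg L l) x \<notin> N" by (auto simp: indicator_def split: if_splits)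
    moreover have "path_shift (deg L l) x \<in> space fair"
      using \<open>x \<in> cylinder L l\<close> path_shift_infinite_path by (simp add: cylinder_def)
    ultimately show "P (path_shift (deg L l) x)" using N(1) by blast
  qed
qed

end

section \<open>The standard maps for a measure with positive density\<close>

text \<open>
  Both the product measures and (with \<open>D = 1\<close>) the Perron--Frobenius measure are of this form.
  Positivity everywhere makes almost everywhere statements for \<open>\<mu>\<close> and for the fair measure equivalent.
\<close>

locale flip_density = flip L v f1 f2 e for L :: "('a, 2) kgraph_data" and v f1 f2 e +
  fixes D :: "('a, 2) infpath \<Rightarrow> real"
  assumes D_measurable [measurable]: "D \<in> borel_measurable (path_borel L)"
    and D_pos: "0 < D x"
    and prob_density: "prob_space (density fair (\<lambda>x. ennreal (D x)))"
begin

definition \<mu> :: "('a, 2) infpath measure" where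
  "\<mu> = density fair (\<lambda>x. ennreal (D x))"

lemma sets_\<mu> [simp, measurable_cong]: "sets \<mu> = sets (path_borel L)"
  by (simp add: \<mu>_def)

lemma space_\<mu> [simp]: "space \<mu> = infinite_paths L"
  by (simp add: \<mu>_def)

lemma prob_space_\<mu>: "prob_space \<mu>"
  using prob_density by (simp add: \<mu>_def)

lemma AE_\<mu>_iff: "(AE x in \<mu>. P x) \<longleftrightarrow> (AE x in fair. P x)"
  unfolding \<mu>_def by (subst AE_density) (simp_all add: D_pos)

lemma equivalent_\<mu>_fair: "equivalent_measures \<mu> fair"
proof -
  have "A \<in> null_sets \<mu> \<longleftrightarrow> A \<in> null_sets fair" for A
  proof (cases "A \<in> sets (path_borel L)")
    case True
    then show ?thesis using AE_iff_null_sets[of A \<mu>] AE_iff_null_sets[of A fair] by (simp add: AE_\<mu>_iff)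
  qed (auto simp: null_sets_def)
  then have "null_sets \<mu> = null_sets fair" by blast
  then show ?thesis by (simp add: equivalent_measures_def absolutely_continuous_def)
qed

text \<open>
  The Radon--Nikodym derivative of \<open>\<mu> \<circ> \<sigma>\<^sub>l\<close>: the scaling factor of the fair measure, corrected by
  the densities at image and argument.
\<close>

definition jacobian :: "'a \<Rightarrow> ('a, 2) infpath \<Rightarrow> real" where
  "jacobian l x = cyl_mass l * D (prefixing L l x) / D x"

lemma jacobian_pos: "0 < jacobian l x"
  by (simp add: jacobian_def D_pos)

lemma jacobian_measurable:
  assumes [measurable]: "l \<in> mor L"
  shows "jacobian l \<in> borel_measurable (path_borel L)"
  unfolding jacobian_def by measurable

lemma emeasure_prefixing_image:
  assumes l [measurable]: "l \<in> mor L" and A [measurable]: "A \<in> sets (path_borel L)"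
  shows "prefixing L l ` A \<in> sets (path_borel L)"
    "emeasure \<mu> (prefixing L l ` A) = emeasure (density \<mu> (\<lambda>x. ennreal (jacobian l x))) A"
proof -
  have As: "A \<subseteq> infinite_paths L" using sets.sets_into_space[OF A] by simp
  have im: "prefixing L l ` A = cylinder L l \<inter> path_shift (deg L l) -` A"
    by (rule prefixing_image[OF l As])
  have "cylinder L l \<inter> path_shift (deg L l) -` A = cylinder L l \<inter> (path_shift (deg L l) -` A \<inter> space (path_borel L))"
    using cylinder_subset by auto
  then show S: "prefixing L l ` A \<in> sets (path_borel L)"
    unfolding im using measurable_sets[OF path_shift_measurable A] cylinder_sets[OF l] by auto
  have "emeasure \<mu> (prefixing L l ` A) = (\<integral>\<^sup>+x. ennreal (D x) * indicator (prefixing L l ` A) x \<partial>fair)"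
    unfolding \<mu>_def using S by (intro emeasure_density) simp_all
  also have "\<dots> = (\<integral>\<^sup>+x. (ennreal (D (prefixing L l (path_shift (deg L l) x))) * indicator A (path_shift (deg L l) x))
      * indicator (cylinder L l) x \<partial>fair)"
    unfolding im by (rule nn_integral_cong) (auto simp: indicator_def prefixing_eqI[OF l])
  also have "\<dots> = ennreal (cyl_mass l) * (\<integral>\<^sup>+x. ennreal (D (prefixing L l x)) * indicator A x \<partial>fair)"
    by (rule nn_integral_shift_fair[OF l, of "\<lambda>x. ennreal (D (prefixing L l x)) * indicator A x"]) measurable
  also have "\<dots> = (\<integral>\<^sup>+x. ennreal (cyl_mass l) * (ennreal (D (prefixing L l x)) * indicator A x) \<partial>fair)"
    by (rule nn_integral_cmult[symmetric]) measurable
  also have "\<dots> = (\<integral>\<^sup>+x. ennreal (D x) * (ennreal (jacobian l x) * indicator A x) \<partial>fair)"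
  proof (rule nn_integral_cong)
    fix x
    have "ennreal (D x) * ennreal (jacobian l x) = ennreal (cyl_mass l) * ennreal (D (prefixing L l x))"
      using D_pos[of x] D_pos[of "prefixing L l x"] by (simp add: jacobian_def flip: ennreal_mult)
    then show "ennreal (cyl_mass l) * (ennreal (D (prefixing L l x)) * indicator A x)
        = ennreal (D x) * (ennreal (jacobian l x) * indicator A x)"
      by (simp add: mult.assoc[symmetric])
  qed
  also have "\<dots> = (\<integral>\<^sup>+x. ennreal (jacobian l x) * indicator A x \<partial>\<mu>)"
    unfolding \<mu>_def using jacobian_measurable[OF l] by (subst nn_integral_density) simp_all
  also have "\<dots> = emeasure (density \<mu> (\<lambda>x. ennreal (jacobian l x))) A"
    using jacobian_measurable[OF l] by (intro emeasure_density[symmetric]) simp_all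
  finally show "emeasure \<mu> (prefixing L l ` A) = emeasure (density \<mu> (\<lambda>x. ennreal (jacobian l x))) A" .
qed

text \<open>
  The set function \<open>A \<mapsto> \<mu> (\<sigma>\<^sub>l A)\<close> agrees on measurable sets with a measure given by a density, so it
  is a measure and its derivative can be read off.
\<close>

lemma measure_comp_prefixing:
  assumes l: "l \<in> mor L"
  shows "measure_comp \<mu> (infinite_paths L) (prefixing L l) = density \<mu> (\<lambda>x. ennreal (jacobian l x))"
    "measure_space (infinite_paths L) (sets \<mu>) (\<lambda>A. emeasure \<mu> (prefixing L l ` A))"
proof -
  let ?N = "density \<mu> (\<lambda>x. ennreal (jacobian l x))"
  have sub: "sets \<mu> \<subseteq> Pow (infinite_paths L)" using sets.space_closed[of \<mu>] by simp
  have sig: "sigma_sets (infinite_paths L) (sets \<mu>) = sets \<mu>" using sets.sigma_sets_eq[of \<mu>] by simp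
  have eq: "emeasure \<mu> (prefixing L l ` A) = emeasure ?N A" if "A \<in> sigma_sets (infinite_paths L) (sets \<mu>)" for A
    using that emeasure_prefixing_image(2)[OF l] unfolding sig by simp
  have R: "restrict_space \<mu> (infinite_paths L) = \<mu>" using restrict_space_space[of \<mu>] by simp
  have "measure_comp \<mu> (infinite_paths L) (prefixing L l) = measure_of (infinite_paths L) (sets \<mu>) (emeasure ?N)"
    unfolding measure_comp_def R by (rule measure_of_eq[OF sub eq])
  also have "\<dots> = measure_of (space ?N) (sets ?N) (emeasure ?N)" by simp
  also have "\<dots> = ?N" by (rule measure_of_of_measure)
  finally show "measure_comp \<mu> (infinite_paths L) (prefixing L l) = ?N" .
  have "measure_space (space ?N) (sets ?N) (emeasure ?N)" by (rule measure_space)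
  then have "measure_space (infinite_paths L) (sets \<mu>) (emeasure ?N)" by simp
  moreover have "measure_space (infinite_paths L) (sigma_sets (infinite_paths L) (sets \<mu>)) (\<lambda>A. emeasure \<mu> (prefixing L l ` A))
      = measure_space (infinite_paths L) (sigma_sets (infinite_paths L) (sets \<mu>)) (emeasure ?N)"
    by (rule measure_space_eq[OF sub]) (rule eq)
  ultimately show "measure_space (infinite_paths L) (sets \<mu>) (\<lambda>A. emeasure \<mu> (prefixing L l ` A))"
    by (simp only: sig)
qed

lemma Phi_measurable: "Phi \<mu> (infinite_paths L) f \<in> borel_measurable (path_borel L)"
proof -
  have R: "restrict_space \<mu> (infinite_paths L) = \<mu>" using restrict_space_space[of \<mu>] by simp
  have "RN_deriv \<mu> (measure_comp \<mu> (infinite_paths L) f) \<in> borel_measurable \<mu>" by measurable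
  then show ?thesis unfolding Phi_def R by simp
qed

lemma Phi_prefixing:
  assumes l: "l \<in> mor L"
  shows "AE x in \<mu>. Phi \<mu> (infinite_paths L) (prefixing L l) x = ennreal (jacobian l x)"
proof -
  interpret prob_space \<mu> by (rule prob_space_\<mu>)
  have R: "restrict_space \<mu> (infinite_paths L) = \<mu>" using restrict_space_space[of \<mu>] by simp
  have "AE x in \<mu>. ennreal (jacobian l x) = RN_deriv \<mu> (measure_comp \<mu> (infinite_paths L) (prefixing L l)) x"
    using jacobian_measurable[OF l] by (intro RN_deriv_unique) (simp_all add: measure_comp_prefixing[OF l])
  then show ?thesis unfolding Phi_def R by eventually_elim simp
qed

lemma semibranching_map_prefixing:
  assumes l: "l \<in> mor L"
  shows "semibranching_map \<mu> (infinite_paths L) (prefixing L l)"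
  unfolding semibranching_map_def
proof (intro conjI)
  have R: "restrict_space \<mu> (infinite_paths L) = \<mu>" using restrict_space_space[of \<mu>] by simp
  show "infinite_paths L \<in> sets \<mu>" using sets.top[of \<mu>] by simp
  show "prefixing L l \<in> restrict_space \<mu> (infinite_paths L) \<rightarrow>\<^sub>M \<mu>"
    unfolding R using prefixing_measurable[OF l] by simp
  show "\<forall>A\<in>sets (restrict_space \<mu> (infinite_paths L)). prefixing L l ` A \<in> sets \<mu>"
    unfolding R using emeasure_prefixing_image(1)[OF l] by simp
  show "measure_space (infinite_paths L) (sets (restrict_space \<mu> (infinite_paths L))) (\<lambda>A. emeasure \<mu> (prefixing L l ` A))"
    unfolding R by (rule measure_comp_prefixing(2)[OF l])
  show "absolutely_continuous (restrict_space \<mu> (infinite_paths L)) (measure_comp \<mu> (infinite_paths L) (prefixing L l))"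
    unfolding R measure_comp_prefixing(1)[OF l]
    by (rule absolutely_continuousI_density) (use jacobian_measurable[OF l] in simp)
  show "AE x in restrict_space \<mu> (infinite_paths L). 0 < Phi \<mu> (infinite_paths L) (prefixing L l) x"
    unfolding R using Phi_prefixing[OF l] by eventually_elim (simp add: jacobian_pos)
qed

lemma prefixing_range: "l \<in> mor L \<Longrightarrow> prefixing L l ` infinite_paths L = cylinder L l"
  using prefixing_image[of l "infinite_paths L"] path_shift_infinite_path cylinder_subset[of l] by blast

text \<open>
  All set-theoretic clauses hold exactly: the ranges are the cylinder sets, which partition the path
  space for each degree, and every domain is the whole path space.
\<close>

theorem standard_system_\<mu>: "standard_system L \<mu>"
  unfolding graph_semibranching_system_def semibranching_system_def coding_map_def
proof (intro conjI allI ballI impI)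
  fix m :: "nat ^ 2"
  show "finite (paths_of_degree L m)" using paths_of_degree_count by blast
  show "path_shift m \<in> \<mu> \<rightarrow>\<^sub>M \<mu>" using path_shift_measurable by simp
  fix l assume "l \<in> paths_of_degree L m"
  then have l: "l \<in> mor L" "deg L l = m" by (simp_all add: paths_of_degree_def)
  show "semibranching_map \<mu> (standard_domain L l) (prefixing L l)"
    unfolding standard_domain_flip[OF l(1)] by (rule semibranching_map_prefixing[OF l(1)])
  show "path_shift m (prefixing L l x) = x" if "x \<in> standard_domain L l" for x
    using that prefixing_flip(2)[OF l(1)] l(2) by (simp add: standard_domain_flip[OF l(1)])
  show "prefixing L l ` standard_domain L l \<inter> prefixing L k ` standard_domain L k \<in> null_sets \<mu>"
    if "k \<in> paths_of_degree L m" "l \<noteq> k" for k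
  proof -
    have k: "k \<in> mor L" "deg L k = m" using that by (simp_all add: paths_of_degree_def)
    have "cylinder L l \<inter> cylinder L k = {}" using l(2) k(2) that(2) by (auto simp: cylinder_def)
    then show ?thesis by (simp add: standard_domain_flip l k prefixing_range)
  qed
next
  fix m :: "nat ^ 2"
  have "x \<in> (\<Union>l\<in>paths_of_degree L m. prefixing L l ` standard_domain L l)" if x: "x \<in> infinite_paths L" for x
  proof -
    have m: "x (0, m) \<in> mor L" "deg L (x (0, m)) = m" using infinite_path_mor0[OF x] infinite_path_deg0[OF x] .
    then have "x \<in> prefixing L (x (0, m)) ` standard_domain L (x (0, m))"
      using x by (simp add: standard_domain_flip prefixing_range) (simp add: cylinder_def)
    then show ?thesis using m by (auto simp: paths_of_degree_def)
  qed
  then have e: "space \<mu> - (\<Union>l\<in>paths_of_degree L m. prefixing L l ` standard_domain L l) = {}" by auto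
  show "space \<mu> - (\<Union>l\<in>paths_of_degree L m. prefixing L l ` standard_domain L l) \<in> null_sets \<mu>"
    unfolding e by simp
next
  fix w assume "w \<in> vertices L"
  then have w: "w = v" by (simp add: vertices_flip)
  have dom: "standard_domain L v = infinite_paths L" by (rule standard_domain_flip[OF v_mor(1)])
  show "prefixing L w x = x" if "x \<in> standard_domain L w" for x
  proof -
    have x: "x \<in> infinite_paths L" using that w dom by simp
    then show ?thesis using prefixing_flip(2)[OF v_mor(1) x] prefixing_flip(3)[OF v_mor(1) x]
      by (simp add: v_mor w path_shift_0)
  qed
  show "0 < emeasure \<mu> (standard_domain L w)"
    unfolding w dom using prob_space.emeasure_space_1[OF prob_space_\<mu>] by simp
next
  fix l n assume l: "l \<in> mor L" and n: "n \<in> mor L" and s: "src L l = rng L n"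
  have ln: "cmp L l n \<in> mor L" using l n by (rule cmp_mor_flip)
  have e: "prefixing L n ` standard_domain L n - standard_domain L l = {}"
    using n l cylinder_subset by (auto simp: standard_domain_flip prefixing_range)
  show "prefixing L n ` standard_domain L n - standard_domain L l \<in> null_sets \<mu>"
    unfolding e by simp
  show "AE x in \<mu>. (x \<in> standard_domain L n \<and> prefixing L n x \<in> standard_domain L l \<longleftrightarrow>
        x \<in> standard_domain L (cmp L l n)) \<and>
      (x \<in> standard_domain L (cmp L l n) \<longrightarrow> prefixing L l (prefixing L n x) = prefixing L (cmp L l n) x)"
  proof (rule AE_I2)
    fix x assume "x \<in> space \<mu>"
    then have x: "x \<in> infinite_paths L" by simp
    then show "(x \<in> standard_domain L n \<and> prefixing L n x \<in> standard_domain L l \<longleftrightarrow>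
        x \<in> standard_domain L (cmp L l n)) \<and>
      (x \<in> standard_domain L (cmp L l n) \<longrightarrow> prefixing L l (prefixing L n x) = prefixing L (cmp L l n) x)"
      using prefixing_cmp[OF l n s x] prefixing_flip(3)[OF n x]
      by (simp add: standard_domain_flip l n ln src_v path_at_zero)
  qed
next
  fix m n :: "nat ^ 2" and x :: "('a, 2) infpath"
  show "path_shift m (path_shift n x) = path_shift (m + n) x" by (rule path_shift_add)
qed

end

section \<open>The standard representation for the fair measure\<close>

context flip
begin

text \<open>
  The action on functions of the operator attached to \<open>l\<close> for the fair measure, whose Radon--Nikodym
  derivative is the constant \<open>cyl_mass l\<close>.
\<close>

definition shift_fun :: "'a \<Rightarrow> (('a, 2) infpath \<Rightarrow> complex) \<Rightarrow> ('a, 2) infpath \<Rightarrow> complex" where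
  "shift_fun l f x = indicator (cylinder L l) x * complex_of_real (cyl_mass l powr (- 1 / 2)) * f (path_shift (deg L l) x)"

text \<open>
  The action of the adjoint.
\<close>

definition prefix_fun :: "'a \<Rightarrow> (('a, 2) infpath \<Rightarrow> complex) \<Rightarrow> ('a, 2) infpath \<Rightarrow> complex" where
  "prefix_fun l f x = complex_of_real (cyl_mass l powr (1 / 2)) * f (prefixing L l x)"

definition shift_op :: "'a \<Rightarrow> ('a, 2) infpath L2_operator" where
  "shift_op l = (\<lambda>\<xi>\<in>vectors (L2 fair). L2_class fair (shift_fun l (L2_rep \<xi>)))"

text \<open>
  The powers of the mass \<open>c\<close> of \<open>Z(l)\<close> that occur below: \<open>c ^ (-1/2)\<close> normalizes \<open>shift_fun\<close>, and \<open>c ^ (1/2)\<close>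
  normalizes its adjoint \<open>prefix_fun\<close>.
\<close>

lemma mass_powr:
  "(cyl_mass l powr (- 1 / 2))\<^sup>2 * cyl_mass l = 1"
  "(cyl_mass l powr (1 / 2))\<^sup>2 = cyl_mass l"
  "cyl_mass l * cyl_mass l powr (- 1 / 2) = cyl_mass l powr (1 / 2)"
  "cyl_mass l powr (1 / 2) * cyl_mass l powr (- 1 / 2) = 1"
proof -
  have p: "0 < cyl_mass l" by simp
  show 1: "(cyl_mass l powr (1 / 2))\<^sup>2 = cyl_mass l"
    using p by (simp add: powr_half_sqrt)
  show 2: "cyl_mass l powr (1 / 2) * cyl_mass l powr (- 1 / 2) = 1"
    using p by (simp flip: powr_add)
  have "cyl_mass l * cyl_mass l powr (- 1 / 2) = cyl_mass l powr 1 * cyl_mass l powr (- 1 / 2)" using p by simp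
  also have "\<dots> = cyl_mass l powr (1 / 2)" unfolding powr_add[symmetric] by simp
  finally show "cyl_mass l * cyl_mass l powr (- 1 / 2) = cyl_mass l powr (1 / 2)" .
  have "(cyl_mass l powr (- 1 / 2))\<^sup>2 * cyl_mass l = (cyl_mass l powr (- 1 / 2))\<^sup>2 * (cyl_mass l powr (1 / 2))\<^sup>2"
    unfolding 1 ..
  also have "\<dots> = (cyl_mass l powr (1 / 2) * cyl_mass l powr (- 1 / 2))\<^sup>2"
    by (simp only: power_mult_distrib mult.commute)
  finally show "(cyl_mass l powr (- 1 / 2))\<^sup>2 * cyl_mass l = 1" unfolding 2 by simp
qed

lemma shift_fun_measurable:
  assumes [measurable]: "l \<in> mor L" "f \<in> borel_measurable (path_borel L)"
  shows "shift_fun l f \<in> borel_measurable (path_borel L)"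
  unfolding shift_fun_def by measurable

lemma prefix_fun_measurable:
  assumes [measurable]: "l \<in> mor L" "f \<in> borel_measurable (path_borel L)"
  shows "prefix_fun l f \<in> borel_measurable (path_borel L)"
  unfolding prefix_fun_def by measurable

lemma L2_fair_measurable: "f \<in> L2_functions fair \<Longrightarrow> f \<in> borel_measurable (path_borel L)"
  using L2_functionsD(1)[of f fair] by simp

lemma shift_fun_norm:
  assumes l: "l \<in> mor L" and f: "f \<in> L2_functions fair"
  shows "(\<integral>\<^sup>+x. ennreal ((cmod (shift_fun l f x))\<^sup>2) \<partial>fair) = (\<integral>\<^sup>+x. ennreal ((cmod (f x))\<^sup>2) \<partial>fair)"
proof -
  note [measurable] = L2_fair_measurable[OF f]
  let ?s = "(cyl_mass l powr (- 1 / 2))\<^sup>2"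
  have "(\<integral>\<^sup>+x. ennreal ((cmod (shift_fun l f x))\<^sup>2) \<partial>fair)
      = (\<integral>\<^sup>+x. ennreal (?s * (cmod (f (path_shift (deg L l) x)))\<^sup>2) * indicator (cylinder L l) x \<partial>fair)"
    by (rule nn_integral_cong) (simp add: shift_fun_def norm_mult power_mult_distrib indicator_def)
  also have "\<dots> = ennreal (cyl_mass l) * (\<integral>\<^sup>+x. ennreal (?s * (cmod (f x))\<^sup>2) \<partial>fair)"
    by (rule nn_integral_shift_fair[OF l]) measurable
  also have "\<dots> = (\<integral>\<^sup>+x. ennreal (cyl_mass l) * ennreal (?s * (cmod (f x))\<^sup>2) \<partial>fair)"
    by (rule nn_integral_cmult[symmetric]) measurable
  also have "\<dots> = (\<integral>\<^sup>+x. ennreal ((cmod (f x))\<^sup>2) \<partial>fair)"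
  proof (rule nn_integral_cong)
    fix x
    have "cyl_mass l * (?s * (cmod (f x))\<^sup>2) = (?s * cyl_mass l) * (cmod (f x))\<^sup>2" by (simp only: ac_simps)
    also have "\<dots> = (cmod (f x))\<^sup>2" unfolding mass_powr(1) by simp
    finally show "ennreal (cyl_mass l) * ennreal (?s * (cmod (f x))\<^sup>2) = ennreal ((cmod (f x))\<^sup>2)"
      by (subst ennreal_mult[symmetric]) simp_all
  qed
  finally show ?thesis .
qed

lemma shift_fun_L2:
  assumes l: "l \<in> mor L" and f: "f \<in> L2_functions fair"
  shows "shift_fun l f \<in> L2_functions fair"
proof (rule L2_functions_nn_integral)
  show "shift_fun l f \<in> borel_measurable fair" using shift_fun_measurable[OF l L2_fair_measurable[OF f]] by simp
  show "(\<integral>\<^sup>+x. ennreal ((cmod (shift_fun l f x))\<^sup>2) \<partial>fair) < \<infinity>"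
    unfolding shift_fun_norm[OF l f] L2_nn_integral[OF f] by simp
qed

lemma prefix_fun_L2:
  assumes l: "l \<in> mor L" and f: "f \<in> L2_functions fair"
  shows "prefix_fun l f \<in> L2_functions fair"
proof (rule L2_functions_nn_integral)
  note [measurable] = L2_fair_measurable[OF f] l
  show "prefix_fun l f \<in> borel_measurable fair" using prefix_fun_measurable[OF l L2_fair_measurable[OF f]] by simp
  have "(\<integral>\<^sup>+x. ennreal ((cmod (prefix_fun l f x))\<^sup>2) \<partial>fair) = (\<integral>\<^sup>+x. ennreal (cyl_mass l) * ennreal ((cmod (f (prefixing L l x)))\<^sup>2) \<partial>fair)"
    by (rule nn_integral_cong)
       (simp only: prefix_fun_def norm_mult power_mult_distrib norm_of_real power2_abs mass_powr(2), simp add: ennreal_mult)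
  also have "\<dots> = ennreal (cyl_mass l) * (\<integral>\<^sup>+x. ennreal ((cmod (f (prefixing L l x)))\<^sup>2) \<partial>fair)"
    by (rule nn_integral_cmult) measurable
  also have "\<dots> = (\<integral>\<^sup>+x. ennreal ((cmod (f (prefixing L l (path_shift (deg L l) x))))\<^sup>2) * indicator (cylinder L l) x \<partial>fair)"
    by (rule nn_integral_shift_fair[OF l, symmetric, of "\<lambda>x. ennreal ((cmod (f (prefixing L l x)))\<^sup>2)"]) measurable
  also have "\<dots> \<le> (\<integral>\<^sup>+x. ennreal ((cmod (f x))\<^sup>2) \<partial>fair)"
    by (rule nn_integral_mono) (simp add: indicator_def prefixing_eqI[OF l])
  also have "\<dots> < \<infinity>" unfolding L2_nn_integral[OF f] by simp
  finally show "(\<integral>\<^sup>+x. ennreal ((cmod (prefix_fun l f x))\<^sup>2) \<partial>fair) < \<infinity>" .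
qed

lemma shift_op_class:
  assumes l: "l \<in> mor L" and f: "f \<in> L2_functions fair"
  shows "shift_op l (L2_class fair f) = L2_class fair (shift_fun l f)"
proof -
  let ?g = "L2_rep (L2_class fair f)"
  have g: "?g \<in> L2_functions fair" by (rule L2_rep(1)[OF L2_class_vec[OF f]])
  have "AE x in fair. shift_fun l ?g x = shift_fun l f x"
    using AE_shift_fair[OF l L2_rep_class[OF f]] by eventually_elim (simp add: shift_fun_def indicator_def)
  then have "L2_class fair (shift_fun l ?g) = L2_class fair (shift_fun l f)"
    by (subst L2_class_eq_iff[OF shift_fun_L2[OF l g] shift_fun_L2[OF l f]])
  then show ?thesis by (simp add: shift_op_def L2_class_vec[OF f])
qed

interpretation H: hilbert "L2 fair" by (rule L2_hilbert)

lemma shift_op_bounded: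
  assumes l: "l \<in> mor L"
  shows "shift_op l \<in> bounded_operators (L2 fair)"
proof (rule H.bounded_operatorI[of _ 1])
  show "shift_op l \<in> extensional (vectors (L2 fair))" by (simp add: shift_op_def)
  fix \<xi> assume "\<xi> \<in> vectors (L2 fair)"
  then obtain f where f: "f \<in> L2_functions fair" "\<xi> = L2_class fair f" by (rule L2_vec_cases)
  show "shift_op l \<xi> \<in> vectors (L2 fair)"
    unfolding f(2) shift_op_class[OF l f(1)] by (rule L2_class_vec[OF shift_fun_L2[OF l f(1)]])
  have "ennreal (\<integral>x. (cmod (shift_fun l f x))\<^sup>2 \<partial>fair) = ennreal (\<integral>x. (cmod (f x))\<^sup>2 \<partial>fair)"
    using shift_fun_norm[OF l f(1)] unfolding L2_nn_integral[OF f(1)] L2_nn_integral[OF shift_fun_L2[OF l f(1)]] .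
  then have "(\<integral>x. (cmod (shift_fun l f x))\<^sup>2 \<partial>fair) = (\<integral>x. (cmod (f x))\<^sup>2 \<partial>fair)"
    by (subst (asm) ennreal_inj) simp_all
  then show "vnorm (L2 fair) (shift_op l \<xi>) \<le> 1 * vnorm (L2 fair) \<xi>"
    unfolding f(2) shift_op_class[OF l f(1)] L2_vnorm[OF f(1)] L2_vnorm[OF shift_fun_L2[OF l f(1)]] by simp
next
  fix \<xi> \<eta> assume "\<xi> \<in> vectors (L2 fair)" "\<eta> \<in> vectors (L2 fair)"
  then obtain f g where f: "f \<in> L2_functions fair" "\<xi> = L2_class fair f"
    and g: "g \<in> L2_functions fair" "\<eta> = L2_class fair g" by (metis L2_vec_cases)
  have "shift_fun l (\<lambda>x. f x + g x) = (\<lambda>x. shift_fun l f x + shift_fun l g x)"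
    by (simp add: shift_fun_def fun_eq_iff distrib_left)
  then show "shift_op l (vplus (L2 fair) \<xi> \<eta>) = vplus (L2 fair) (shift_op l \<xi>) (shift_op l \<eta>)"
    unfolding f(2) g(2) by (simp add: L2_plus shift_op_class l f(1) g(1) L2_functions_plus shift_fun_L2)
next
  fix z \<xi> assume "\<xi> \<in> vectors (L2 fair)"
  then obtain f where f: "f \<in> L2_functions fair" "\<xi> = L2_class fair f" by (rule L2_vec_cases)
  have "shift_fun l (\<lambda>x. z * f x) = (\<lambda>x. z * shift_fun l f x)"
    by (simp add: shift_fun_def fun_eq_iff)
  then show "shift_op l (vscale (L2 fair) z \<xi>) = vscale (L2 fair) z (shift_op l \<xi>)"
    unfolding f(2) by (simp add: L2_scale shift_op_class l f(1) L2_functions_scale shift_fun_L2)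
qed

text \<open>
  Substitution along the shift: on \<open>Z(l)\<close> a function \<open>g\<close> equals \<open>(g \<circ> \<sigma>\<^sub>l)\<close> composed with the shift.
\<close>

lemma shift_op_adjoint_class:
  assumes l: "l \<in> mor L" and g: "g \<in> L2_functions fair"
  shows "adjoint_op (L2 fair) (shift_op l) (L2_class fair g) = L2_class fair (prefix_fun l g)"
proof (rule H.inner_ext)
  note A = H.adjoint_op[OF shift_op_bounded[OF l]]
  have c: "L2_class fair g \<in> vectors (L2 fair)" by (rule L2_class_vec[OF g])
  show "adjoint_op (L2 fair) (shift_op l) (L2_class fair g) \<in> vectors (L2 fair)"
    by (rule H.bounded_operatorD(2)[OF A(1) c])
  have p: "L2_class fair (prefix_fun l g) \<in> vectors (L2 fair)" by (rule L2_class_vec[OF prefix_fun_L2[OF l g]])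
  then show "L2_class fair (prefix_fun l g) \<in> vectors (L2 fair)" .
  fix \<xi> assume xi: "\<xi> \<in> vectors (L2 fair)"
  then obtain f where f: "f \<in> L2_functions fair" "\<xi> = L2_class fair f" by (rule L2_vec_cases)
  note [measurable] = L2_fair_measurable[OF f(1)] L2_fair_measurable[OF g] l
  have cnj [measurable]: "cnj \<in> borel_measurable borel" by (intro borel_measurable_continuous_onI continuous_intros)
  let ?s = "complex_of_real (cyl_mass l powr (- 1 / 2))"
  have "vinner (L2 fair) (shift_op l \<xi>) (L2_class fair g) = (\<integral>x. shift_fun l f x * cnj (g x) \<partial>fair)"
    unfolding f(2) shift_op_class[OF l f(1)] by (rule L2_inner[OF shift_fun_L2[OF l f(1)] g])
  also have "\<dots> = (\<integral>x. indicator (cylinder L l) x *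
      (?s * f (path_shift (deg L l) x) * cnj (g (prefixing L l (path_shift (deg L l) x)))) \<partial>fair)"
    by (rule Bochner_Integration.integral_cong) (simp_all add: shift_fun_def indicator_def prefixing_eqI[OF l])
  also have "\<dots> = complex_of_real (cyl_mass l) * (\<integral>x. ?s * f x * cnj (g (prefixing L l x)) \<partial>fair)"
    by (rule integral_shift_fair[OF l, of "\<lambda>x. ?s * f x * cnj (g (prefixing L l x))"]) measurable
  also have "\<dots> = (\<integral>x. complex_of_real (cyl_mass l) * (?s * f x * cnj (g (prefixing L l x))) \<partial>fair)"
    by simp
  also have "\<dots> = (\<integral>x. f x * cnj (prefix_fun l g x) \<partial>fair)"
  proof (rule Bochner_Integration.integral_cong[OF refl])
    fix x
    have "complex_of_real (cyl_mass l) * ?s = complex_of_real (cyl_mass l powr (1 / 2))"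
      unfolding of_real_mult[symmetric] mass_powr(3) ..
    then have "complex_of_real (cyl_mass l) * (?s * f x * cnj (g (prefixing L l x)))
        = complex_of_real (cyl_mass l powr (1 / 2)) * (f x * cnj (g (prefixing L l x)))"
      by (simp only: mult.assoc[symmetric])
    then show "complex_of_real (cyl_mass l) * (?s * f x * cnj (g (prefixing L l x))) = f x * cnj (prefix_fun l g x)"
      unfolding prefix_fun_def complex_cnj_mult complex_cnj_complex_of_real by (simp only: ac_simps)
  qed
  also have "\<dots> = vinner (L2 fair) \<xi> (L2_class fair (prefix_fun l g))"
    unfolding f(2) by (rule L2_inner[symmetric, OF f(1) prefix_fun_L2[OF l g]])
  finally have "vinner (L2 fair) \<xi> (adjoint_op (L2 fair) (shift_op l) (L2_class fair g)) =
      vinner (L2 fair) \<xi> (L2_class fair (prefix_fun l g))"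
    unfolding A(2)[OF xi c] .
  then show "vinner (L2 fair) (adjoint_op (L2 fair) (shift_op l) (L2_class fair g)) \<xi> =
      vinner (L2 fair) (L2_class fair (prefix_fun l g)) \<xi>"
    using H.inner_commute[OF xi p] H.inner_commute[OF xi H.bounded_operatorD(2)[OF A(1) c]] by simp
qed

lemma shift_op_isometry:
  assumes l: "l \<in> mor L" and f: "f \<in> L2_functions fair"
  shows "adjoint_op (L2 fair) (shift_op l) (shift_op l (L2_class fair f)) = L2_class fair f"
proof -
  have "prefix_fun l (shift_fun l f) x = f x" if x: "x \<in> space fair" for x
  proof -
    have "complex_of_real (cyl_mass l powr (1 / 2)) * complex_of_real (cyl_mass l powr (- 1 / 2)) = 1"
      unfolding of_real_mult[symmetric] mass_powr(4) by simp
    then show ?thesis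
      using prefixing_flip(1,2)[OF l, of x] x unfolding prefix_fun_def shift_fun_def
      by (simp add: mult.assoc[symmetric])
  qed
  then show ?thesis
    unfolding shift_op_class[OF l f] shift_op_adjoint_class[OF l shift_fun_L2[OF l f]]
    by (intro L2_class_cong prefix_fun_L2 shift_fun_L2 l f)
qed

lemma shift_op_range_projection:
  assumes l: "l \<in> mor L" and f: "f \<in> L2_functions fair"
  shows "shift_op l (adjoint_op (L2 fair) (shift_op l) (L2_class fair f)) = L2_class fair (\<lambda>x. indicator (cylinder L l) x * f x)"
proof -
  have "shift_fun l (prefix_fun l f) x = indicator (cylinder L l) x * f x" for x
  proof -
    have "complex_of_real (cyl_mass l powr (- 1 / 2)) * complex_of_real (cyl_mass l powr (1 / 2)) = 1"
      unfolding of_real_mult[symmetric] mult.commute[of "cyl_mass l powr (- 1 / 2)"] mass_powr(4) by simp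
    then show ?thesis
      using prefixing_eqI[OF l, of x] unfolding prefix_fun_def shift_fun_def
      by (simp add: indicator_def mult.assoc[symmetric])
  qed
  then show ?thesis
    unfolding shift_op_adjoint_class[OF l f] shift_op_class[OF l prefix_fun_L2[OF l f]] by presburger
qed

lemma shift_op_v:
  assumes f: "f \<in> L2_functions fair"
  shows "shift_op v (L2_class fair f) = L2_class fair f"
proof -
  have "shift_fun v f x = f x" if "x \<in> space fair" for x
    using that by (simp add: shift_fun_def v_mor path_shift_0 cylinder_v)
  then show ?thesis unfolding shift_op_class[OF v_mor(1) f] by (intro L2_class_cong shift_fun_L2 v_mor f)
qed

lemma shift_op_cmp:
  assumes l: "l \<in> mor L" and n: "n \<in> mor L" and f: "f \<in> L2_functions fair"
  shows "shift_op l (shift_op n (L2_class fair f)) = shift_op (cmp L l n) (L2_class fair f)"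
proof -
  have ln: "cmp L l n \<in> mor L" by (rule cmp_mor_flip[OF l n])
  have "shift_fun l (shift_fun n f) x = shift_fun (cmp L l n) f x" for x
  proof -
    have m: "cyl_mass (cmp L l n) powr (- 1 / 2) = cyl_mass l powr (- 1 / 2) * cyl_mass n powr (- 1 / 2)"
      unfolding deg_cmp_flip[OF l n] vector_add_component power_add by (rule powr_mult)
    have i: "indicator (cylinder L (cmp L l n)) x =
        indicator (cylinder L l) x * (indicator (cylinder L n) (path_shift (deg L l) x) :: complex)"
      using cylinder_cmp_iff[OF l n, of x] by (simp add: indicator_def src_v[OF l] rng_v[OF n])
    have s: "path_shift (deg L n) (path_shift (deg L l) x) = path_shift (deg L (cmp L l n)) x"
      unfolding path_shift_add deg_cmp_flip[OF l n] by (simp only: add.commute)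
    show ?thesis
      unfolding shift_fun_def s i m of_real_mult by (simp only: ac_simps)
  qed
  then show ?thesis
    unfolding shift_op_class[OF n f] shift_op_class[OF l shift_fun_L2[OF n f]] shift_op_class[OF ln f]
    by presburger
qed

lemma operator_eqI:
  assumes "S \<in> bounded_operators (L2 fair)" "T \<in> bounded_operators (L2 fair)"
    and "\<And>f. f \<in> L2_functions fair \<Longrightarrow> S (L2_class fair f) = T (L2_class fair f)"
  shows "S = T"
proof (rule H.operator_ext[OF assms(1,2)])
  fix u assume "u \<in> vectors (L2 fair)"
  then obtain f where "f \<in> L2_functions fair" "u = L2_class fair f" by (rule L2_vec_cases)
  then show "S u = T u" using assms(3) by simp
qed

definition range_projection :: "'a \<Rightarrow> ('a, 2) infpath L2_operator" where
  "range_projection l = shift_op l \<otimes>\<^bsub>BH (L2 fair)\<^esub> star (BH (L2 fair)) (shift_op l)"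

lemma range_projection:
  assumes l: "l \<in> mor L"
  shows "range_projection l \<in> bounded_operators (L2 fair)"
    "f \<in> L2_functions fair \<Longrightarrow> range_projection l (L2_class fair f) = L2_class fair (\<lambda>x. indicator (cylinder L l) x * f x)"
  using H.mult_bounded[OF shift_op_bounded[OF l] H.adjoint_op(1)[OF shift_op_bounded[OF l]]]
    shift_op_range_projection[OF l]
  unfolding range_projection_def H.BH_sel by (blast, simp add: L2_class_vec)

text \<open>
  The range projections are multiplication by indicators of cylinder sets, so a finite sum of them is
  multiplication by the sum of the indicators.
\<close>

lemma finsum_range_projections:
  assumes "finite I" "I \<subseteq> mor L" "f \<in> L2_functions fair"
  shows "finsum (BH (L2 fair)) range_projection I \<in> bounded_operators (L2 fair)"
    "(\<lambda>x. (\<Sum>l\<in>I. indicator (cylinder L l) x) * f x) \<in> L2_functions fair"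
    "finsum (BH (L2 fair)) range_projection I (L2_class fair f) =
      L2_class fair (\<lambda>x. (\<Sum>l\<in>I. indicator (cylinder L l) x) * f x)"
proof -
  interpret B: abelian_group "BH (L2 fair)" by (rule H.BH_abelian_group)
  have "finsum (BH (L2 fair)) range_projection I \<in> bounded_operators (L2 fair) \<and>
    (\<lambda>x. (\<Sum>l\<in>I. indicator (cylinder L l) x) * f x) \<in> L2_functions fair \<and>
    finsum (BH (L2 fair)) range_projection I (L2_class fair f) =
      L2_class fair (\<lambda>x. (\<Sum>l\<in>I. indicator (cylinder L l) x) * f x)"
    using assms(1,2)
  proof (induction I)
    case empty
    have "finsum (BH (L2 fair)) range_projection {} = \<zero>\<^bsub>BH (L2 fair)\<^esub>" by (rule B.finsum_empty)
    then show ?case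
      using H.zero_bounded L2_functions_zero[of fair] L2_class_vec[OF assms(3)]
      by (simp add: H.BH_sel L2_zero del: restrict_apply) (simp only: restrict_apply')
  next
    case (insert l I)
    have l: "l \<in> mor L" and I: "I \<subseteq> mor L" using insert.prems by auto
    note IH = insert.IH[OF I]
    have p: "range_projection \<in> I \<rightarrow> carrier (BH (L2 fair))"
      using range_projection(1) I unfolding H.BH_sel(1) by blast
    have pl: "range_projection l \<in> carrier (BH (L2 fair))"
      using range_projection(1)[OF l] unfolding H.BH_sel(1) .
    have e: "finsum (BH (L2 fair)) range_projection (insert l I)
        = range_projection l \<oplus>\<^bsub>BH (L2 fair)\<^esub> finsum (BH (L2 fair)) range_projection I"
      by (rule B.finsum_insert[OF insert.hyps(1,2) p pl])
    have b: "finsum (BH (L2 fair)) range_projection (insert l I) \<in> bounded_operators (L2 fair)"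
      unfolding e H.BH_sel(4) using IH by (intro H.add_bounded range_projection(1)[OF l]) blast
    have fe: "(\<lambda>x. (\<Sum>l\<in>insert l I. indicator (cylinder L l) x) * f x) =
        (\<lambda>x. indicator (cylinder L l) x * f x + (\<Sum>l\<in>I. indicator (cylinder L l) x) * f x)"
      using insert.hyps by (simp add: distrib_right)
    have il: "(\<lambda>x. indicator (cylinder L l) x * f x) \<in> L2_functions fair"
      using cylinder_sets[OF l] by (intro L2_functions_indicator assms(3)) simp
    have "finsum (BH (L2 fair)) range_projection (insert l I) (L2_class fair f) =
        vplus (L2 fair) (range_projection l (L2_class fair f)) (finsum (BH (L2 fair)) range_projection I (L2_class fair f))"
      unfolding e H.BH_sel(4) using L2_class_vec[OF assms(3)] by (rule restrict_apply')
    also have "\<dots> = L2_class fair (\<lambda>x. (\<Sum>l\<in>insert l I. indicator (cylinder L l) x) * f x)"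
      unfolding fe range_projection(2)[OF l assms(3)] using IH L2_plus[OF il] by simp
    finally have "finsum (BH (L2 fair)) range_projection (insert l I) (L2_class fair f) =
        L2_class fair (\<lambda>x. (\<Sum>l\<in>insert l I. indicator (cylinder L l) x) * f x)" .
    moreover have "(\<lambda>x. (\<Sum>l\<in>insert l I. indicator (cylinder L l) x) * f x) \<in> L2_functions fair"
      unfolding fe using IH L2_functions_plus[OF il] by blast
    ultimately show ?case using b by blast
  qed
  then show "finsum (BH (L2 fair)) range_projection I \<in> bounded_operators (L2 fair)"
    "(\<lambda>x. (\<Sum>l\<in>I. indicator (cylinder L l) x) * f x) \<in> L2_functions fair"
    "finsum (BH (L2 fair)) range_projection I (L2_class fair f) =
      L2_class fair (\<lambda>x. (\<Sum>l\<in>I. indicator (cylinder L l) x) * f x)" by blast+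
qed

lemma sum_cylinder_indicators:
  assumes x: "x \<in> infinite_paths L"
  shows "(\<Sum>l\<in>paths_of_degree L n. indicator (cylinder L l) x) = (1 :: complex)"
proof -
  have fin: "finite (paths_of_degree L n)" using paths_of_degree_count by blast
  have "(\<Sum>l\<in>paths_of_degree L n. indicator (cylinder L l) x) = (\<Sum>l\<in>paths_of_degree L n. if l = x (0, n) then 1 else (0 :: complex))"
    using x by (intro sum.cong) (auto simp: indicator_def cylinder_def paths_of_degree_def)
  also have "\<dots> = 1"
    using fin infinite_path_mor0[OF x, of n] infinite_path_deg0[OF x, of n] by (simp add: paths_of_degree_def)
  finally show ?thesis .
qed

text \<open>
  The relations reduce to \<open>S\<^sub>l\<^sup>* S\<^sub>l = 1\<close>, to \<open>S\<^sub>l S\<^sub>n = S\<^sub>l\<^sub>n\<close>, and to the fact that the cylinder sets of a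
  given degree partition the path space.
\<close>

theorem shift_op_cuntz_krieger: "cuntz_krieger_family L (BH (L2 fair)) shift_op"
  unfolding cuntz_krieger_family_def
proof (intro conjI ballI allI impI)
  note b = shift_op_bounded
  note a = H.adjoint_op(1)[OF shift_op_bounded]
  fix l assume l: "l \<in> mor L"
  show "shift_op l \<in> carrier (BH (L2 fair))" using b[OF l] by (simp add: H.BH_sel)
  show "shift_op l \<otimes>\<^bsub>BH (L2 fair)\<^esub> star (BH (L2 fair)) (shift_op l) \<otimes>\<^bsub>BH (L2 fair)\<^esub> shift_op l = shift_op l"
  proof (rule operator_eqI)
    show "shift_op l \<otimes>\<^bsub>BH (L2 fair)\<^esub> star (BH (L2 fair)) (shift_op l) \<otimes>\<^bsub>BH (L2 fair)\<^esub> shift_op l \<in> bounded_operators (L2 fair)"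
      unfolding H.BH_sel by (intro H.mult_bounded b a l)
    fix f assume f: "f \<in> L2_functions fair"
    show "(shift_op l \<otimes>\<^bsub>BH (L2 fair)\<^esub> star (BH (L2 fair)) (shift_op l) \<otimes>\<^bsub>BH (L2 fair)\<^esub> shift_op l) (L2_class fair f) = shift_op l (L2_class fair f)"
      using shift_op_isometry[OF l f] L2_class_vec[OF f] H.bounded_operatorD(2)[OF b[OF l] L2_class_vec[OF f]]
      by (simp add: H.BH_sel)
  qed (rule b[OF l])
  show "star (BH (L2 fair)) (shift_op l) \<otimes>\<^bsub>BH (L2 fair)\<^esub> shift_op l = shift_op (src L l)"
    unfolding src_v[OF l]
  proof (rule operator_eqI)
    show "star (BH (L2 fair)) (shift_op l) \<otimes>\<^bsub>BH (L2 fair)\<^esub> shift_op l \<in> bounded_operators (L2 fair)"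
      unfolding H.BH_sel by (intro H.mult_bounded b a l)
    fix f assume f: "f \<in> L2_functions fair"
    show "(star (BH (L2 fair)) (shift_op l) \<otimes>\<^bsub>BH (L2 fair)\<^esub> shift_op l) (L2_class fair f) = shift_op v (L2_class fair f)"
      using shift_op_isometry[OF l f] shift_op_v[OF f] L2_class_vec[OF f] by (simp add: H.BH_sel)
  qed (rule b[OF v_mor(1)])
  fix n assume n: "n \<in> mor L"
  show "shift_op l \<otimes>\<^bsub>BH (L2 fair)\<^esub> shift_op n = shift_op (cmp L l n)"
  proof (rule operator_eqI)
    show "shift_op l \<otimes>\<^bsub>BH (L2 fair)\<^esub> shift_op n \<in> bounded_operators (L2 fair)"
      unfolding H.BH_sel by (intro H.mult_bounded b l n)
    fix f assume f: "f \<in> L2_functions fair"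
    show "(shift_op l \<otimes>\<^bsub>BH (L2 fair)\<^esub> shift_op n) (L2_class fair f) = shift_op (cmp L l n) (L2_class fair f)"
      using shift_op_cmp[OF l n f] L2_class_vec[OF f] by (simp add: H.BH_sel)
  qed (rule b[OF cmp_mor_flip[OF l n]])
next
  note b = shift_op_bounded[OF v_mor(1)]
  note a = H.adjoint_op(1)[OF b]
  fix w assume "w \<in> vertices L"
  then have w: "w = v" by (simp add: vertices_flip)
  show "star (BH (L2 fair)) (shift_op w) = shift_op w"
    unfolding w H.BH_sel
  proof (rule operator_eqI[OF a b])
    fix f assume f: "f \<in> L2_functions fair"
    show "adjoint_op (L2 fair) (shift_op v) (L2_class fair f) = shift_op v (L2_class fair f)"
      using shift_op_isometry[OF v_mor(1) f] unfolding shift_op_v[OF f] .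
  qed
  show "shift_op w \<otimes>\<^bsub>BH (L2 fair)\<^esub> shift_op w = shift_op w"
    unfolding w
  proof (rule operator_eqI)
    show "shift_op v \<otimes>\<^bsub>BH (L2 fair)\<^esub> shift_op v \<in> bounded_operators (L2 fair)"
      unfolding H.BH_sel by (intro H.mult_bounded b)
    fix f assume f: "f \<in> L2_functions fair"
    show "(shift_op v \<otimes>\<^bsub>BH (L2 fair)\<^esub> shift_op v) (L2_class fair f) = shift_op v (L2_class fair f)"
      using shift_op_v[OF f] L2_class_vec[OF f] by (simp add: H.BH_sel)
  qed (rule b)
  show "shift_op w \<otimes>\<^bsub>BH (L2 fair)\<^esub> shift_op u = \<zero>\<^bsub>BH (L2 fair)\<^esub>"
    if "u \<in> vertices L" "w \<noteq> u" for u
    using that w by (simp add: vertices_flip)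
  fix n :: "nat ^ 2"
  have P: "{l \<in> paths_of_degree L n. rng L l = w} = paths_of_degree L n"
    using w rng_v by (auto simp: paths_of_degree_def)
  have fin: "finite (paths_of_degree L n)" using paths_of_degree_count by blast
  have sub: "paths_of_degree L n \<subseteq> mor L" by (auto simp: paths_of_degree_def)
  show "shift_op w = (\<Oplus>\<^bsub>BH (L2 fair)\<^esub>l\<in>{l \<in> paths_of_degree L n. rng L l = w}.
      shift_op l \<otimes>\<^bsub>BH (L2 fair)\<^esub> star (BH (L2 fair)) (shift_op l))"
    unfolding P unfolding w range_projection_def[symmetric]
  proof (rule operator_eqI[OF b])
    note F = finsum_range_projections[OF fin sub]
    show "finsum (BH (L2 fair)) range_projection (paths_of_degree L n) \<in> bounded_operators (L2 fair)"
      by (rule F(1)[OF L2_functions_zero])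
    fix f assume f: "f \<in> L2_functions fair"
    have "L2_class fair f = L2_class fair (\<lambda>x. (\<Sum>l\<in>paths_of_degree L n. indicator (cylinder L l) x) * f x)"
      by (rule L2_class_cong[OF f F(2)[OF f]]) (simp add: sum_cylinder_indicators)
    then show "shift_op v (L2_class fair f) = finsum (BH (L2 fair)) range_projection (paths_of_degree L n) (L2_class fair f)"
      unfolding F(3)[OF f] shift_op_v[OF f] .
  qed
qed

end

section \<open>Changing the measure is a unitary equivalence\<close>

context flip_density
begin

definition density_unitary :: "(('a, 2) infpath \<Rightarrow> complex) set \<Rightarrow> (('a, 2) infpath \<Rightarrow> complex) set" where
  "density_unitary \<xi> = L2_class fair (\<lambda>x. complex_of_real (sqrt (D x)) * L2_rep \<xi> x)"

text \<open>
  \<open>\<bar>\<surd>D f\<bar>\<^sup>2 = D \<bar>f\<bar>\<^sup>2\<close>, and integrating this against the fair measure is integrating \<open>\<bar>f\<bar>\<^sup>2\<close> against \<open>\<mu>\<close>.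
\<close>

lemma L2_density_iff:
  assumes [measurable]: "f \<in> borel_measurable (path_borel L)"
  shows "f \<in> L2_functions \<mu> \<longleftrightarrow> (\<lambda>x. complex_of_real (sqrt (D x)) * f x) \<in> L2_functions fair"
proof -
  have "integrable \<mu> (\<lambda>x. (cmod (f x))\<^sup>2) \<longleftrightarrow> integrable fair (\<lambda>x. D x *\<^sub>R (cmod (f x))\<^sup>2)"
    unfolding \<mu>_def by (rule integrable_density) (simp_all add: less_imp_le[OF D_pos])
  also have "(\<lambda>x. D x *\<^sub>R (cmod (f x))\<^sup>2) = (\<lambda>x. (cmod (complex_of_real (sqrt (D x)) * f x))\<^sup>2)"
    by (simp add: fun_eq_iff norm_mult power_mult_distrib less_imp_le[OF D_pos])
  finally show ?thesis by (simp add: L2_functions_def)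
qed

lemma L2_\<mu>_measurable: "f \<in> L2_functions \<mu> \<Longrightarrow> f \<in> borel_measurable (path_borel L)"
  using L2_functionsD(1)[of f \<mu>] by simp

lemma L2_densityD: "f \<in> L2_functions \<mu> \<Longrightarrow> (\<lambda>x. complex_of_real (sqrt (D x)) * f x) \<in> L2_functions fair"
  using L2_density_iff[OF L2_\<mu>_measurable] by blast

lemma density_unitary_class:
  assumes f: "f \<in> L2_functions \<mu>"
  shows "density_unitary (L2_class \<mu> f) = L2_class fair (\<lambda>x. complex_of_real (sqrt (D x)) * f x)"
proof -
  have r: "L2_rep (L2_class \<mu> f) \<in> L2_functions \<mu>" by (rule L2_rep(1)[OF L2_class_vec[OF f]])
  have "AE x in fair. L2_rep (L2_class \<mu> f) x = f x" using L2_rep_class[OF f] by (simp add: AE_\<mu>_iff)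
  then have "AE x in fair. complex_of_real (sqrt (D x)) * L2_rep (L2_class \<mu> f) x = complex_of_real (sqrt (D x)) * f x"
    by eventually_elim simp
  then show ?thesis unfolding density_unitary_def
    by (subst L2_class_eq_iff[OF L2_densityD[OF r] L2_densityD[OF f]])
qed

lemma density_unitary: "unitary (L2 \<mu>) (L2 fair) density_unitary"
  unfolding unitary_def linear_on_def
proof (intro conjI ballI allI)
  have vec: "density_unitary \<xi> \<in> vectors (L2 fair)" if "\<xi> \<in> vectors (L2 \<mu>)" for \<xi>
    unfolding density_unitary_def by (rule L2_class_vec[OF L2_densityD[OF L2_rep(1)[OF that]]])
  then show "density_unitary ` vectors (L2 \<mu>) \<subseteq> vectors (L2 fair)" by blast
  show "bij_betw density_unitary (vectors (L2 \<mu>)) (vectors (L2 fair))"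
    unfolding bij_betw_def
  proof
    show "inj_on density_unitary (vectors (L2 \<mu>))"
    proof (rule inj_onI)
      fix \<xi> \<eta> assume "\<xi> \<in> vectors (L2 \<mu>)" "\<eta> \<in> vectors (L2 \<mu>)" and eq: "density_unitary \<xi> = density_unitary \<eta>"
      then obtain f g where f: "f \<in> L2_functions \<mu>" "\<xi> = L2_class \<mu> f"
        and g: "g \<in> L2_functions \<mu>" "\<eta> = L2_class \<mu> g" by (metis L2_vec_cases)
      have "AE x in fair. complex_of_real (sqrt (D x)) * f x = complex_of_real (sqrt (D x)) * g x"
        using eq unfolding f(2) g(2) density_unitary_class[OF f(1)] density_unitary_class[OF g(1)]
          L2_class_eq_iff[OF L2_densityD[OF f(1)] L2_densityD[OF g(1)]] .
      then have "AE x in \<mu>. f x = g x"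
        unfolding AE_\<mu>_iff by eventually_elim (use D_pos less_irrefl in \<open>simp add: less_imp_neq[OF D_pos, symmetric]\<close>)
      then show "\<xi> = \<eta>" using f g L2_class_eq_iff by blast
    qed
    show "density_unitary ` vectors (L2 \<mu>) = vectors (L2 fair)"
    proof
      show "density_unitary ` vectors (L2 \<mu>) \<subseteq> vectors (L2 fair)" using vec by blast
      show "vectors (L2 fair) \<subseteq> density_unitary ` vectors (L2 \<mu>)"
      proof
        fix \<eta> assume "\<eta> \<in> vectors (L2 fair)"
        then obtain g where g: "g \<in> L2_functions fair" "\<eta> = L2_class fair g" by (rule L2_vec_cases)
        note [measurable] = L2_fair_measurable[OF g(1)]
        let ?f = "\<lambda>x. g x / complex_of_real (sqrt (D x))"
        have e: "(\<lambda>x. complex_of_real (sqrt (D x)) * ?f x) = g"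
          by (simp add: fun_eq_iff less_imp_neq[OF D_pos, symmetric])
        have m: "?f \<in> borel_measurable (path_borel L)" by measurable
        have f: "?f \<in> L2_functions \<mu>" unfolding L2_density_iff[OF m] e by (rule g(1))
        have "density_unitary (L2_class \<mu> ?f) = \<eta>" unfolding density_unitary_class[OF f] e g(2) ..
        then show "\<eta> \<in> density_unitary ` vectors (L2 \<mu>)" using L2_class_vec[OF f] by blast
      qed
    qed
  qed
next
  fix \<xi> \<eta> assume "\<xi> \<in> vectors (L2 \<mu>)" "\<eta> \<in> vectors (L2 \<mu>)"
  then obtain f g where f: "f \<in> L2_functions \<mu>" "\<xi> = L2_class \<mu> f"
    and g: "g \<in> L2_functions \<mu>" "\<eta> = L2_class \<mu> g" by (metis L2_vec_cases)
  note [measurable] = L2_\<mu>_measurable[OF f(1)] L2_\<mu>_measurable[OF g(1)]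
  show "density_unitary (vplus (L2 \<mu>) \<xi> \<eta>) = vplus (L2 fair) (density_unitary \<xi>) (density_unitary \<eta>)"
    unfolding f(2) g(2) L2_plus[OF f(1) g(1)] density_unitary_class[OF f(1)] density_unitary_class[OF g(1)]
      density_unitary_class[OF L2_functions_plus[OF f(1) g(1)]] L2_plus[OF L2_densityD[OF f(1)] L2_densityD[OF g(1)]]
    by (simp only: distrib_left)
  have cnj [measurable]: "cnj \<in> borel_measurable borel" by (intro borel_measurable_continuous_onI continuous_intros)
  have "vinner (L2 fair) (density_unitary \<xi>) (density_unitary \<eta>) =
      (\<integral>x. complex_of_real (sqrt (D x)) * f x * cnj (complex_of_real (sqrt (D x)) * g x) \<partial>fair)"
    unfolding f(2) g(2) density_unitary_class[OF f(1)] density_unitary_class[OF g(1)]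
    by (rule L2_inner[OF L2_densityD[OF f(1)] L2_densityD[OF g(1)]])
  also have "\<dots> = (\<integral>x. D x *\<^sub>R (f x * cnj (g x)) \<partial>fair)"
  proof (rule Bochner_Integration.integral_cong[OF refl])
    fix x
    have "complex_of_real (sqrt (D x)) * complex_of_real (sqrt (D x)) = complex_of_real (D x)"
      unfolding of_real_mult[symmetric] using D_pos[of x] by simp
    then show "complex_of_real (sqrt (D x)) * f x * cnj (complex_of_real (sqrt (D x)) * g x) = D x *\<^sub>R (f x * cnj (g x))"
      unfolding scaleR_conv_of_real complex_cnj_mult complex_cnj_complex_of_real
      by (metis (no_types, lifting) mult.assoc mult.left_commute)
  qed
  also have "\<dots> = (\<integral>x. f x * cnj (g x) \<partial>\<mu>)"
    unfolding \<mu>_def by (rule integral_density[symmetric]) (simp_all add: less_imp_le[OF D_pos])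
  also have "\<dots> = vinner (L2 \<mu>) \<xi> \<eta>" unfolding f(2) g(2) by (rule L2_inner[OF f(1) g(1), symmetric])
  finally show "vinner (L2 fair) (density_unitary \<xi>) (density_unitary \<eta>) = vinner (L2 \<mu>) \<xi> \<eta>" .
next
  fix z \<xi> assume "\<xi> \<in> vectors (L2 \<mu>)"
  then obtain f where f: "f \<in> L2_functions \<mu>" "\<xi> = L2_class \<mu> f" by (rule L2_vec_cases)
  show "density_unitary (vscale (L2 \<mu>) z \<xi>) = vscale (L2 fair) z (density_unitary \<xi>)"
    unfolding f(2) L2_scale[OF f(1)] density_unitary_class[OF f(1)]
      density_unitary_class[OF L2_functions_scale[OF f(1)]] L2_scale[OF L2_densityD[OF f(1)]]
    by (simp only: mult.left_commute)
qed

abbreviation standard_op :: "'a \<Rightarrow> ('a, 2) infpath L2_operator" where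
  "standard_op \<equiv> semibranching_operator L \<mu> (standard_domain L) (prefixing L) path_shift"

text \<open>
  On \<open>Z(l)\<close> the derivative at the shifted path \<open>T x\<close> is \<open>c D(x) / D(T x)\<close> with \<open>c = cyl_mass l\<close>, because
  prefixing by \<open>l\<close> takes \<open>T x\<close> back to \<open>x\<close>.  Its power \<open>-1/2\<close> exchanges \<open>\<surd>D(x)\<close> for \<open>c ^ (-1/2) \<surd>D(T x)\<close>.
\<close>

lemma density_unitary_intertwines:
  assumes l: "l \<in> mor L" and xi: "\<xi> \<in> vectors (L2 \<mu>)"
  shows "standard_op l \<xi> \<in> vectors (L2 \<mu>)"
    "density_unitary (standard_op l \<xi>) = shift_op l (density_unitary \<xi>)"
proof -
  let ?f = "L2_rep \<xi>" and ?T = "path_shift (deg L l)"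
  let ?Df = "\<lambda>x. complex_of_real (sqrt (D x)) * ?f x"
  have f: "?f \<in> L2_functions \<mu>" by (rule L2_rep(1)[OF xi])
  define g where "g x = indicator (cylinder L l) x *
      complex_of_real (enn2real (Phi \<mu> (infinite_paths L) (prefixing L l) (?T x)) powr (- 1 / 2)) * ?f (?T x)" for x
  note [measurable] = L2_\<mu>_measurable[OF f] l Phi_measurable
  have gm: "g \<in> borel_measurable (path_borel L)" unfolding g_def by measurable
  have op: "standard_op l \<xi> = L2_class \<mu> g"
    unfolding semibranching_operator_def restrict_apply'[OF xi] standard_domain_flip[OF l] prefixing_range[OF l] g_def ..
  have "AE x in fair. Phi \<mu> (infinite_paths L) (prefixing L l) x = ennreal (jacobian l x)"
    using Phi_prefixing[OF l] unfolding AE_\<mu>_iff .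
  from AE_shift_fair[OF l this]
  have AE: "AE x in fair. complex_of_real (sqrt (D x)) * g x = shift_fun l ?Df x"
  proof eventually_elim
    case (elim x)
    show ?case
    proof (cases "x \<in> cylinder L l")
      case True
      have "Phi \<mu> (infinite_paths L) (prefixing L l) (?T x) = ennreal (cyl_mass l * D x / D (?T x))"
        using elim True prefixing_eqI[OF l True] by (simp add: jacobian_def)
      then have P: "enn2real (Phi \<mu> (infinite_paths L) (prefixing L l) (?T x)) = cyl_mass l * D x / D (?T x)"
        using D_pos[of x] D_pos[of "?T x"] by simp
      have "sqrt (D x) * (cyl_mass l * D x / D (?T x)) powr (- 1 / 2) = cyl_mass l powr (- 1 / 2) * sqrt (D (?T x))"
      proof -
        have "(cyl_mass l * D x / D (?T x)) powr (- 1 / 2) = cyl_mass l powr (- 1 / 2) * D x powr (- 1 / 2) / D (?T x) powr (- 1 / 2)"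
          using D_pos[of x] D_pos[of "?T x"] by (simp add: powr_mult powr_divide)
        moreover have "D y powr (- 1 / 2) = 1 / sqrt (D y)" for y
          using D_pos[of y] powr_minus_divide[of "D y" "1 / 2"] by (simp add: powr_half_sqrt)
        ultimately show ?thesis using D_pos[of x] D_pos[of "?T x"] by (simp add: field_simps)
      qed
      then have "complex_of_real (sqrt (D x)) * complex_of_real ((cyl_mass l * D x / D (?T x)) powr (- 1 / 2))
          = complex_of_real (cyl_mass l powr (- 1 / 2)) * complex_of_real (sqrt (D (?T x)))"
        unfolding of_real_mult[symmetric] by (rule arg_cong)
      then show ?thesis
        using True unfolding g_def shift_fun_def P by (simp add: mult.assoc[symmetric])
    qed (simp add: g_def shift_fun_def)
  qed
  have S: "shift_fun l ?Df \<in> L2_functions fair" by (rule shift_fun_L2[OF l L2_densityD[OF f]])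
  have m: "(\<lambda>x. complex_of_real (sqrt (D x)) * g x) \<in> borel_measurable fair"
    using gm by simp
  have "integrable fair (\<lambda>x. (cmod (complex_of_real (sqrt (D x)) * g x))\<^sup>2)"
  proof (rule integrable_cong_AE_imp[OF L2_functionsD(2)[OF S]])
    show "(\<lambda>x. (cmod (complex_of_real (sqrt (D x)) * g x))\<^sup>2) \<in> borel_measurable fair" using m by measurable
    show "AE x in fair. (cmod (shift_fun l ?Df x))\<^sup>2 = (cmod (complex_of_real (sqrt (D x)) * g x))\<^sup>2"
      using AE by eventually_elim (simp only:)
  qed
  then have Dg: "(\<lambda>x. complex_of_real (sqrt (D x)) * g x) \<in> L2_functions fair" using m by (simp add: L2_functions_def)
  then have g: "g \<in> L2_functions \<mu>" using L2_density_iff[OF gm] by blast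
  show "standard_op l \<xi> \<in> vectors (L2 \<mu>)" unfolding op by (rule L2_class_vec[OF g])
  have "density_unitary (standard_op l \<xi>) = L2_class fair (shift_fun l ?Df)"
    unfolding op density_unitary_class[OF g] by (subst L2_class_eq_iff[OF Dg S]) (rule AE)
  also have "\<dots> = shift_op l (density_unitary \<xi>)"
    unfolding density_unitary_def by (rule shift_op_class[OF l L2_densityD[OF f], symmetric])
  finally show "density_unitary (standard_op l \<xi>) = shift_op l (density_unitary \<xi>)" .
qed

sublocale U: unitary_pair "L2 \<mu>" "L2 fair" density_unitary
  by (intro unitary_pair.intro unitary_pair_axioms.intro L2_hilbert density_unitary)

lemma conj_op_standard_op: "l \<in> mor L \<Longrightarrow> U.conj_op (standard_op l) = shift_op l"
  unfolding U.conj_op_def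
proof (rule extensionalityI[of _ "vectors (L2 fair)"])
  fix w assume l: "l \<in> mor L" and w: "w \<in> vectors (L2 fair)"
  show "(\<lambda>w\<in>vectors (L2 fair). density_unitary (standard_op l (U.V w))) w = shift_op l w"
    using w density_unitary_intertwines(2)[OF l U.V_vec[OF w]] by (simp add: U.U_V)
qed (auto simp: shift_op_def)

context
  fixes A :: "'b cstar_data" and t :: "'a \<Rightarrow> 'b" and \<phi> :: "'b \<Rightarrow> ('a, 2) infpath L2_operator"
  assumes A: "cstar_algebra A" and t: "\<And>l. l \<in> mor L \<Longrightarrow> t l \<in> carrier A"
    and \<phi>: "\<phi> \<in> star_hom A (BH (L2 fair))" "\<And>l. l \<in> mor L \<Longrightarrow> \<phi> (t l) = shift_op l"
    and \<phi>_unique: "\<And>\<psi>. \<lbrakk>\<psi> \<in> star_hom A (BH (L2 fair)); \<forall>l\<in>mor L. \<psi> (t l) = shift_op l\<rbrakk> \<Longrightarrow> \<psi> = \<phi>"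
begin

text \<open>
  Conjugating \<open>\<pi>\<close> gives a *-homomorphism with values \<open>S\<^sub>l\<close> on the generators; the uniqueness part of
  the universal property identifies it with \<open>\<phi>\<close> on all of \<open>A\<close>.
\<close>

lemma representation_intertwined:
  assumes \<pi>: "standard_representation L A t \<mu> \<pi>" and a: "a \<in> carrier A" and u: "u \<in> vectors (L2 \<mu>)"
  shows "density_unitary (\<pi> a u) = \<phi> a (density_unitary u)" "\<pi> a u \<in> vectors (L2 \<mu>)"
proof -
  have hom: "\<pi> \<in> star_hom A (BH (L2 \<mu>))" and gen: "\<And>l. l \<in> mor L \<Longrightarrow> \<pi> (t l) = standard_op l"
    using \<pi> unfolding semibranching_representation_def by blast+
  let ?\<psi> = "\<lambda>a\<in>carrier A. U.conj_op (\<pi> a)"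
  have "?\<psi> = \<phi>"
  proof (rule \<phi>_unique[OF U.star_hom_conj[OF A hom]], rule ballI)
    fix l assume l: "l \<in> mor L"
    show "?\<psi> (t l) = shift_op l" unfolding restrict_apply'[OF t[OF l]] gen[OF l] by (rule conj_op_standard_op[OF l])
  qed
  then have "\<phi> a = U.conj_op (\<pi> a)" using restrict_apply'[OF a, of "\<lambda>a. U.conj_op (\<pi> a)"] by simp
  then show "density_unitary (\<pi> a u) = \<phi> a (density_unitary u)"
    using u by (simp add: U.conj_op_apply U.U_vec U.V_U)
  have "\<pi> a \<in> bounded_operators (L2 \<mu>)"
    using hom a unfolding star_hom_def by (auto simp: BH_def)
  then show "\<pi> a u \<in> vectors (L2 \<mu>)" using U.H.bounded_operatorD(2) u by blast
qed

text \<open>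
  Existence: conjugate \<open>\<phi>\<close> back.  Uniqueness: by intertwining, any two representations become
  equal after applying the injective \<open>density_unitary\<close>.
\<close>

lemma representation_exists_unique: "\<exists>!\<pi>. standard_representation L A t \<mu> \<pi>"
proof (rule ex_ex1I)
  interpret W: unitary_pair "L2 fair" "L2 \<mu>" U.V
    by (intro unitary_pair.intro unitary_pair_axioms.intro L2_hilbert U.unitary_V)
  have WV: "W.V u = density_unitary u" if u: "u \<in> vectors (L2 \<mu>)" for u
    using W.V_U[OF U.U_vec[OF u]] by (simp add: U.V_U u)
  let ?\<pi> = "\<lambda>a\<in>carrier A. W.conj_op (\<phi> a)"
  have "standard_representation L A t \<mu> ?\<pi>"
    unfolding semibranching_representation_def
  proof (intro conjI ballI)
    show "?\<pi> \<in> star_hom A (BH (L2 \<mu>))" by (rule W.star_hom_conj[OF A \<phi>(1)])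
    fix l assume l: "l \<in> mor L"
    have "W.conj_op (shift_op l) = standard_op l"
      unfolding W.conj_op_def
    proof (rule extensionalityI[of _ "vectors (L2 \<mu>)"])
      fix u assume u: "u \<in> vectors (L2 \<mu>)"
      have "U.V (shift_op l (density_unitary u)) = standard_op l u"
        using density_unitary_intertwines[OF l u] U.V_U by metis
      then show "(\<lambda>w\<in>vectors (L2 \<mu>). U.V (shift_op l (W.V w))) u = standard_op l u" using u by (simp add: WV)
    qed (auto simp: semibranching_operator_def)
    then show "?\<pi> (t l) = standard_op l" unfolding restrict_apply'[OF t[OF l]] \<phi>(2)[OF l] .
  qed
  then show "\<exists>\<pi>. standard_representation L A t \<mu> \<pi>" by blast
next
  fix \<pi> \<pi>' assume r: "standard_representation L A t \<mu> \<pi>" "standard_representation L A t \<mu> \<pi>'"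
  have c: "\<pi> \<in> carrier A \<rightarrow>\<^sub>E carrier (BH (L2 \<mu>))" "\<pi>' \<in> carrier A \<rightarrow>\<^sub>E carrier (BH (L2 \<mu>))"
    using r unfolding semibranching_representation_def star_hom_def by blast+
  show "\<pi> = \<pi>'"
  proof (rule PiE_ext[OF c])
    fix a assume a: "a \<in> carrier A"
    show "\<pi> a = \<pi>' a"
    proof (rule U.H.operator_ext)
      show "\<pi> a \<in> bounded_operators (L2 \<mu>)" "\<pi>' a \<in> bounded_operators (L2 \<mu>)"
        using PiE_mem[OF c(1) a] PiE_mem[OF c(2) a] by (simp_all add: BH_def)
      fix u assume u: "u \<in> vectors (L2 \<mu>)"
      note i = representation_intertwined[OF r(1) a u] representation_intertwined[OF r(2) a u]
      show "\<pi> a u = \<pi>' a u" using i U.V_U by metis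
    qed
  qed
qed

end
end

section \<open>The product measures\<close>

lemma unitary_compose:
  assumes "unitary H K U" "unitary K H' W"
  shows "unitary H H' (W \<circ> U)"
  using assms bij_betw_trans unfolding unitary_def linear_on_def by (auto simp: image_subset_iff)

context flip
begin

lemma flip_density_dens:
  assumes "admissible \<gamma>"
  shows "flip_density L v f1 f2 e (dens \<gamma>)"
proof (intro flip_density.intro flip_density_axioms.intro)
  show "flip L v f1 f2 e" by (rule flip_axioms)
  show "prob_space (density fair (\<lambda>x. ennreal (dens \<gamma> x)))"
    using extends_square_weights_iff[OF assms, of "density fair (\<lambda>x. ennreal (dens \<gamma> x))"]
    by (simp add: extends_square_weights_def borel_probability_def)
qed (rule dens_measurable[OF assms], rule dens_pos[OF assms])

lemma flip_density_1: "flip_density L v f1 f2 e (\<lambda>_. 1)"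
  by (intro flip_density.intro flip_density_axioms.intro)
     (simp_all add: flip_axioms density_1 prob_space_fair)

lemma \<mu>_1: "flip_density.\<mu> L v f1 f2 e (\<lambda>_. 1) = fair"
  by (simp add: flip_density.\<mu>_def[OF flip_density_1] density_1)

lemma extends_iff_\<mu>:
  assumes "admissible \<gamma>"
  shows "extends_square_weights L v f1 f2 e \<gamma> \<mu> \<longleftrightarrow> \<mu> = flip_density.\<mu> L v f1 f2 e (dens \<gamma>)"
  unfolding extends_square_weights_iff[OF assms] flip_density.\<mu>_def[OF flip_density_dens[OF assms]] ..

text \<open>
  The representation \<open>\<phi>\<close> on \<open>L\<^sup>2\<close> of the fair measure to which all others are compared.
\<close>

lemma shift_representation:
  assumes univ: "graph_cstar_algebra TYPE(('a, 2) infpath L2_operator) L A t"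
  shows "cstar_algebra A \<and> (\<forall>l\<in>mor L. t l \<in> carrier A) \<and>
    (\<exists>\<phi>. \<phi> \<in> star_hom A (BH (L2 fair)) \<and> (\<forall>l\<in>mor L. \<phi> (t l) = shift_op l) \<and>
      (\<forall>\<psi>. \<psi> \<in> star_hom A (BH (L2 fair)) \<and> (\<forall>l\<in>mor L. \<psi> (t l) = shift_op l) \<longrightarrow> \<psi> = \<phi>))"
proof (intro conjI)
  show "cstar_algebra A" using univ unfolding graph_cstar_algebra_def by (elim conjE)
  have "cuntz_krieger_family L A t" using univ unfolding graph_cstar_algebra_def by (elim conjE)
  then show "\<forall>l\<in>mor L. t l \<in> carrier A" by (simp add: cuntz_krieger_family_def)
  have "\<forall>(B :: ('a, 2) infpath L2_operator cstar_data) s. cstar_algebra B \<and> cuntz_krieger_family L B s \<longrightarrow>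
      (\<exists>!\<phi>. \<phi> \<in> star_hom A B \<and> (\<forall>l\<in>mor L. \<phi> (t l) = s l))"
    using univ unfolding graph_cstar_algebra_def by (elim conjE)
  from this[THEN spec, THEN spec, THEN mp,
      OF conjI[OF hilbert.BH_cstar_algebra[OF L2_hilbert, of fair] shift_op_cuntz_krieger]]
  have "\<exists>!\<phi>. \<phi> \<in> star_hom A (BH (L2 fair)) \<and> (\<forall>l\<in>mor L. \<phi> (t l) = shift_op l)" .
  then show "\<exists>\<phi>. \<phi> \<in> star_hom A (BH (L2 fair)) \<and> (\<forall>l\<in>mor L. \<phi> (t l) = shift_op l) \<and>
      (\<forall>\<psi>. \<psi> \<in> star_hom A (BH (L2 fair)) \<and> (\<forall>l\<in>mor L. \<psi> (t l) = shift_op l) \<longrightarrow> \<psi> = \<phi>)"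
    by (simp only: Ex1_def conj_assoc)
qed

text \<open>
  Both representations are conjugate to the same \<open>\<phi>\<close>; compose one unitary with the inverse of the
  other.
\<close>

lemma density_representations_equivalent:
  assumes D: "flip_density L v f1 f2 e D" and D': "flip_density L v f1 f2 e D'"
    and univ: "graph_cstar_algebra TYPE(('a, 2) infpath L2_operator) L A t"
    and \<pi>: "standard_representation L A t (flip_density.\<mu> L v f1 f2 e D) \<pi>"
    and \<pi>': "standard_representation L A t (flip_density.\<mu> L v f1 f2 e D') \<pi>'"
  shows "unitarily_equivalent A (L2 (flip_density.\<mu> L v f1 f2 e D)) \<pi> (L2 (flip_density.\<mu> L v f1 f2 e D')) \<pi>'"
proof -
  interpret D: flip_density L v f1 f2 e D by (rule D)
  interpret D': flip_density L v f1 f2 e D' by (rule D')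
  obtain \<phi> where A: "cstar_algebra A" and t: "\<And>l. l \<in> mor L \<Longrightarrow> t l \<in> carrier A"
    and \<phi>: "\<phi> \<in> star_hom A (BH (L2 fair))" "\<And>l. l \<in> mor L \<Longrightarrow> \<phi> (t l) = shift_op l"
    "\<And>\<psi>. \<lbrakk>\<psi> \<in> star_hom A (BH (L2 fair)); \<forall>l\<in>mor L. \<psi> (t l) = shift_op l\<rbrakk> \<Longrightarrow> \<psi> = \<phi>"
    using shift_representation[OF univ] by metis
  let ?W = "D'.U.V \<circ> D.density_unitary"
  have "unitary (L2 D.\<mu>) (L2 D'.\<mu>) ?W"
    by (rule unitary_compose[OF D.density_unitary D'.U.unitary_V])
  moreover have "?W (\<pi> a u) = \<pi>' a (?W u)" if a: "a \<in> carrier A" and u: "u \<in> vectors (L2 D.\<mu>)" for a u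
  proof -
    have w: "?W u \<in> vectors (L2 D'.\<mu>)"
      unfolding comp_apply by (rule D'.U.V_vec[OF D.U.U_vec[OF u]])
    have 1: "D.density_unitary (\<pi> a u) = \<phi> a (D.density_unitary u)"
      by (rule D.representation_intertwined(1)[OF A t \<phi> \<pi> a u])
    have 2: "D.density_unitary u = D'.density_unitary (?W u)"
      unfolding comp_apply by (rule D'.U.U_V[OF D.U.U_vec[OF u], symmetric])
    have 3: "D'.density_unitary (\<pi>' a (?W u)) = \<phi> a (D'.density_unitary (?W u))"
      by (rule D'.representation_intertwined(1)[OF A t \<phi> \<pi>' a w])
    have "?W (\<pi> a u) = D'.U.V (\<phi> a (D.density_unitary u))" unfolding comp_apply 1 ..
    also have "\<dots> = D'.U.V (D'.density_unitary (\<pi>' a (?W u)))" unfolding 3 by (rule arg_cong[OF 2])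
    also have "\<dots> = \<pi>' a (?W u)"
      by (rule D'.U.V_U[OF D'.representation_intertwined(2)[OF A t \<phi> \<pi>' a w]])
    finally show ?thesis .
  qed
  ultimately show ?thesis unfolding unitarily_equivalent_def by blast
qed

lemma density_representation_exists_unique:
  assumes D: "flip_density L v f1 f2 e D"
    and univ: "graph_cstar_algebra TYPE(('a, 2) infpath L2_operator) L A t"
  shows "\<exists>!\<pi>. standard_representation L A t (flip_density.\<mu> L v f1 f2 e D) \<pi>"
proof -
  interpret D: flip_density L v f1 f2 e D by (rule D)
  obtain \<phi> where A: "cstar_algebra A" and t: "\<And>l. l \<in> mor L \<Longrightarrow> t l \<in> carrier A"
    and \<phi>: "\<phi> \<in> star_hom A (BH (L2 fair))" "\<And>l. l \<in> mor L \<Longrightarrow> \<phi> (t l) = shift_op l"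
    "\<And>\<psi>. \<lbrakk>\<psi> \<in> star_hom A (BH (L2 fair)); \<forall>l\<in>mor L. \<psi> (t l) = shift_op l\<rbrakk> \<Longrightarrow> \<psi> = \<phi>"
    using shift_representation[OF univ] by metis
  show ?thesis by (rule D.representation_exists_unique[OF A t \<phi>])
qed

end

theorem proposition4p2:
  fixes L :: "('a, 2) kgraph_data"
    and v f1 f2 e :: 'a
    and \<gamma> :: "nat \<Rightarrow> real"
  assumes "flip_graph L v f1 f2 e"
    and "admissible \<gamma>"
  shows
    "(\<exists>!\<mu>. extends_square_weights L v f1 f2 e \<gamma> \<mu>) \<and>
     (\<forall>\<mu>. extends_square_weights L v f1 f2 e \<gamma> \<mu> \<longrightarrow>
        standard_system L \<mu> \<and>
        equivalent_measures \<mu> (pf_measure L) \<and>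
        (\<forall>(A :: 'b cstar_data) t.
           graph_cstar_algebra TYPE(('a, 2) infpath L2_operator) L A t \<longrightarrow>
             (\<exists>!\<pi>. standard_representation L A t \<mu> \<pi>) \<and>
             (\<exists>!\<pi>. standard_representation L A t (pf_measure L) \<pi>) \<and>
             (\<forall>\<pi> \<pi>'. standard_representation L A t \<mu> \<pi> \<and>
                      standard_representation L A t (pf_measure L) \<pi>' \<longrightarrow>
                unitarily_equivalent A (L2 \<mu>) \<pi> (L2 (pf_measure L)) \<pi>') \<and>
             (\<forall>\<gamma>' \<mu>' \<pi> \<pi>'. admissible \<gamma>' \<and> extends_square_weights L v f1 f2 e \<gamma>' \<mu>' \<and>
                  standard_representation L A t \<mu> \<pi> \<and>
                  standard_representation L A t \<mu>' \<pi>' \<longrightarrow>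
                unitarily_equivalent A (L2 \<mu>) \<pi> (L2 \<mu>') \<pi>')))"
proof -
  interpret flip L v f1 f2 e
    using assms(1) by (intro flip.intro flip_axioms.intro) (auto simp: flip_graph_def)
  note D = flip_density_dens[OF assms(2)]
  interpret D: flip_density L v f1 f2 e "dens \<gamma>" by (rule D)
  \<comment> \<open>The Perron--Frobenius measure enters as the case of density 1.\<close>
  have pf: "pf_measure L = flip_density.\<mu> L v f1 f2 e (\<lambda>_. 1)"
    by (simp add: \<mu>_1 pf_measure_flip)
  have eq: "equivalent_measures D.\<mu> (pf_measure L)"
    unfolding pf_measure_flip by (rule D.equivalent_\<mu>_fair)
  have equiv: "unitarily_equivalent A (L2 D.\<mu>) \<pi> (L2 \<mu>') \<pi>'"
    if "graph_cstar_algebra TYPE(('a, 2) infpath L2_operator) L A t" "admissible \<gamma>'"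
      "extends_square_weights L v f1 f2 e \<gamma>' \<mu>'"
      "standard_representation L A t D.\<mu> \<pi>" "standard_representation L A t \<mu>' \<pi>'"
    for A :: "'b cstar_data" and t \<gamma>' \<mu>' \<pi> \<pi>'
    using that(3) density_representations_equivalent[OF D flip_density_dens[OF that(2)] that(1,4), of \<pi>'] that(5)
    unfolding extends_iff_\<mu>[OF that(2)] by blast
  have ex: "\<exists>!\<mu>. \<mu> = D.\<mu>" by blast
  show ?thesis
    unfolding extends_iff_\<mu>[OF assms(2)]
  proof (intro conjI allI impI ex, goal_cases)
    case 1 then show ?case using D.standard_system_\<mu> by simp
  next
    case 2 then show ?case using eq by simp
  next
    case 3 then show ?case using density_representation_exists_unique[OF D 3(2)] by simp
  next
    case 4 show ?case unfolding pf by (rule density_representation_exists_unique[OF flip_density_1 4(2)])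
  next
    case (5 \<mu> A t \<pi> \<pi>')
    then show ?case
      unfolding pf using density_representations_equivalent[OF D flip_density_1 5(2), of \<pi> \<pi>'] by simp
  next
    case (6 \<mu> A t \<gamma>' \<mu>' \<pi> \<pi>')
    then show ?case using equiv[OF 6(2), of \<gamma>' \<mu>' \<pi> \<pi>'] by simp
  qed
qed

end
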